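(* Let $B_1$ be the unit ball of $\mathbb{R}^N$ centered at the origin and, for $r>0$, let $B_r$ be the concentric ball of radius $r$. Let $\alpha>-1$, $\beta\in(0,\alpha+2]$, and let $F:(\mathbb{R}^N\setminus\{0\})\times\mathcal{S}_N\to\mathbb{R}$ satisfy the structural assumptions (with exponent $\alpha$) listed in the context. Let $b:B_1\to\mathbb{R}$ be Lipschitz continuous and let $f,g:B_1\to\mathbb{R}$ be bounded and continuous. Suppose that $u$ is a bounded viscosity subsolution of $$-F(\nabla u,D^2u)+b(x)|\nabla u|^\beta\le g\quad\text{in }B_1$$ and $v$ is a bounded viscosity supersolution of $$-F(\nabla v,D^2v)+b(x)|\nabla v|^\beta\ge f\quad\text{in }B_1.$$ Then for all $r\in(0,1)$ there exists $c_r$ such that for all $(x,y)\in B_r\times B_r$ $$u(x)-v(y)\le\sup_{B_1}(u-v)+c_r|x-y|.$$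
   Context: $\mathcal{S}_N$ is the set of real symmetric $N\times N$ matrices. Structural assumptions on $F$: $F$ is continuous on $(\mathbb{R}^N\setminus\{0\})\times\mathcal{S}_N$; $F$ is homogeneous of degree $\alpha>-1$ in $p$ (i.e. $F(tp,M)=|t|^\alpha F(p,M)$ for $t\in\mathbb{R}\setminus\{0\}$) and positively homogeneous of degree $1$ in $M$; there are constants $A\ge a>0$ such that $a|p|^\alpha\,\mathrm{tr}(N')\le F(p,M+N')-F(p,M)\le A|p|^\alpha\,\mathrm{tr}(N')$ for all $p\neq0$, $M,N'\in\mathcal{S}_N$ with $N'\ge0$; and there is $c>0$ such that $|F(p,M)-F(q,M)|\le c|M|\,\big||p|^\alpha-|q|^\alpha\big|$ for all $p,q\in\mathbb{R}^N\setminus\{0\}$, $M\in\mathcal{S}_N$. Viscosity sub/supersolutions: let $\Omega\subset\mathbb{R}^N$ be open and $h:\Omega\to\mathbb{R}$ continuous. An upper (lower) semicontinuous function $u$ is a viscosity subsolution (supersolution) of $-F(\nabla u,D^2u)+b(x)|\nabla u|^\beta\le h$ (resp. $\ge h$) in $\Omega$ if for every $x_0\in\Omega$: if $u$ is constant in a neighbourhood of $x_0$, then $h(x_0)\ge0$ (resp. $\le0$); otherwise, for every function $\phi$ of class $\mathcal{C}^2$ near $x_0$ such that $u-\phi$ has a local maximum (resp. minimum) at $x_0$ and $\nabla\phi(x_0)\ne0$, one has $-F(\nabla\phi(x_0),D^2\phi(x_0))+b(x_0)|\nabla\phi(x_0)|^\beta\le h(x_0)$ (resp. $\ge h(x_0)$).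 *)

theory Defs
  imports "HOL-Analysis.Analysis"
begin

definition sym_matrices :: "(real^'n^'n) set" where
  "sym_matrices = {M. transpose M = M}"

definition psd :: "real^'n^'n \<Rightarrow> bool" where
  "psd M \<longleftrightarrow> (\<forall>x. 0 \<le> x \<bullet> (M *v x))"

text \<open>
  The operator \<open>F\<close> is a total function here, but every condition only concerns its values
  \<open>F p M\<close> with \<open>p \<noteq> 0\<close> and \<open>M\<close> symmetric. The norm of \<open>M\<close> in the last condition is the Euclidean
  (Frobenius) norm; since \<open>c\<close> is existentially quantified, any other matrix norm gives the same
  condition.
\<close>
definition structural_assms :: "real \<Rightarrow> (real^'n \<Rightarrow> real^'n^'n \<Rightarrow> real) \<Rightarrow> bool" where
  "structural_assms \<alpha> F \<longleftrightarrow>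
     continuous_on ((UNIV - {0}) \<times> sym_matrices) (\<lambda>(p, M). F p M) \<and>
     (\<forall>t p. \<forall>M\<in>sym_matrices. t \<noteq> 0 \<and> p \<noteq> 0 \<longrightarrow> F (t *\<^sub>R p) M = \<bar>t\<bar> powr \<alpha> * F p M) \<and>
     (\<forall>s p. \<forall>M\<in>sym_matrices. s > 0 \<and> p \<noteq> 0 \<longrightarrow> F p (s *\<^sub>R M) = s * F p M) \<and>
     (\<exists>a A. 0 < a \<and> a \<le> A \<and>
        (\<forall>p. \<forall>M\<in>sym_matrices. \<forall>N\<in>sym_matrices. p \<noteq> 0 \<and> psd N \<longrightarrow>
           a * norm p powr \<alpha> * trace N \<le> F p (M + N) - F p M \<and>
           F p (M + N) - F p M \<le> A * norm p powr \<alpha> * trace N)) \<and>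
     (\<exists>c>0. \<forall>p q. \<forall>M\<in>sym_matrices. p \<noteq> 0 \<and> q \<noteq> 0 \<longrightarrow>
        \<bar>F p M - F q M\<bar> \<le> c * norm M * \<bar>norm p powr \<alpha> - norm q powr \<alpha>\<bar>)"

definition usc_on :: "'a::topological_space set \<Rightarrow> ('a \<Rightarrow> real) \<Rightarrow> bool" where
  "usc_on S u \<longleftrightarrow> (\<forall>x\<in>S. \<forall>y. u x < y \<longrightarrow> (\<forall>\<^sub>F z in at x within S. u z < y))"

definition lsc_on :: "'a::topological_space set \<Rightarrow> ('a \<Rightarrow> real) \<Rightarrow> bool" where
  "lsc_on S u \<longleftrightarrow> (\<forall>x\<in>S. \<forall>y. y < u x \<longrightarrow> (\<forall>\<^sub>F z in at x within S. y < u z))"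

text \<open>
  \<open>C2_near \<phi> D H x\<^sub>0\<close>: on a neighbourhood of \<open>x\<^sub>0\<close>, \<open>\<phi>\<close> is of class \<open>C\<^sup>2\<close> with gradient \<open>D\<close> and
  Hessian matrix \<open>H\<close>.
\<close>
definition C2_near ::
  "(real^'n \<Rightarrow> real) \<Rightarrow> (real^'n \<Rightarrow> real^'n) \<Rightarrow> (real^'n \<Rightarrow> real^'n^'n) \<Rightarrow> real^'n \<Rightarrow> bool" where
  "C2_near \<phi> D H x\<^sub>0 \<longleftrightarrow>
     (\<exists>U. open U \<and> x\<^sub>0 \<in> U \<and>
        (\<forall>x\<in>U. GDERIV \<phi> x :> D x) \<and>
        (\<forall>x\<in>U. (D has_derivative (\<lambda>h. H x *v h)) (at x)) \<and>
        continuous_on U H)"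

text \<open>
  In the next two definitions \<open>\<Omega>\<close> is meant to be open, so that neighbourhoods of \<open>x\<^sub>0\<close> may be
  taken inside \<open>\<Omega>\<close> and the values of \<open>u\<close> outside \<open>\<Omega>\<close> are irrelevant.
\<close>
definition viscosity_subsolution ::
  "(real^'n \<Rightarrow> real^'n^'n \<Rightarrow> real) \<Rightarrow> (real^'n \<Rightarrow> real) \<Rightarrow> real \<Rightarrow> (real^'n \<Rightarrow> real) \<Rightarrow>
   (real^'n) set \<Rightarrow> (real^'n \<Rightarrow> real) \<Rightarrow> bool" where
  "viscosity_subsolution F b \<beta> h \<Omega> u \<longleftrightarrow>
     usc_on \<Omega> u \<and>
     (\<forall>x\<^sub>0\<in>\<Omega>.
        if \<forall>\<^sub>F x in nhds x\<^sub>0. u x = u x\<^sub>0 then h x\<^sub>0 \<ge> 0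
        else (\<forall>\<phi> D H. C2_near \<phi> D H x\<^sub>0 \<and>
                (\<forall>\<^sub>F x in nhds x\<^sub>0. u x - \<phi> x \<le> u x\<^sub>0 - \<phi> x\<^sub>0) \<and> D x\<^sub>0 \<noteq> 0 \<longrightarrow>
                - F (D x\<^sub>0) (H x\<^sub>0) + b x\<^sub>0 * norm (D x\<^sub>0) powr \<beta> \<le> h x\<^sub>0))"

definition viscosity_supersolution ::
  "(real^'n \<Rightarrow> real^'n^'n \<Rightarrow> real) \<Rightarrow> (real^'n \<Rightarrow> real) \<Rightarrow> real \<Rightarrow> (real^'n \<Rightarrow> real) \<Rightarrow>
   (real^'n) set \<Rightarrow> (real^'n \<Rightarrow> real) \<Rightarrow> bool" where
  "viscosity_supersolution F b \<beta> h \<Omega> u \<longleftrightarrow>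
     lsc_on \<Omega> u \<and>
     (\<forall>x\<^sub>0\<in>\<Omega>.
        if \<forall>\<^sub>F x in nhds x\<^sub>0. u x = u x\<^sub>0 then h x\<^sub>0 \<le> 0
        else (\<forall>\<phi> D H. C2_near \<phi> D H x\<^sub>0 \<and>
                (\<forall>\<^sub>F x in nhds x\<^sub>0. u x - \<phi> x \<ge> u x\<^sub>0 - \<phi> x\<^sub>0) \<and> D x\<^sub>0 \<noteq> 0 \<longrightarrow>
                - F (D x\<^sub>0) (H x\<^sub>0) + b x\<^sub>0 * norm (D x\<^sub>0) powr \<beta> \<ge> h x\<^sub>0))"

end

theory Submission
  imports Defs
begin

text \<open>
  The proof is the method of Ishii and Lions. Write \<open>S = sup (u - v)\<close>. If the estimate fails at some
  pair of points whose first member is \<open>x0\<close>, then for a concave modulus \<open>\<psi>\<close> with \<open>\<psi> 0 = 0\<close> the function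
  \<open>u x - v y - \<psi> |x - y| - L |x - x0|^2\<close> exceeds \<open>S\<close> somewhere, and \<open>L\<close> and \<open>\<psi>\<close> are taken so large that
  it has an interior maximum \<open>(xb, yb)\<close> (\<open>doubled_maximum\<close>). There \<open>xb \<noteq> yb\<close>, because \<open>u - v \<le> S\<close> on the
  diagonal. Comparing the two equations at such a maximum makes the second derivatives of \<open>u\<close> and
  \<open>v\<close> differ, in the direction of \<open>xb - yb\<close>, by a multiple of \<open>- \<psi>''\<close>; ellipticity turns this into
  a term that all others must balance. The result (\<open>concavity_bound_at_maximum\<close>) is an upper bound for
  \<open>- \<psi>''\<close> at \<open>s = |xb - yb|\<close>, in terms of \<open>\<psi>'\<close>, \<open>s\<close> and \<open>d = |xb - x0|\<close>; a modulus violating that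
  bound gives a contradiction. The term \<open>d / s\<close> of the bound comes from the dependence of \<open>F\<close> on the
  gradient. With only \<open>d \<le> 2\<close> known, the modulus \<open>M \<surd>t\<close> violates the bound for large \<open>M\<close>
  (\<open>holder_step\<close>). The Hoelder estimate so obtained bounds \<open>L d^2\<close> by a multiple of \<open>\<surd>s\<close>, and with
  this the bound is violated by \<open>M (t - (2/5) t^(5/4))\<close>, which is at most \<open>M t\<close> (\<open>lipschitz_step\<close>).

  The comparison at the maximum rests on the theorem on sums (\<open>theorem_on_sums\<close>): \<open>u\<close> and \<open>v\<close> have
  second order test functions at nearby points, with gradients and Hessians controlled by those of
  the penalty. It is proved here for a quadratic penalty, which suffices since \<open>\<psi> |x - y|\<close> lies below its
  second order expansion up to a small quadratic error. One replaces \<open>u\<close> and \<open>- v\<close> by their sup-convolutions,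
  which have a paraboloid below their graph at every point, and looks for a point where the sum minus the
  penalty lies below a plane and both functions have second order expansions
  (\<open>peano2_at_contact_point\<close>).

  Such a point is found without Aleksandrov's theorem. On the set \<open>K\<close> of points touched from above by planes
  of small slope, the function is caught between a plane and a paraboloid, so the slope is
  Lipschitz on \<open>K\<close> and attains every small value; hence \<open>K\<close> is not negligible. Rademacher's theorem,
  applied to a Lipschitz extension of the slope and to the distance from \<open>K\<close>, gives a point of \<open>K\<close> where
  the slope is differentiable and where \<open>K\<close> is so dense that the second order expansion can be summed along
  chains of points of \<open>K\<close>. Rademacher's theorem follows from its one-dimensional case, which is the
  Radon-Nikodym theorem, by averaging over small cubes at common Lebesgue points of the partial
  derivatives.
\<close>

section \<open>Lipschitz functions of one real variable\<close>

text \<open>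
  The limit need not exist; clamping to \<open>[- L, L]\<close> keeps the function bounded, and it stays Borel
  measurable in \<open>t\<close> and, later, in base points of lines.
\<close>
definition right_deriv :: "real \<Rightarrow> (real \<Rightarrow> real) \<Rightarrow> real \<Rightarrow> real" where
  "right_deriv L f t =
     max (- L) (min L (lim (\<lambda>n. real (Suc n) * (f (t + 1 / real (Suc n)) - f t))))"

text \<open>
  Adding \<open>(L + 1) t\<close> turns \<open>f\<close> into a bi-Lipschitz increasing bijection \<open>\<phi>\<close> of the line. The measure
  \<open>A \<mapsto> |\<phi> ` A|\<close> is then absolutely continuous, its Radon-Nikodym density integrates to the increments
  of \<open>\<phi>\<close>, and by Lebesgue differentiation it is almost everywhere the derivative of \<open>\<phi>\<close>.
\<close>
lemma lipschitz_has_integral_derivative: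
  fixes f :: "real \<Rightarrow> real"
  assumes L: "L-lipschitz_on UNIV f"
  obtains \<gamma> N where "negligible N" "\<And>t. t \<notin> N \<Longrightarrow> right_deriv L f t = \<gamma> t"
    "\<And>a b. a \<le> b \<Longrightarrow> (\<gamma> has_integral (f b - f a)) {a..b}"
proof -
  have L0: "0 \<le> L" using L by (rule lipschitz_on_nonneg)
  have lip: "\<bar>f x - f y\<bar> \<le> L * \<bar>x - y\<bar>" for x y
    using lipschitz_onD[OF L, of x y] by (simp add: dist_real_def)
  define \<phi> where "\<phi> = (\<lambda>t. f t + (L + 1) * t)"
  have expand: "b - a \<le> \<phi> b - \<phi> a" and contract: "\<phi> b - \<phi> a \<le> (2*L+1) * (b - a)" if "a \<le> b" for a b
    using lip[of b a] that by (auto simp: \<phi>_def abs_le_iff algebra_simps)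
  have cont_f: "continuous_on S f" for S
    using lipschitz_on_continuous_on[OF L] continuous_on_subset by blast
  have cont\<phi>: "continuous_on S \<phi>" for S
    unfolding \<phi>_def by (intro continuous_intros cont_f)
  have inj: "inj \<phi>"
    by (rule linorder_injI) (use expand in \<open>smt (verit)\<close>)
  have surj: "surj \<phi>"
  proof -
    have "\<exists>x. \<phi> x = y" for y
    proof -
      define c where "c = \<bar>y - \<phi> 0\<bar> + 1"
      have c: "c > 0" by (simp add: c_def)
      have "\<phi> (- c) \<le> y" "y \<le> \<phi> c"
        using expand[of 0 c] expand[of "-c" 0] c by (auto simp: c_def abs_if split: if_splits)
      moreover have "continuous_on {-c..c} \<phi>" by (rule cont\<phi>)
      ultimately show ?thesis using IVT'[of \<phi> "-c" y c] c by auto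
    qed
    then show ?thesis by (metis surj_def)
  qed
  define \<psi> where "\<psi> = inv \<phi>"
  have \<phi>\<psi>: "\<phi> (\<psi> y) = y" and \<psi>\<phi>: "\<psi> (\<phi> x) = x" for x y
    by (simp_all add: \<psi>_def surj_f_inv_f[OF surj] inv_f_f[OF inj])
  have mono_iff: "\<phi> a \<le> \<phi> b \<longleftrightarrow> a \<le> b" for a b
    using expand[of a b] expand[of b a] by linarith
  have "1-lipschitz_on UNIV \<psi>"
  proof (rule lipschitz_onI)
    fix x y
    show "dist (\<psi> x) (\<psi> y) \<le> 1 * dist x y"
      using expand[of "\<psi> x" "\<psi> y"] expand[of "\<psi> y" "\<psi> x"]
      by (cases "\<psi> x \<le> \<psi> y") (auto simp: dist_real_def \<phi>\<psi> abs_if)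
  qed simp
  then have "continuous_on UNIV \<psi>" by (rule lipschitz_on_continuous_on)
  then have meas\<psi>[measurable]: "\<psi> \<in> borel_measurable borel"
    by (rule borel_measurable_continuous_onI)
  \<comment> \<open>the Stieltjes measure of \<open>\<phi>\<close>\<close>
  define \<mu> where "\<mu> = distr lborel borel \<psi>"
  have em: "emeasure \<mu> A = emeasure lborel (\<phi> ` A)" if [measurable]: "A \<in> sets borel" for A
  proof -
    have "\<psi> -` A = \<phi> ` A"
      using \<phi>\<psi> \<psi>\<phi> by (auto intro!: image_eqI)
    then show ?thesis by (simp add: \<mu>_def emeasure_distr)
  qed
  have bor: "\<phi> ` A \<in> sets borel" if "A \<in> sets borel" for A
  proof -
    have "\<psi> -` A = \<phi> ` A"
      using \<phi>\<psi> \<psi>\<phi> by (auto intro!: image_eqI)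
    then show ?thesis using measurable_sets[OF meas\<psi> that] by simp
  qed
  have "absolutely_continuous lborel \<mu>"
    unfolding absolutely_continuous_def
  proof
    fix A assume "A \<in> null_sets (lborel :: real measure)"
    then have A: "A \<in> sets borel" and negA: "negligible A"
      by (auto simp: negligible_iff_null_sets null_sets_completionI)
    have "negligible (\<phi> ` A)"
    proof (rule negligible_locally_Lipschitz_image[OF _ negA])
      fix x
      have "norm (\<phi> y - \<phi> x) \<le> (2*L+1) * norm (y - x)" for y
        using contract[of x y] contract[of y x] expand[of x y] expand[of y x] L0
        by (cases "x \<le> y") (auto simp: abs_if)
      then show "\<exists>T B. open T \<and> x \<in> T \<and> (\<forall>y\<in>A \<inter> T. norm (\<phi> y - \<phi> x) \<le> B * norm (y - x))"
        by (intro exI[of _ UNIV] exI[of _ "2*L+1"]) auto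
    qed simp
    then have "emeasure lborel (\<phi> ` A) = 0"
      using bor[OF A] by (metis emeasure_lborel_countable negligible_iff_emeasure0 emeasure_completion
          negligible_imp_sets sets_lborel main_part_sets lborel_def null_setsD1 negligible_iff_null_sets null_sets_completion_iff)
    then show "A \<in> null_sets \<mu>"
      using em[OF A] A by (auto simp: null_sets_def \<mu>_def)
  qed
  then obtain \<delta> where \<delta>[measurable]: "\<delta> \<in> borel_measurable lborel" and dens: "density lborel \<delta> = \<mu>"
    using sigma_finite_measure.Radon_Nikodym[OF lborel.sigma_finite_measure_axioms, of \<mu>] by (auto simp: \<mu>_def)
  have int\<delta>: "(\<integral>\<^sup>+t. \<delta> t * indicator {a..b} t \<partial>lborel) = ennreal (\<phi> b - \<phi> a)" if "a \<le> b" for a b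
  proof -
    have "\<phi> ` {a..b} = {\<phi> a..\<phi> b}"
      using mono_iff \<phi>\<psi> by (auto intro!: image_eqI[where x="\<psi> _"]) (metis mono_iff \<phi>\<psi>)+
    then have "emeasure \<mu> {a..b} = ennreal (\<phi> b - \<phi> a)"
      using em[of "{a..b}"] mono_iff that by simp
    then show ?thesis by (simp add: dens[symmetric] emeasure_density)
  qed
  have fin: "AE t in lborel. t \<in> {a..b} \<longrightarrow> \<delta> t \<noteq> \<infinity>" for a b
  proof (cases "a \<le> b")
    case True
    have "AE t in lborel. \<delta> t * indicator {a..b} t \<noteq> \<infinity>"
      by (rule nn_integral_PInf_AE) (use int\<delta>[OF True] in auto)
    then show ?thesis by eventually_elim (auto simp: indicator_def)
  qed auto
  define \<gamma>1 where "\<gamma>1 = (\<lambda>t. enn2real (\<delta> t))"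
  have [measurable]: "\<gamma>1 \<in> borel_measurable borel" unfolding \<gamma>1_def by measurable
  have hi: "(\<gamma>1 has_integral (\<phi> b - \<phi> a)) {a..b}" if ab: "a \<le> b" for a b
  proof -
    have "(\<integral>\<^sup>+t. ennreal (\<gamma>1 t * indicator {a..b} t) \<partial>lborel) = (\<integral>\<^sup>+t. \<delta> t * indicator {a..b} t \<partial>lborel)"
      by (rule nn_integral_cong_AE, use fin[of a b] in eventually_elim)
        (auto simp: \<gamma>1_def indicator_def less_top)
    then have "((\<lambda>t. \<gamma>1 t * indicator {a..b} t) has_integral (\<phi> b - \<phi> a)) UNIV"
      by (intro nn_integral_has_integral) (use expand[OF ab] ab in \<open>auto simp: int\<delta> \<gamma>1_def\<close>)
    then show ?thesis
      by (subst has_integral_restrict_UNIV[symmetric]) (simp add: indicator_def of_bool_def if_distrib cong: if_cong)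
  qed
  have "\<gamma>1 integrable_on cbox a b" for a b :: real
  proof (cases "a \<le> b")
    case True then show ?thesis using hi[OF True] by (auto simp: integrable_on_def)
  qed (auto simp: integrable_on_empty)
  from integrable_ccontinuous_explicit[of \<gamma>1, OF this] obtain N where N: "negligible N"
    and conv: "\<And>x e. \<lbrakk>x \<notin> N; 0 < e\<rbrakk> \<Longrightarrow> \<exists>d>0. \<forall>h. 0 < h \<and> h < d \<longrightarrow>
         norm (integral (cbox x (x + h *\<^sub>R One)) \<gamma>1 /\<^sub>R h ^ DIM(real) - \<gamma>1 x) < e" by blast
  define \<gamma> where "\<gamma> = (\<lambda>t. \<gamma>1 t - (L + 1))"
  show thesis
  proof
    show "negligible N" by fact
    show "(\<gamma> has_integral (f b - f a)) {a..b}" if ab: "a \<le> b" for a b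
    proof -
      have "(\<gamma> has_integral ((\<phi> b - \<phi> a) - (b - a) *\<^sub>R (L+1))) {a..b}"
        unfolding \<gamma>_def using has_integral_const_real[of "L+1" a b] ab
        by (intro has_integral_diff hi ab) auto
      then show ?thesis by (simp add: \<phi>_def algebra_simps)
    qed
    show "right_deriv L f t = \<gamma> t" if t: "t \<notin> N" for t
    proof -
      define q where "q = (\<lambda>n. real (Suc n) * (f (t + 1 / real (Suc n)) - f t))"
      have qL: "\<bar>q n\<bar> \<le> L" for n
        using lip[of "t + 1 / real (Suc n)" t] unfolding q_def
        by (simp add: abs_mult pos_le_divide_eq mult.commute)
      have "q \<longlonglongrightarrow> \<gamma> t"
      proof (rule LIMSEQ_I)
        fix e :: real assume "0 < e"
        from conv[OF t this] obtain d where d: "d > 0"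
          "\<And>h. 0 < h \<Longrightarrow> h < d \<Longrightarrow> norm (integral (cbox t (t + h *\<^sub>R One)) \<gamma>1 /\<^sub>R h ^ DIM(real) - \<gamma>1 t) < e" by blast
        obtain n0 where n0: "inverse (real (Suc n0)) < d" using d(1) reals_Archimedean by blast
        have "norm (q n - \<gamma> t) < e" if "n \<ge> n0" for n
        proof -
          define h where "h = 1 / real (Suc n)"
          have h: "0 < h" by (simp add: h_def)
          have "h \<le> inverse (real (Suc n0))" unfolding h_def inverse_eq_divide
            by (rule divide_left_mono) (use that in auto)
          then have "h < d" using n0 by simp
          from d(2)[OF h this] have "\<bar>(\<phi> (t + h) - \<phi> t) / h - \<gamma>1 t\<bar> < e"
            using integral_unique[OF hi[of t "t+h"]] h by (simp add: divide_inverse mult.commute)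
          moreover have "(\<phi> (t + h) - \<phi> t) / h = q n + (L + 1)"
            using h unfolding \<phi>_def q_def h_def by (simp add: field_simps)
          ultimately show ?thesis by (simp add: \<gamma>_def)
        qed
        then show "\<exists>n0. \<forall>n\<ge>n0. norm (q n - \<gamma> t) < e" by blast
      qed
      moreover from this have "\<bar>\<gamma> t\<bar> \<le> L"
        using LIMSEQ_le_const2[OF tendsto_rabs, of q "\<gamma> t" L] qL by blast
      ultimately show ?thesis
        using limI[of q "\<gamma> t"] unfolding right_deriv_def q_def[symmetric] by (auto simp: abs_le_iff)
    qed
  qed
qed

text \<open>
  This is the only form in which the derivative along lines is used: how far \<open>f\<close> is from the affine
  function of slope \<open>c\<close> is measured by an integral, to which Tonelli's theorem applies.
\<close>
lemma lipschitz_increment_le: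
  fixes f :: "real \<Rightarrow> real"
  assumes L: "L-lipschitz_on UNIV f" and ab: "a \<le> b"
  shows "ennreal \<bar>f b - f a - c * (b - a)\<bar>
    \<le> (\<integral>\<^sup>+t. ennreal \<bar>right_deriv L f t - c\<bar> * indicator {a..b} t \<partial>lborel)"
proof -
  from lipschitz_has_integral_derivative[OF L] obtain \<gamma> N where N: "negligible N"
    and eq: "\<And>t. t \<notin> N \<Longrightarrow> right_deriv L f t = \<gamma> t"
    and hi: "\<And>a b. a \<le> b \<Longrightarrow> (\<gamma> has_integral (f b - f a)) {a..b}" by metis
  have cont: "continuous_on UNIV f" using L by (rule lipschitz_on_continuous_on)
  have [measurable]: "f \<in> borel_measurable borel" using cont by (rule borel_measurable_continuous_onI)
  have meas[measurable]: "right_deriv L f \<in> borel_measurable borel"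
    unfolding right_deriv_def[abs_def] by measurable
  have "((\<lambda>t. right_deriv L f t - c) has_integral ((f b - f a) - (b - a) *\<^sub>R c)) {a..b}"
    using has_integral_const_real[of c a b] ab
    by (intro has_integral_diff has_integral_spike[OF N _ hi[OF ab]]) (auto simp: eq)
  then have hi': "((\<lambda>t. right_deriv L f t - c) has_integral (f b - f a - c * (b - a))) {a..b}"
    by (simp add: algebra_simps)
  have bd: "\<bar>right_deriv L f t - c\<bar> \<le> L + \<bar>c\<bar>" for t
    using lipschitz_on_nonneg[OF L] unfolding right_deriv_def by (auto simp: max_def min_def abs_if)
  have int: "(\<lambda>t. right_deriv L f t - c) absolutely_integrable_on {a..b}"
  proof (rule measurable_bounded_by_integrable_imp_absolutely_integrable[where g="\<lambda>_. L + \<bar>c\<bar>"])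
    show "(\<lambda>t. right_deriv L f t - c) \<in> borel_measurable (lebesgue_on {a..b})"
      by (intro measurable_restrict_space1 measurable_completion) measurable
  qed (use bd in auto)
  then have abs_int: "(\<lambda>t. \<bar>right_deriv L f t - c\<bar>) integrable_on {a..b}"
    by (simp add: absolutely_integrable_on_def)
  have "ennreal \<bar>f b - f a - c * (b - a)\<bar> \<le> ennreal (integral {a..b} (\<lambda>t. \<bar>right_deriv L f t - c\<bar>))"
    using integral_norm_bound_integral[of "\<lambda>t. right_deriv L f t - c" "{a..b}" "\<lambda>t. \<bar>right_deriv L f t - c\<bar>"]
      hi' abs_int integral_unique[OF hi'] by (intro ennreal_leI) (auto simp: has_integral_integrable)
  also have "ennreal (integral {a..b} (\<lambda>t. \<bar>right_deriv L f t - c\<bar>)) =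
     (\<integral>\<^sup>+t. ennreal \<bar>right_deriv L f t - c\<bar> * indicator {a..b} t \<partial>lborel)"
  proof (rule set_nn_integral_lborel_eq_integral[symmetric])
    have "(\<integral>\<^sup>+t\<in>{a..b}. ennreal \<bar>right_deriv L f t - c\<bar> \<partial>lborel)
        \<le> (\<integral>\<^sup>+t\<in>{a..b}. ennreal (L + \<bar>c\<bar>) \<partial>lborel)"
      by (intro nn_integral_mono mult_right_mono ennreal_leI bd) auto
    also have "\<dots> < \<infinity>" using ab by (simp add: nn_integral_cmult_indicator ennreal_mult_less_top)
    finally show "(\<integral>\<^sup>+t\<in>{a..b}. ennreal \<bar>right_deriv L f t - c\<bar> \<partial>lborel) < \<infinity>" .
  qed (auto simp: set_borel_measurable_def)
  finally show ?thesis .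
qed

section \<open>Rademacher's theorem\<close>

text \<open>
  The reflection that changes the sign of the coordinates in \<open>B\<close>; as \<open>B\<close> varies these maps carry the
  positive orthant onto all orthants.
\<close>
definition flip :: "'a::euclidean_space set \<Rightarrow> 'a \<Rightarrow> 'a" where
  "flip B x = (\<Sum>i\<in>Basis. (if i \<in> B then - (x \<bullet> i) else x \<bullet> i) *\<^sub>R i)"

lemma flip_inner: "i \<in> Basis \<Longrightarrow> flip B x \<bullet> i = (if i \<in> B then - (x \<bullet> i) else x \<bullet> i)"
  unfolding flip_def by simp

lemma flip_flip [simp]: "flip B (flip B x) = x"
  by (rule euclidean_eqI) (simp add: flip_inner)

lemma linear_flip: "linear (flip B)"
  by (rule linearI; rule euclidean_eqI) (auto simp: flip_inner inner_add_left)

lemma flip_basis: "i \<in> Basis \<Longrightarrow> flip B (t *\<^sub>R i) = (if i \<in> B then - t else t) *\<^sub>R i"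
  by (rule euclidean_eqI) (auto simp: flip_inner inner_Basis)

lemma norm_flip [simp]: "norm (flip B x) = norm x"
  by (subst (1 2) norm_eq_sqrt_inner, subst (1 2) euclidean_inner)
     (auto intro!: sum.cong arg_cong[where f=sqrt] simp: flip_inner)

lemma measurable_flip [measurable]: "flip B \<in> borel_measurable borel"
  by (intro borel_measurable_continuous_onI linear_continuous_on linear_conv_bounded_linear[THEN iffD1] linear_flip)

text \<open>
  Lebesgue differentiation is applied to averages over cubes with lower corner \<open>x\<close>. Composing \<open>g\<close>
  with the reflections gives cubes in every orthant at \<open>x\<close>, and letting \<open>q\<close> range over the rationals upgrades the
  convergence of averages of \<open>g\<close> to that of averages of \<open>|g - g x|\<close>.
\<close>
lemma AE_negligible_orthant_Lebesgue_point:
  fixes g :: "'a::euclidean_space \<Rightarrow> real"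
  assumes [measurable]: "g \<in> borel_measurable borel" and bd: "\<And>x. \<bar>g x\<bar> \<le> C"
  obtains N where "negligible N"
    "\<And>x B e. x \<notin> N \<Longrightarrow> B \<subseteq> Basis \<Longrightarrow> 0 < e \<Longrightarrow>
      \<exists>d>0. \<forall>h. 0 < h \<and> h < d \<longrightarrow>
        (\<integral>\<^sup>+y\<in>cbox 0 (h *\<^sub>R One). ennreal \<bar>g (x + flip B y) - g x\<bar> \<partial>lborel) \<le> ennreal (e * h ^ DIM('a))"
proof -
  have int: "(\<lambda>z. \<bar>g (flip B z) - q\<bar>) integrable_on cbox a b" for B q and a b :: 'a
    by (rule measurable_bounded_by_integrable_imp_integrable_real[where g="\<lambda>_. C + \<bar>q\<bar>"])
      (use abs_triangle_ineq4 bd in \<open>auto intro!: measurable_restrict_space1 measurable_completion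
         intro: order_trans[OF abs_triangle_ineq4] add_mono\<close>)
  have "\<exists>N. negligible N \<and> (\<forall>x e. x \<notin> N \<longrightarrow> 0 < e \<longrightarrow>
        (\<exists>d>0. \<forall>h. 0 < h \<and> h < d \<longrightarrow>
           norm (integral (cbox x (x + h *\<^sub>R One)) (\<lambda>z. \<bar>g (flip B z) - q\<bar>) /\<^sub>R h ^ DIM('a)
                 - \<bar>g (flip B x) - q\<bar>) < e))" for B :: "'a set" and q
    by (rule integrable_ccontinuous_explicit[OF int[of B q]]) blast
  then obtain N where N: "\<And>B q. negligible (N B q)" and
    conv: "\<And>B q x e. x \<notin> N B q \<Longrightarrow> 0 < e \<Longrightarrow> \<exists>d>0. \<forall>h. 0 < h \<and> h < d \<longrightarrow>
           norm (integral (cbox x (x + h *\<^sub>R One)) (\<lambda>z. \<bar>g (flip B z) - q\<bar>) /\<^sub>R h ^ DIM('a)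
                 - \<bar>g (flip B x) - q\<bar>) < e" by metis
  show thesis
  proof
    define M where "M = (\<Union>B\<in>Pow Basis. \<Union>q\<in>\<rat>. flip B ` N B q)"
    have "negligible (flip B ` N B q)" for B q
      by (rule negligible_locally_Lipschitz_image[OF order_refl N])
        (auto intro!: exI[of _ UNIV] exI[of _ 1] simp flip: linear_diff[OF linear_flip])
    then show "negligible M"
      unfolding M_def by (intro negligible_countable_Union countable_image countable_rat ballI)
         (auto intro!: negligible_countable_Union countable_image countable_rat intro: countable_finite)
    fix x :: 'a and B :: "'a set" and e assume x: "x \<notin> M" and B: "B \<subseteq> Basis" and e: "(0::real) < e"
    define z where "z = flip B x"
    obtain q where q: "q \<in> \<rat>" "\<bar>g x - q\<bar> < e / 3"
    proof -
      obtain q where "q \<in> \<rat>" "g x < q" "q < g x + e / 3"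
        using Rats_dense_in_real[of "g x" "g x + e/3"] e by fastforce
      then show ?thesis by (intro that[of q]) auto
    qed
    have "z \<notin> N B q"
    proof
      assume "z \<in> N B q"
      then have "x \<in> flip B ` N B q" by (intro image_eqI[where x=z]) (simp_all add: z_def)
      then show False using x B q(1) by (auto simp: M_def)
    qed
    moreover have "0 < e / 3" using e by simp
    ultimately obtain d where d: "d > 0" and
      dh: "\<And>h. 0 < h \<Longrightarrow> h < d \<Longrightarrow> norm (integral (cbox z (z + h *\<^sub>R One)) (\<lambda>z. \<bar>g (flip B z) - q\<bar>) /\<^sub>R h ^ DIM('a)
                 - \<bar>g (flip B z) - q\<bar>) < e/3"
      using conv[of z B q "e/3"] by blast
    have fz: "flip B z = x" by (simp add: z_def)
    have "(\<integral>\<^sup>+y\<in>cbox 0 (h *\<^sub>R One). ennreal \<bar>g (x + flip B y) - g x\<bar> \<partial>lborel) \<le> ennreal (e * h ^ DIM('a))"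
      if h: "0 < h" "h < d" for h
    proof -
      let ?I = "integral (cbox z (z + h *\<^sub>R One)) (\<lambda>z. \<bar>g (flip B z) - q\<bar>)"
      have nni: "(\<integral>\<^sup>+y\<in>cbox z (z + h *\<^sub>R One). ennreal \<bar>g (flip B y) - q\<bar> \<partial>lborel) = ennreal ?I"
      proof (rule set_nn_integral_lborel_eq_integral)
        have "(\<integral>\<^sup>+y\<in>cbox z (z + h *\<^sub>R One). ennreal \<bar>g (flip B y) - q\<bar> \<partial>lborel)
            \<le> (\<integral>\<^sup>+y\<in>cbox z (z + h *\<^sub>R One). ennreal (C + \<bar>q\<bar>) \<partial>lborel)"
          by (intro nn_integral_mono mult_right_mono ennreal_leI order_trans[OF abs_triangle_ineq4] add_mono bd) auto
        also have "\<dots> < \<infinity>" by (simp add: nn_integral_cmult_indicator ennreal_mult_less_top emeasure_lborel_cbox_eq)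
        finally show "(\<integral>\<^sup>+y\<in>cbox z (z + h *\<^sub>R One). ennreal \<bar>g (flip B y) - q\<bar> \<partial>lborel) < \<infinity>" .
      qed (auto simp: set_borel_measurable_def)
      have hm: "0 < h ^ DIM('a)" using h by simp
      have "norm (?I /\<^sub>R h ^ DIM('a) - \<bar>g x - q\<bar>) < e/3" using dh[OF h] by (simp add: fz)
      then have "inverse (h ^ DIM('a)) * ?I < 2 * e / 3" using q(2)
        unfolding real_norm_def real_scaleR_def abs_less_iff by linarith
      then have "?I / h ^ DIM('a) < 2 * e / 3" by (simp only: divide_inverse_commute)
      then have I: "?I \<le> 2 * e / 3 * h ^ DIM('a)" using hm by (simp only: pos_divide_less_eq less_imp_le)
      have "(\<integral>\<^sup>+y\<in>cbox 0 (h *\<^sub>R One). ennreal \<bar>g (x + flip B y) - g x\<bar> \<partial>lborel)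
         \<le> (\<integral>\<^sup>+y\<in>cbox 0 (h *\<^sub>R One). ennreal \<bar>g (flip B (z + y)) - q\<bar> + ennreal (e/3) \<partial>lborel)"
      proof (intro nn_integral_mono mult_right_mono)
        fix y
        have "\<bar>g (x + flip B y) - g x\<bar> \<le> \<bar>g (flip B (z + y)) - q\<bar> + e/3"
          using q(2) unfolding linear_add[OF linear_flip] fz by linarith
        then show "ennreal \<bar>g (x + flip B y) - g x\<bar> \<le> ennreal \<bar>g (flip B (z + y)) - q\<bar> + ennreal (e/3)"
          using e by (simp flip: ennreal_plus add: ennreal_leI)
      qed auto
      also have "\<dots> = (\<integral>\<^sup>+y\<in>cbox 0 (h *\<^sub>R One). ennreal \<bar>g (flip B (z + y)) - q\<bar> \<partial>lborel)
          + (\<integral>\<^sup>+y\<in>cbox 0 (h *\<^sub>R (One::'a)). ennreal (e/3) \<partial>lborel)"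
        by (subst nn_integral_add[symmetric]) (auto simp: distrib_right)
      also have "(\<integral>\<^sup>+y\<in>cbox 0 (h *\<^sub>R (One::'a)). ennreal (e/3) \<partial>lborel) = ennreal (e/3 * h ^ DIM('a))"
        using h e by (simp add: nn_integral_cmult_indicator emeasure_lborel_cbox_eq ennreal_mult[symmetric])
      also have "(\<integral>\<^sup>+y\<in>cbox 0 (h *\<^sub>R One). ennreal \<bar>g (flip B (z + y)) - q\<bar> \<partial>lborel)
          = (\<integral>\<^sup>+y\<in>cbox z (z + h *\<^sub>R One). ennreal \<bar>g (flip B y) - q\<bar> \<partial>lborel)"
      proof -
        have "(\<integral>\<^sup>+y\<in>cbox z (z + h *\<^sub>R One). ennreal \<bar>g (flip B y) - q\<bar> \<partial>lborel)
          = (\<integral>\<^sup>+y\<in>cbox z (z + h *\<^sub>R One). ennreal \<bar>g (flip B y) - q\<bar> \<partial>(distr lborel borel ((+) z)))"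
          by (simp only: lborel_distr_plus)
        also have "\<dots> = (\<integral>\<^sup>+y\<in>cbox 0 (h *\<^sub>R One). ennreal \<bar>g (flip B (z + y)) - q\<bar> \<partial>lborel)"
          by (subst nn_integral_distr) (auto intro!: nn_integral_cong simp: indicator_def mem_box inner_add_left)
        finally show ?thesis by simp
      qed
      also have "\<dots> \<le> ennreal (2 * e / 3 * h ^ DIM('a))" unfolding nni by (rule ennreal_leI[OF I])
      finally have "(\<integral>\<^sup>+y\<in>cbox 0 (h *\<^sub>R One). ennreal \<bar>g (x + flip B y) - g x\<bar> \<partial>lborel)
          \<le> ennreal (2 * e / 3 * h ^ DIM('a)) + ennreal (e/3 * h ^ DIM('a))"
        by (simp add: add_mono)
      also have "\<dots> = ennreal (e * h ^ DIM('a))"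
        using e h by (subst ennreal_plus[symmetric]) (auto simp: field_simps)
      finally show ?thesis .
    qed
    with d show "\<exists>d>0. \<forall>h. 0 < h \<and> h < d \<longrightarrow>
        (\<integral>\<^sup>+y\<in>cbox 0 (h *\<^sub>R One). ennreal \<bar>g (x + flip B y) - g x\<bar> \<partial>lborel) \<le> ennreal (e * h ^ DIM('a))"
      by blast
  qed
qed

text \<open>
  The increment of \<open>F\<close> by \<open>\<kappa>\<close> is a sum of increments along coordinate axes. Averaged over the starting point,
  each of these is an integral over translates of a small cube, all contained in the cube of side
  \<open>2 h\<close>. The induction adds one axis at a time.
\<close>
lemma averaged_increment_le:
  fixes F :: "'a::euclidean_space \<Rightarrow> real" and G :: "'a \<Rightarrow> 'a \<Rightarrow> real"
  assumes F[measurable]: "F \<in> borel_measurable borel"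
    and G[measurable]: "\<And>i. G i \<in> borel_measurable borel"
    and inc: "\<And>i y t. i \<in> Basis \<Longrightarrow> 0 \<le> t \<Longrightarrow> ennreal \<bar>F (y + t *\<^sub>R i) - F y - c i * t\<bar>
        \<le> (\<integral>\<^sup>+s. ennreal \<bar>G i (y + s *\<^sub>R i) - c i\<bar> * indicator {0..t} s \<partial>lborel)"
    and \<kappa>: "\<And>i. i \<in> Basis \<Longrightarrow> 0 \<le> \<kappa> \<bullet> i \<and> \<kappa> \<bullet> i \<le> h" and \<delta>: "0 \<le> \<delta>" "\<delta> \<le> h"
    and S: "S \<subseteq> Basis"
  shows "(\<integral>\<^sup>+\<eta>\<in>cbox 0 (\<delta> *\<^sub>R One). ennreal \<bar>F (\<eta> + (\<Sum>i\<in>S. (\<kappa> \<bullet> i) *\<^sub>R i)) - F \<eta> - (\<Sum>i\<in>S. c i * (\<kappa> \<bullet> i))\<bar> \<partial>lborel)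
    \<le> ennreal h * (\<Sum>i\<in>S. \<integral>\<^sup>+z\<in>cbox 0 ((2 * h) *\<^sub>R One). ennreal \<bar>G i z - c i\<bar> \<partial>lborel)"
proof -
  let ?Q = "cbox 0 (\<delta> *\<^sub>R One) :: 'a set"
  let ?I = "\<lambda>i. \<integral>\<^sup>+z\<in>cbox 0 ((2 * h) *\<^sub>R One). ennreal \<bar>G i z - c i\<bar> \<partial>lborel"
  have "finite S" using S finite_Basis finite_subset by blast
  then show ?thesis using S
  proof induction
    case (insert j S)
    let ?\<kappa> = "\<Sum>i\<in>S. (\<kappa> \<bullet> i) *\<^sub>R i"
    have j: "j \<in> Basis" and S: "S \<subseteq> Basis" using insert.prems by auto
    have \<kappa>S: "0 \<le> ?\<kappa> \<bullet> i \<and> ?\<kappa> \<bullet> i \<le> h \<and> (i = j \<longrightarrow> ?\<kappa> \<bullet> i = 0)" if "i \<in> Basis" for i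
    proof -
      have "?\<kappa> \<bullet> i = (\<Sum>k\<in>S. if k = i then \<kappa> \<bullet> i else 0)"
        unfolding inner_sum_left by (rule sum.cong) (use that S in \<open>auto simp: inner_Basis subset_iff\<close>)
      also have "\<dots> = (if i \<in> S then \<kappa> \<bullet> i else 0)" using insert.hyps(1) by simp
      finally show ?thesis using \<kappa>[OF that] insert.hyps(2) by auto
    qed
    have shift: "(\<integral>\<^sup>+\<eta>\<in>?Q. ennreal \<bar>G j (\<eta> + ?\<kappa> + s *\<^sub>R j) - c j\<bar> \<partial>lborel) \<le> ?I j"
      if s: "0 \<le> s" "s \<le> \<kappa> \<bullet> j" for s
    proof -
      let ?v = "?\<kappa> + s *\<^sub>R j"
      have sub: "?v + \<eta> \<in> cbox 0 ((2 * h) *\<^sub>R One)" if "\<eta> \<in> ?Q" for \<eta>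
      proof -
        have "0 \<le> (?v + \<eta>) \<bullet> i \<and> (?v + \<eta>) \<bullet> i \<le> 2 * h" if i: "i \<in> Basis" for i
        proof -
          have "0 \<le> \<eta> \<bullet> i \<and> \<eta> \<bullet> i \<le> \<delta>" using \<open>\<eta> \<in> ?Q\<close> i by (auto simp: mem_box)
          moreover have "0 \<le> ?v \<bullet> i \<and> ?v \<bullet> i \<le> h"
            using \<kappa>S[OF i] \<kappa>[OF j] s i j by (auto simp: inner_add_left inner_Basis)
          ultimately show ?thesis using \<delta> by (auto simp: inner_add_left)
        qed
        then show ?thesis by (auto simp: mem_box)
      qed
      have "(\<integral>\<^sup>+\<eta>\<in>?Q. ennreal \<bar>G j (\<eta> + ?\<kappa> + s *\<^sub>R j) - c j\<bar> \<partial>lborel)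
          \<le> (\<integral>\<^sup>+\<eta>. ennreal \<bar>G j (?v + \<eta>) - c j\<bar> * indicator (cbox 0 ((2 * h) *\<^sub>R One)) (?v + \<eta>) \<partial>lborel)"
        by (intro nn_integral_mono) (use sub in \<open>auto simp: indicator_def algebra_simps\<close>)
      also have "\<dots> = (\<integral>\<^sup>+z\<in>cbox 0 ((2 * h) *\<^sub>R One). ennreal \<bar>G j z - c j\<bar> \<partial>(distr lborel borel ((+) ?v)))"
        by (subst nn_integral_distr) auto
      also have "\<dots> = ?I j" by (simp only: lborel_distr_plus)
      finally show ?thesis .
    qed
    have "(\<integral>\<^sup>+\<eta>\<in>?Q. ennreal \<bar>F (\<eta> + ?\<kappa> + (\<kappa> \<bullet> j) *\<^sub>R j) - F (\<eta> + ?\<kappa>) - c j * (\<kappa> \<bullet> j)\<bar> \<partial>lborel)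
       \<le> (\<integral>\<^sup>+\<eta>. (\<integral>\<^sup>+s. ennreal \<bar>G j (\<eta> + ?\<kappa> + s *\<^sub>R j) - c j\<bar> * indicator {0..\<kappa> \<bullet> j} s * indicator ?Q \<eta> \<partial>lborel) \<partial>lborel)"
    proof (intro nn_integral_mono)
      fix \<eta>
      have "ennreal \<bar>F (\<eta> + ?\<kappa> + (\<kappa> \<bullet> j) *\<^sub>R j) - F (\<eta> + ?\<kappa>) - c j * (\<kappa> \<bullet> j)\<bar> * indicator ?Q \<eta>
        \<le> (\<integral>\<^sup>+s. ennreal \<bar>G j (\<eta> + ?\<kappa> + s *\<^sub>R j) - c j\<bar> * indicator {0..\<kappa> \<bullet> j} s \<partial>lborel) * indicator ?Q \<eta>"
        by (intro mult_right_mono inc j) (use \<kappa>[OF j] in auto)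
      also have "\<dots> = (\<integral>\<^sup>+s. ennreal \<bar>G j (\<eta> + ?\<kappa> + s *\<^sub>R j) - c j\<bar> * indicator {0..\<kappa> \<bullet> j} s * indicator ?Q \<eta> \<partial>lborel)"
        by (subst nn_integral_multc) auto
      finally show "ennreal \<bar>F (\<eta> + ?\<kappa> + (\<kappa> \<bullet> j) *\<^sub>R j) - F (\<eta> + ?\<kappa>) - c j * (\<kappa> \<bullet> j)\<bar> * indicator ?Q \<eta>
        \<le> (\<integral>\<^sup>+s. ennreal \<bar>G j (\<eta> + ?\<kappa> + s *\<^sub>R j) - c j\<bar> * indicator {0..\<kappa> \<bullet> j} s * indicator ?Q \<eta> \<partial>lborel)" .
    qed
    also have "\<dots> = (\<integral>\<^sup>+s. (\<integral>\<^sup>+\<eta>. ennreal \<bar>G j (\<eta> + ?\<kappa> + s *\<^sub>R j) - c j\<bar> * indicator {0..\<kappa> \<bullet> j} s * indicator ?Q \<eta> \<partial>lborel) \<partial>lborel)"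
      by (rule lborel_pair.Fubini') measurable
    also have "\<dots> \<le> (\<integral>\<^sup>+s. ?I j * indicator {0..\<kappa> \<bullet> j} s \<partial>lborel)"
    proof (intro nn_integral_mono)
      fix s
      show "(\<integral>\<^sup>+\<eta>. ennreal \<bar>G j (\<eta> + ?\<kappa> + s *\<^sub>R j) - c j\<bar> * indicator {0..\<kappa> \<bullet> j} s * indicator ?Q \<eta> \<partial>lborel)
          \<le> ?I j * indicator {0..\<kappa> \<bullet> j} s"
        using shift[of s] by (auto simp: indicator_def)
    qed
    also have "\<dots> = ?I j * ennreal (\<kappa> \<bullet> j)"
      using \<kappa>[OF j] by (subst nn_integral_cmult_indicator) auto
    also have "\<dots> \<le> ennreal h * ?I j"
      using \<kappa>[OF j] by (subst mult.commute) (intro mult_right_mono ennreal_leI, auto)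
    finally have step: "(\<integral>\<^sup>+\<eta>\<in>?Q. ennreal \<bar>F (\<eta> + ?\<kappa> + (\<kappa> \<bullet> j) *\<^sub>R j) - F (\<eta> + ?\<kappa>) - c j * (\<kappa> \<bullet> j)\<bar> \<partial>lborel) \<le> ennreal h * ?I j" .
    have "(\<integral>\<^sup>+\<eta>\<in>?Q. ennreal \<bar>F (\<eta> + (\<Sum>i\<in>insert j S. (\<kappa> \<bullet> i) *\<^sub>R i)) - F \<eta> - (\<Sum>i\<in>insert j S. c i * (\<kappa> \<bullet> i))\<bar> \<partial>lborel)
       \<le> (\<integral>\<^sup>+\<eta>. ennreal \<bar>F (\<eta> + ?\<kappa>) - F \<eta> - (\<Sum>i\<in>S. c i * (\<kappa> \<bullet> i))\<bar> * indicator ?Q \<eta>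
           + ennreal \<bar>F (\<eta> + ?\<kappa> + (\<kappa> \<bullet> j) *\<^sub>R j) - F (\<eta> + ?\<kappa>) - c j * (\<kappa> \<bullet> j)\<bar> * indicator ?Q \<eta> \<partial>lborel)"
    proof (intro nn_integral_mono)
      fix \<eta>
      have eq: "(\<Sum>i\<in>insert j S. (\<kappa> \<bullet> i) *\<^sub>R i) = ?\<kappa> + (\<kappa> \<bullet> j) *\<^sub>R j"
        "(\<Sum>i\<in>insert j S. c i * (\<kappa> \<bullet> i)) = (\<Sum>i\<in>S. c i * (\<kappa> \<bullet> i)) + c j * (\<kappa> \<bullet> j)"
        using insert.hyps by (simp_all add: add.commute)
      have "\<bar>F (\<eta> + (\<Sum>i\<in>insert j S. (\<kappa> \<bullet> i) *\<^sub>R i)) - F \<eta> - (\<Sum>i\<in>insert j S. c i * (\<kappa> \<bullet> i))\<bar>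
        \<le> \<bar>F (\<eta> + ?\<kappa>) - F \<eta> - (\<Sum>i\<in>S. c i * (\<kappa> \<bullet> i))\<bar> + \<bar>F (\<eta> + ?\<kappa> + (\<kappa> \<bullet> j) *\<^sub>R j) - F (\<eta> + ?\<kappa>) - c j * (\<kappa> \<bullet> j)\<bar>"
        unfolding eq add.assoc[symmetric] by linarith
      then have "ennreal \<bar>F (\<eta> + (\<Sum>i\<in>insert j S. (\<kappa> \<bullet> i) *\<^sub>R i)) - F \<eta> - (\<Sum>i\<in>insert j S. c i * (\<kappa> \<bullet> i))\<bar>
        \<le> ennreal \<bar>F (\<eta> + ?\<kappa>) - F \<eta> - (\<Sum>i\<in>S. c i * (\<kappa> \<bullet> i))\<bar> + ennreal \<bar>F (\<eta> + ?\<kappa> + (\<kappa> \<bullet> j) *\<^sub>R j) - F (\<eta> + ?\<kappa>) - c j * (\<kappa> \<bullet> j)\<bar>"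
        by (simp only: ennreal_plus[symmetric] abs_ge_zero) (rule ennreal_leI)
      then show "ennreal \<bar>F (\<eta> + (\<Sum>i\<in>insert j S. (\<kappa> \<bullet> i) *\<^sub>R i)) - F \<eta> - (\<Sum>i\<in>insert j S. c i * (\<kappa> \<bullet> i))\<bar> * indicator ?Q \<eta>
        \<le> ennreal \<bar>F (\<eta> + ?\<kappa>) - F \<eta> - (\<Sum>i\<in>S. c i * (\<kappa> \<bullet> i))\<bar> * indicator ?Q \<eta>
          + ennreal \<bar>F (\<eta> + ?\<kappa> + (\<kappa> \<bullet> j) *\<^sub>R j) - F (\<eta> + ?\<kappa>) - c j * (\<kappa> \<bullet> j)\<bar> * indicator ?Q \<eta>"
        by (subst distrib_right[symmetric]) (intro mult_right_mono, auto)
    qed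
    also have "\<dots> \<le> ennreal h * (\<Sum>i\<in>S. ?I i) + ennreal h * ?I j"
      by (subst nn_integral_add) (auto intro!: add_mono step insert.IH S)
    also have "\<dots> = ennreal h * (\<Sum>i\<in>insert j S. ?I i)"
      using insert.hyps by (simp add: distrib_left add.commute)
    finally show ?case .
  qed simp
qed

text \<open>
  Replacing \<open>F\<close> by its average over a cube of side \<open>\<delta> h\<close>, where \<open>h = norm \<kappa>\<close>, costs at most a multiple of
  \<open>\<delta> h\<close> because \<open>F\<close> is Lipschitz. The averaged increment is controlled by the mean oscillation of the
  partial derivatives over a cube of side \<open>2 h\<close>, with a factor depending on \<open>\<delta>\<close>; so \<open>\<delta>\<close> is fixed first and
  \<open>h\<close> is made small afterwards.
\<close>
lemma derivative_on_orthant_at_Lebesgue_point: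
  fixes F :: "'a::euclidean_space \<Rightarrow> real" and G :: "'a \<Rightarrow> 'a \<Rightarrow> real"
  assumes L: "L-lipschitz_on UNIV F"
    and G[measurable]: "\<And>i. G i \<in> borel_measurable borel"
    and inc: "\<And>i y t. i \<in> Basis \<Longrightarrow> 0 \<le> t \<Longrightarrow> ennreal \<bar>F (y + t *\<^sub>R i) - F y - c i * t\<bar>
        \<le> (\<integral>\<^sup>+s. ennreal \<bar>G i (y + s *\<^sub>R i) - c i\<bar> * indicator {0..t} s \<partial>lborel)"
    and leb: "\<And>i e. i \<in> Basis \<Longrightarrow> 0 < e \<Longrightarrow> \<exists>d>0. \<forall>h. 0 < h \<and> h < d \<longrightarrow>
        (\<integral>\<^sup>+z\<in>cbox 0 (h *\<^sub>R One). ennreal \<bar>G i z - c i\<bar> \<partial>lborel) \<le> ennreal (e * h ^ DIM('a))"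
    and e: "0 < e"
  shows "\<exists>d>0. \<forall>\<kappa>. (\<forall>i\<in>Basis. 0 \<le> \<kappa> \<bullet> i) \<and> norm \<kappa> < d \<longrightarrow>
     \<bar>F \<kappa> - F 0 - (\<Sum>i\<in>Basis. c i * (\<kappa> \<bullet> i))\<bar> \<le> e * norm \<kappa>"
proof -
  let ?m = "DIM('a)"
  have m: "0 < real ?m" by simp
  have L0: "0 \<le> L" using L by (rule lipschitz_on_nonneg)
  define r where "r = (\<lambda>y. F y - (\<Sum>i\<in>Basis. c i * (y \<bullet> i)))"
  define C where "C = L + (\<Sum>i\<in>(Basis::'a set). \<bar>c i\<bar>) + 1"
  have "0 \<le> (\<Sum>i\<in>(Basis::'a set). \<bar>c i\<bar>)" by (rule sum_nonneg) simp
  then have C: "C > 0" unfolding C_def using L0 by linarith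
  have rC: "\<bar>r a - r b\<bar> \<le> C * norm (a - b)" for a b
  proof -
    have "\<bar>\<Sum>i\<in>Basis. c i * ((a - b) \<bullet> i)\<bar> \<le> (\<Sum>i\<in>(Basis::'a set). \<bar>c i\<bar> * norm (a - b))"
      by (intro order_trans[OF sum_abs] sum_mono) (auto simp: abs_mult intro!: mult_left_mono Basis_le_norm)
    moreover have "\<bar>F a - F b\<bar> \<le> L * norm (a - b)"
      using lipschitz_onD[OF L, of a b] by (simp add: dist_norm)
    moreover have "r a - r b = (F a - F b) - (\<Sum>i\<in>Basis. c i * ((a - b) \<bullet> i))"
      by (simp add: r_def inner_diff_left right_diff_distrib sum_subtractf)
    moreover have "C * norm (a - b) = L * norm (a - b) + (\<Sum>i\<in>(Basis::'a set). \<bar>c i\<bar> * norm (a - b)) + norm (a - b)"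
      by (simp add: C_def distrib_right sum_distrib_right)
    ultimately show ?thesis using norm_ge_zero[of "a - b"] by linarith
  qed
  define \<delta> where "\<delta> = min 1 (e / (4 * C * ?m))"
  have \<delta>: "0 < \<delta>" "\<delta> \<le> 1" and \<delta>e: "2 * C * ?m * \<delta> \<le> e / 2"
  proof -
    show "0 < \<delta>" "\<delta> \<le> 1" using C e by (simp_all add: \<delta>_def)
    have "\<delta> \<le> e / (4 * C * ?m)" by (simp add: \<delta>_def)
    then show "2 * C * ?m * \<delta> \<le> e / 2" using C m by (simp add: field_simps)
  qed
  \<comment> \<open>chosen so that the mean oscillation over the cube of side \<open>2 h\<close> contributes \<open>e / 2 * h\<close>\<close>
  define e' where "e' = e / (2 * ?m) * (\<delta> / 2) ^ ?m"
  have e': "0 < e'" using e \<delta> by (simp add: e'_def)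
  have "\<exists>D. \<forall>i\<in>Basis. D i > 0 \<and> (\<forall>h. 0 < h \<and> h < D i \<longrightarrow>
        (\<integral>\<^sup>+z\<in>cbox 0 (h *\<^sub>R One). ennreal \<bar>G i z - c i\<bar> \<partial>lborel) \<le> ennreal (e' * h ^ DIM('a)))"
    by (intro bchoice ballI) (use leb[OF _ e'] in blast)
  then obtain D where D: "\<And>i. i \<in> Basis \<Longrightarrow> D i > 0"
    and DI: "\<And>i h. i \<in> Basis \<Longrightarrow> 0 < h \<Longrightarrow> h < D i \<Longrightarrow>
        (\<integral>\<^sup>+z\<in>cbox 0 (h *\<^sub>R One). ennreal \<bar>G i z - c i\<bar> \<partial>lborel) \<le> ennreal (e' * h ^ DIM('a))" by blast
  define d where "d = Min (D ` Basis) / 2"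
  have d0: "d > 0" unfolding d_def using D by simp
  have dD: "2 * d \<le> D i" if "i \<in> Basis" for i unfolding d_def using that by simp
  have [measurable]: "F \<in> borel_measurable borel"
    using lipschitz_on_continuous_on[OF L] by (rule borel_measurable_continuous_onI)
  have "\<bar>F \<kappa> - F 0 - (\<Sum>i\<in>Basis. c i * (\<kappa> \<bullet> i))\<bar> \<le> e * norm \<kappa>"
    if \<kappa>: "\<And>i. i \<in> Basis \<Longrightarrow> 0 \<le> \<kappa> \<bullet> i" and \<kappa>d: "norm \<kappa> < d" for \<kappa>
  proof (cases "\<kappa> = 0")
    case False
    define h where "h = norm \<kappa>"
    have h: "0 < h" "h < d" using False \<kappa>d by (auto simp: h_def)
    let ?Q = "cbox 0 ((\<delta> * h) *\<^sub>R One) :: 'a set"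
    let ?V = "(\<delta> * h) ^ ?m"
    have V: "0 < ?V" using \<delta> h by simp
    have emQ: "emeasure lborel ?Q = ennreal ?V"
      using \<delta> h by (simp add: emeasure_lborel_cbox_eq)
    have \<kappa>sum: "(\<Sum>i\<in>Basis. (\<kappa> \<bullet> i) *\<^sub>R i) = \<kappa>" by (rule euclidean_representation)
    have b: "0 \<le> 2 * C * (?m * (\<delta> * h))" using C \<delta> h by simp
    have "ennreal \<bar>r \<kappa> - r 0\<bar> * ennreal ?V = (\<integral>\<^sup>+\<eta>\<in>?Q. ennreal \<bar>r \<kappa> - r 0\<bar> \<partial>lborel)"
      by (simp add: nn_integral_cmult_indicator emQ)
    also have "\<dots> \<le> (\<integral>\<^sup>+\<eta>. ennreal \<bar>F (\<eta> + \<kappa>) - F \<eta> - (\<Sum>i\<in>Basis. c i * (\<kappa> \<bullet> i))\<bar> * indicator ?Q \<eta>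
         + ennreal (2 * C * (?m * (\<delta> * h))) * indicator ?Q \<eta> \<partial>lborel)"
    proof (rule nn_integral_mono)
      fix \<eta> :: 'a
      show "ennreal \<bar>r \<kappa> - r 0\<bar> * indicator ?Q \<eta> \<le>
        ennreal \<bar>F (\<eta> + \<kappa>) - F \<eta> - (\<Sum>i\<in>Basis. c i * (\<kappa> \<bullet> i))\<bar> * indicator ?Q \<eta>
         + ennreal (2 * C * (?m * (\<delta> * h))) * indicator ?Q \<eta>"
      proof (cases "\<eta> \<in> ?Q")
        case True
        have "norm \<eta> \<le> (\<Sum>i\<in>Basis. \<bar>\<eta> \<bullet> i\<bar>)" by (rule norm_le_l1)
        also have "\<dots> \<le> (\<Sum>i\<in>(Basis::'a set). \<delta> * h)"
          by (rule sum_mono) (use True in \<open>auto simp: mem_box\<close>)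
        finally have n: "norm \<eta> \<le> ?m * (\<delta> * h)" by simp
        have "C * norm \<eta> \<le> C * (?m * (\<delta> * h))" using n C by (intro mult_left_mono) auto
        moreover have "\<bar>r \<kappa> - r (\<eta> + \<kappa>)\<bar> \<le> C * norm \<eta>" using rC[of \<kappa> "\<eta> + \<kappa>"] by simp
        moreover have "\<bar>r \<eta> - r 0\<bar> \<le> C * norm \<eta>" using rC[of \<eta> 0] by simp
        moreover have "r (\<eta> + \<kappa>) - r \<eta> = F (\<eta> + \<kappa>) - F \<eta> - (\<Sum>i\<in>Basis. c i * (\<kappa> \<bullet> i))"
          by (simp add: r_def inner_add_left distrib_left sum.distrib)
        ultimately have "\<bar>r \<kappa> - r 0\<bar> \<le> \<bar>F (\<eta> + \<kappa>) - F \<eta> - (\<Sum>i\<in>Basis. c i * (\<kappa> \<bullet> i))\<bar> + 2 * (C * (?m * (\<delta> * h)))"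
          by linarith
        then have "ennreal \<bar>r \<kappa> - r 0\<bar> \<le> ennreal \<bar>F (\<eta> + \<kappa>) - F \<eta> - (\<Sum>i\<in>Basis. c i * (\<kappa> \<bullet> i))\<bar> + ennreal (2 * C * (?m * (\<delta> * h)))"
          using b by (subst ennreal_plus[symmetric]) (auto intro!: ennreal_leI simp only: mult.assoc)
        then show ?thesis using True by simp
      qed simp
    qed
    also have "\<dots> = (\<integral>\<^sup>+\<eta>\<in>?Q. ennreal \<bar>F (\<eta> + \<kappa>) - F \<eta> - (\<Sum>i\<in>Basis. c i * (\<kappa> \<bullet> i))\<bar> \<partial>lborel)
         + ennreal (2 * C * (?m * (\<delta> * h))) * ennreal ?V"
      by (subst nn_integral_add) (auto simp: nn_integral_cmult_indicator emQ)
    also have "(\<integral>\<^sup>+\<eta>\<in>?Q. ennreal \<bar>F (\<eta> + \<kappa>) - F \<eta> - (\<Sum>i\<in>Basis. c i * (\<kappa> \<bullet> i))\<bar> \<partial>lborel)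
        \<le> ennreal h * (\<Sum>i\<in>Basis. \<integral>\<^sup>+z\<in>cbox 0 ((2 * h) *\<^sub>R One). ennreal \<bar>G i z - c i\<bar> \<partial>lborel)"
    proof -
      have "0 \<le> \<kappa> \<bullet> i \<and> \<kappa> \<bullet> i \<le> h" if "i \<in> Basis" for i
        using \<kappa>[OF that] Basis_le_norm[OF that, of \<kappa>] by (auto simp: h_def)
      then show ?thesis
        using averaged_increment_le[of F G c \<kappa> h "\<delta> * h" Basis, OF _ G inc] \<delta> h
        by (simp add: \<kappa>sum mult_le_cancel_right1)
    qed
    also have "(\<Sum>i\<in>Basis. \<integral>\<^sup>+z\<in>cbox 0 ((2 * h) *\<^sub>R One). ennreal \<bar>G i z - c i\<bar> \<partial>lborel)
        \<le> (\<Sum>i\<in>(Basis::'a set). ennreal (e' * (2 * h) ^ ?m))"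
      using h by (intro sum_mono DI) (auto intro: less_le_trans[OF _ dD])
    also have "\<dots> = ennreal (?m * (e' * (2 * h) ^ ?m))"
      using e' h by (simp add: ennreal_of_nat_eq_real_of_nat ennreal_mult[symmetric])
    also have "ennreal h * ennreal (?m * (e' * (2 * h) ^ ?m)) + ennreal (2 * C * (?m * (\<delta> * h))) * ennreal ?V
        = ennreal (h * (?m * (e' * (2 * h) ^ ?m)) + 2 * C * (?m * (\<delta> * h)) * ?V)"
      using e' h C \<delta> by (simp add: ennreal_mult[symmetric] ennreal_plus[symmetric] del: ennreal_plus)
    also have "h * (?m * (e' * (2 * h) ^ ?m)) + 2 * C * (?m * (\<delta> * h)) * ?V = (e / 2 + 2 * C * ?m * \<delta>) * h * ?V"
    proof -
      have "?m * (e' * (2 * h) ^ ?m) = e / 2 * ?V"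
        unfolding e'_def using m by (simp add: power_mult_distrib power_divide)
      then show ?thesis by (simp only: ring_distribs mult_ac)
    qed
    finally have "ennreal (\<bar>r \<kappa> - r 0\<bar> * ?V) \<le> ennreal ((e / 2 + 2 * C * ?m * \<delta>) * h * ?V)"
      using V by (simp add: ennreal_mult[symmetric] add_mono mult_left_mono)
    then have "\<bar>r \<kappa> - r 0\<bar> * ?V \<le> (e / 2 + 2 * C * ?m * \<delta>) * h * ?V"
      using e C \<delta> h by (subst (asm) ennreal_le_iff) auto
    then have "\<bar>r \<kappa> - r 0\<bar> \<le> (e / 2 + 2 * C * ?m * \<delta>) * h" using V by (rule mult_right_le_imp_le)
    also have "\<dots> \<le> e * h" using \<delta>e h by (intro mult_right_mono) auto
    finally show ?thesis by (simp add: r_def h_def algebra_simps)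
  qed simp
  with d0 show ?thesis by blast
qed

text \<open>
  Off a negligible set, \<open>x\<close> is a Lebesgue point of all partial derivatives in all orthants, and the
  previous lemma applies to \<open>f\<close> composed with each reflection. The same numbers \<open>g i x\<close>
  serve in every orthant, so the expansions fit together to one linear map.
\<close>
theorem rademacher:
  fixes f :: "'a::euclidean_space \<Rightarrow> real"
  assumes L: "L-lipschitz_on UNIV f"
  obtains N where "negligible N" "\<And>x. x \<notin> N \<Longrightarrow> f differentiable (at x)"
proof -
  have L0: "0 \<le> L" using L by (rule lipschitz_on_nonneg)
  have [measurable]: "f \<in> borel_measurable borel"
    using lipschitz_on_continuous_on[OF L] by (rule borel_measurable_continuous_onI)
  define g where "g = (\<lambda>i x. right_deriv L (\<lambda>t. f (x + t *\<^sub>R i)) 0)"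
  have g[measurable]: "g i \<in> borel_measurable borel" for i
    unfolding g_def right_deriv_def[abs_def] by measurable
  have gL: "\<bar>g i x\<bar> \<le> L" for i x
    using L0 unfolding g_def right_deriv_def by (auto simp: max_def min_def)
  have g_line: "right_deriv L (\<lambda>t. f (x + t *\<^sub>R i)) s = g i (x + s *\<^sub>R i)" for x i s
    unfolding g_def right_deriv_def by (simp add: algebra_simps)
  have lip_line: "L-lipschitz_on UNIV (\<lambda>t. f (x + t *\<^sub>R i))" if "i \<in> Basis" for x i
  proof (rule lipschitz_onI[OF _ L0])
    fix s t :: real
    have "dist (f (x + s *\<^sub>R i)) (f (x + t *\<^sub>R i)) \<le> L * dist (x + s *\<^sub>R i) (x + t *\<^sub>R i)"
      by (rule lipschitz_onD[OF L]) auto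
    also have "dist (x + s *\<^sub>R i) (x + t *\<^sub>R i) = dist s t"
      using that by (simp add: dist_norm scaleR_left_diff_distrib[symmetric] norm_scaleR)
    finally show "dist (f (x + s *\<^sub>R i)) (f (x + t *\<^sub>R i)) \<le> L * dist s t" .
  qed
  define leb where "leb = (\<lambda>i x. \<forall>B e. B \<subseteq> Basis \<longrightarrow> 0 < e \<longrightarrow>
      (\<exists>d>0. \<forall>h. 0 < h \<and> h < d \<longrightarrow>
        (\<integral>\<^sup>+y\<in>cbox 0 (h *\<^sub>R One). ennreal \<bar>g i (x + flip B y) - g i x\<bar> \<partial>lborel) \<le> ennreal (e * h ^ DIM('a))))"
  have "\<exists>N. negligible N \<and> (\<forall>x. x \<notin> N \<longrightarrow> leb i x)" for i
    unfolding leb_def by (rule AE_negligible_orthant_Lebesgue_point[of "g i" L, OF g gL]) blast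
  then obtain N where N: "\<And>i. negligible (N i)" and Nleb: "\<And>i x. x \<notin> N i \<Longrightarrow> leb i x"
    by metis
  show thesis
  proof
    show "negligible (\<Union>i\<in>Basis. N i)" using N by (intro negligible_Union) auto
    fix x assume "x \<notin> (\<Union>i\<in>Basis. N i)"
    then have x: "x \<notin> N i" if "i \<in> Basis" for i using that by auto
    define D where "D = (\<lambda>k. \<Sum>i\<in>Basis. g i x * (k \<bullet> i))"
    have "(f has_derivative D) (at x)"
      unfolding has_derivative_at_alt
    proof (intro conjI allI impI)
      show "bounded_linear D" unfolding D_def
        by (intro bounded_linear_sum bounded_linear_const_mult bounded_linear_inner_left)
      fix e :: real assume e: "0 < e"
      have "\<exists>d>0. \<forall>\<kappa>. (\<forall>i\<in>Basis. 0 \<le> \<kappa> \<bullet> i) \<and> norm \<kappa> < d \<longrightarrow>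
           \<bar>f (x + flip B \<kappa>) - f x - D (flip B \<kappa>)\<bar> \<le> e * norm \<kappa>" if B: "B \<in> Pow Basis" for B
      proof -
        define \<sigma> where "\<sigma> = (\<lambda>i. if i \<in> B then - 1 else (1::real))"
        define F where "F = (\<lambda>y. f (x + flip B y))"
        have "L-lipschitz_on UNIV F"
        proof (rule lipschitz_onI[OF _ L0])
          fix a b
          show "dist (F a) (F b) \<le> L * dist a b"
            using lipschitz_onD[OF L, of "x + flip B a" "x + flip B b"]
            by (simp add: F_def dist_norm linear_diff[OF linear_flip, symmetric])
        qed
        moreover have "(\<lambda>y. \<sigma> i * g i (x + flip B y)) \<in> borel_measurable borel" for i by measurable
        moreover have "ennreal \<bar>F (y + t *\<^sub>R i) - F y - (\<sigma> i * g i x) * t\<bar>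
           \<le> (\<integral>\<^sup>+s. ennreal \<bar>\<sigma> i * g i (x + flip B (y + s *\<^sub>R i)) - \<sigma> i * g i x\<bar> * indicator {0..t} s \<partial>lborel)"
          if i: "i \<in> Basis" and t: "0 \<le> t" for i y t
        proof (cases "i \<in> B")
          case False
          have "ennreal \<bar>f (x + flip B y + t *\<^sub>R i) - f (x + flip B y + 0 *\<^sub>R i) - g i x * (t - 0)\<bar>
            \<le> (\<integral>\<^sup>+s. ennreal \<bar>right_deriv L (\<lambda>t. f (x + flip B y + t *\<^sub>R i)) s - g i x\<bar> * indicator {0..t} s \<partial>lborel)"
            by (rule lipschitz_increment_le[OF lip_line[OF i] t])
          then show ?thesis
            unfolding g_line using False i by (simp add: F_def \<sigma>_def linear_add[OF linear_flip] flip_basis add.assoc)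
        next
          case True
          have "ennreal \<bar>f (x + flip B y + 0 *\<^sub>R i) - f (x + flip B y + (- t) *\<^sub>R i) - g i x * (0 - - t)\<bar>
            \<le> (\<integral>\<^sup>+s. ennreal \<bar>right_deriv L (\<lambda>t. f (x + flip B y + t *\<^sub>R i)) s - g i x\<bar> * indicator {-t..0} s \<partial>lborel)"
            by (rule lipschitz_increment_le[OF lip_line[OF i]]) (use t in simp)
          also have "\<dots> = (\<integral>\<^sup>+s. ennreal \<bar>g i (x + flip B y - s *\<^sub>R i) - g i x\<bar> * indicator {-t..0} (-s) \<partial>lborel)"
            unfolding g_line by (subst nn_integral_real_affine[where c="-1" and t=0]) auto
          also have "\<dots> = (\<integral>\<^sup>+s. ennreal \<bar>\<sigma> i * g i (x + flip B (y + s *\<^sub>R i)) - \<sigma> i * g i x\<bar> * indicator {0..t} s \<partial>lborel)"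
            using True i by (intro nn_integral_cong)
              (auto simp: \<sigma>_def linear_add[OF linear_flip] flip_basis indicator_def algebra_simps abs_minus_commute)
          finally show ?thesis
            using True i by (simp add: F_def \<sigma>_def linear_add[OF linear_flip] flip_basis add.assoc abs_minus_commute algebra_simps)
        qed
        moreover have "\<exists>d>0. \<forall>h. 0 < h \<and> h < d \<longrightarrow>
            (\<integral>\<^sup>+z\<in>cbox 0 (h *\<^sub>R One). ennreal \<bar>\<sigma> i * g i (x + flip B z) - \<sigma> i * g i x\<bar> \<partial>lborel) \<le> ennreal (e * h ^ DIM('a))"
          if "i \<in> Basis" "0 < e" for i e
        proof -
          have "\<bar>\<sigma> i * a - \<sigma> i * b\<bar> = \<bar>a - b\<bar>" for a b by (auto simp: \<sigma>_def)
          then show ?thesis using Nleb[OF x[OF that(1)], unfolded leb_def, rule_format, OF _ that(2), of B] B by simp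
        qed
        ultimately have "\<exists>d>0. \<forall>\<kappa>. (\<forall>i\<in>Basis. 0 \<le> \<kappa> \<bullet> i) \<and> norm \<kappa> < d \<longrightarrow>
           \<bar>F \<kappa> - F 0 - (\<Sum>i\<in>Basis. \<sigma> i * g i x * (\<kappa> \<bullet> i))\<bar> \<le> e * norm \<kappa>"
          using e by (intro derivative_on_orthant_at_Lebesgue_point[where L=L and G="\<lambda>i y. \<sigma> i * g i (x + flip B y)"])
        moreover have "(\<Sum>i\<in>Basis. \<sigma> i * g i x * (\<kappa> \<bullet> i)) = D (flip B \<kappa>)" for \<kappa>
          unfolding D_def \<sigma>_def by (rule sum.cong) (auto simp: flip_inner)
        moreover have "F 0 = f x" by (simp add: F_def linear_0[OF linear_flip])
        ultimately show ?thesis by (simp add: F_def)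
      qed
      then have "\<exists>d. \<forall>B\<in>Pow Basis. d B > 0 \<and> (\<forall>\<kappa>. (\<forall>i\<in>Basis. 0 \<le> \<kappa> \<bullet> i) \<and> norm \<kappa> < d B \<longrightarrow>
           \<bar>f (x + flip B \<kappa>) - f x - D (flip B \<kappa>)\<bar> \<le> e * norm \<kappa>)"
        by (intro bchoice) blast
      then obtain d where d: "\<And>B. B \<subseteq> Basis \<Longrightarrow> d B > 0" and
        D: "\<And>B \<kappa>. B \<subseteq> Basis \<Longrightarrow> (\<And>i. i\<in>Basis \<Longrightarrow> 0 \<le> \<kappa> \<bullet> i) \<Longrightarrow> norm \<kappa> < d B \<Longrightarrow>
           \<bar>f (x + flip B \<kappa>) - f x - D (flip B \<kappa>)\<bar> \<le> e * norm \<kappa>" by (metis PowI)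
      have "norm (f y - f x - D (y - x)) \<le> e * norm (y - x)" if y: "norm (y - x) < Min (d ` Pow Basis)" for y
      proof -
        define B where "B = {i\<in>Basis. (y - x) \<bullet> i < 0}"
        define \<kappa> where "\<kappa> = flip B (y - x)"
        have B: "B \<subseteq> Basis" by (auto simp: B_def)
        have "0 \<le> \<kappa> \<bullet> i" if "i \<in> Basis" for i
          using that by (auto simp: \<kappa>_def flip_inner B_def)
        moreover have "norm \<kappa> < d B"
        proof -
          have "Min (d ` Pow Basis) \<le> d B" using B by (intro Min_le) auto
          then show ?thesis using y by (simp add: \<kappa>_def)
        qed
        ultimately show ?thesis using D[OF B, of \<kappa>] by (simp add: \<kappa>_def)
      qed
      moreover have "Min (d ` Pow Basis) > 0" using d by (subst Min_gr_iff) auto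
      ultimately show "\<exists>d>0. \<forall>y. norm (y - x) < d \<longrightarrow> norm (f y - f x - D (y - x)) \<le> e * norm (y - x)"
        by blast
    qed
    then show "f differentiable (at x)" by (auto simp: differentiable_def)
  qed
qed

section \<open>Second order expansions at contact points\<close>

text \<open>
  A second order expansion at the single point \<open>x\<close>. The map \<open>S\<close> need not be symmetric: it will arise as
  a derivative of a gradient, and only its quadratic form enters.
\<close>
definition peano2 :: "('a::euclidean_space \<Rightarrow> real) \<Rightarrow> 'a \<Rightarrow> 'a \<Rightarrow> ('a \<Rightarrow> 'a) \<Rightarrow> bool" where
  "peano2 f x p S \<longleftrightarrow> linear S \<and> (\<forall>e>0. \<exists>d>0. \<forall>h. norm h < d \<longrightarrow>
      \<bar>f (x + h) - f x - p \<bullet> h - (S h \<bullet> h) / 2\<bar> \<le> e * (norm h)\<^sup>2)"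

text \<open>
  Near \<open>x\<close> the set \<open>K\<close> comes within \<open>o(|h|)\<close> of every point \<open>x + h\<close>, so the segment from \<open>x\<close> to \<open>x + h\<close>
  can be shadowed by a chain of \<open>n\<close> steps between points of \<open>K\<close>. Each step has a first order expansion with
  error \<open>O(|h|^2 / n^2)\<close> and a slope \<open>g x + (i / n) S h + o(|h|)\<close>; summing the slopes produces the quadratic
  term.
\<close>
lemma peano2_if_contact_density:
  fixes f :: "'a::euclidean_space \<Rightarrow> real" and g :: "'a \<Rightarrow> 'a"
  assumes xK: "x \<in> K" and r: "0 < r" and C: "0 \<le> C"
    and est: "\<And>a b. a \<in> K \<Longrightarrow> b \<in> ball x r \<Longrightarrow> \<bar>f b - f a - g a \<bullet> (b - a)\<bar> \<le> C * (norm (b - a))\<^sup>2"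
    and dens: "\<And>e. e > 0 \<Longrightarrow> \<exists>d>0. \<forall>y. norm (y - x) < d \<longrightarrow> (\<exists>a\<in>K. norm (a - y) \<le> e * norm (y - x))"
    and der: "(g has_derivative S) (at x)"
  shows "peano2 f x (g x) S"
  unfolding peano2_def
proof (intro conjI allI impI)
  have bl: "bounded_linear S" using der by (rule has_derivative_bounded_linear)
  then show lin: "linear S" by (rule bounded_linear.linear)
  obtain T where T: "T > 0" "\<And>h. norm (S h) \<le> norm h * T"
    using bounded_linear.pos_bounded[OF bl] by blast
  fix e :: real assume e: "0 < e"
  define A where "A = 9 * C + 3 * (T + 2) + 3 * T"
  have A: "A > 0" using C T by (simp add: A_def)
  obtain n :: nat where n: "real n > A / e + 1" using reals_Archimedean2 by blast
  have Ae: "A / e > 0" using A e by simp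
  have n1: "real n \<ge> 1" "n > 0" using n Ae by (linarith, use n Ae in \<open>cases n\<close>) auto
  have An: "A / n \<le> e"
  proof -
    have "A \<le> e * n" using n e by (simp add: field_simps)
    then show ?thesis using n1 by (simp add: field_simps)
  qed
  \<comment> \<open>shadowing error relative to \<open>norm h\<close>: small against the step \<open>1 / n\<close> even after summing \<open>n\<close> terms\<close>
  define \<epsilon> where "\<epsilon> = 1 / (real n)\<^sup>2"
  have \<epsilon>: "0 < \<epsilon>" "\<epsilon> \<le> 1 / n" "n * \<epsilon> = 1 / n" "\<epsilon> \<le> 1"
    using n1 one_le_power[OF n1(1), of 2] by (auto simp: \<epsilon>_def power2_eq_square field_simps)
  obtain d1 where d1: "d1 > 0" "\<And>y. norm (y - x) < d1 \<Longrightarrow> \<exists>a\<in>K. norm (a - y) \<le> \<epsilon> * norm (y - x)"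
    using dens[OF \<epsilon>(1)] by blast
  obtain d2 where d2: "d2 > 0" "\<And>y. norm (y - x) < d2 \<Longrightarrow> norm (g y - g x - S (y - x)) \<le> 1 / n * norm (y - x)"
    using der n1 unfolding has_derivative_at_alt by (metis zero_less_divide_1_iff of_nat_0_less_iff)
  define d where "d = min d1 (min (d2 / 2) (r / 2))"
  have d: "d > 0" using d1 d2 r by (simp add: d_def)
  have "\<bar>f (x + h) - f x - g x \<bullet> h - (S h \<bullet> h) / 2\<bar> \<le> e * (norm h)\<^sup>2" if h: "norm h < d" for h
  proof -
    define H where "H = norm h"
    have H: "0 \<le> H" "H < d1" "2 * H < d2" "2 * H < r" using h by (auto simp: d_def H_def)
    define z where "z = (\<lambda>i::nat. x + (real i / n) *\<^sub>R h)"
    have zx: "norm (z i - x) \<le> H" if "i \<le> n" for i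
    proof -
      have "real i / n * norm h \<le> 1 * norm h" using that n1 by (intro mult_right_mono) auto
      then show ?thesis by (simp add: z_def H_def)
    qed
    have "\<exists>a. \<forall>i\<in>{..n}. a i \<in> K \<and> norm (a i - z i) \<le> \<epsilon> * H"
    proof (rule bchoice, intro ballI)
      fix i assume "i \<in> {..n}"
      then have zi: "norm (z i - x) \<le> H" using zx by simp
      then obtain a where "a \<in> K" "norm (a - z i) \<le> \<epsilon> * norm (z i - x)" using d1(2)[of "z i"] H by force
      moreover have "\<epsilon> * norm (z i - x) \<le> \<epsilon> * H" using zi \<epsilon> by (intro mult_left_mono) auto
      ultimately show "\<exists>a. a \<in> K \<and> norm (a - z i) \<le> \<epsilon> * H" by force
    qed
    then obtain a where aK: "\<And>i. i \<le> n \<Longrightarrow> a i \<in> K" and az: "\<And>i. i \<le> n \<Longrightarrow> norm (a i - z i) \<le> \<epsilon> * H" by auto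
    \<comment> \<open>the end point \<open>x + h\<close> of the chain need not lie in \<open>K\<close>\<close>
    define b where "b = (\<lambda>i. if i = 0 then x else if i = n then x + h else a i)"
    have b0: "b 0 = x" and bn: "b n = x + h" using n1 by (auto simp: b_def)
    have bz: "norm (b i - z i) \<le> \<epsilon> * H" if "i \<le> n" for i
      using that az[OF that] n1 \<epsilon> H by (auto simp: b_def z_def)
    have bK: "b i \<in> K" if "i < n" for i using that aK xK by (auto simp: b_def)
    have bx: "norm (b i - x) \<le> 2 * H" if "i \<le> n" for i
    proof -
      have "norm (b i - x) \<le> norm (b i - z i) + norm (z i - x)"
        using norm_triangle_ineq[of "b i - z i" "z i - x"] by simp
      moreover have "\<epsilon> * H \<le> H" using \<epsilon> H by (intro mult_left_le_one_le) auto
      ultimately show ?thesis using bz[OF that] zx[OF that] by linarith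
    qed
    define w where "w = (\<lambda>i. (b (Suc i) - z (Suc i)) - (b i - z i))"
    have step: "b (Suc i) - b i = (1 / n) *\<^sub>R h + w i" for i
      by (simp add: w_def z_def algebra_simps add_divide_distrib)
    have w: "norm (w i) \<le> 2 * \<epsilon> * H" if "i < n" for i
      using bz[of i] bz[of "Suc i"] that norm_triangle_ineq4[of "b (Suc i) - z (Suc i)" "b i - z i"]
      by (simp add: w_def)
    have nstep: "norm (b (Suc i) - b i) \<le> 3 / n * H" if "i < n" for i
    proof -
      have "norm (b (Suc i) - b i) \<le> H / n + norm (w i)"
        unfolding step using norm_triangle_ineq[of "(1 / n) *\<^sub>R h" "w i"] by (simp add: H_def)
      moreover have "2 * \<epsilon> * H \<le> 2 * (1 / n) * H" using \<epsilon> H by (intro mult_right_mono) auto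
      moreover have "H / n + 2 * (1 / n) * H = 3 / n * H" by (simp add: field_simps)
      ultimately show ?thesis using w[OF that] by linarith
    qed
    define R where "R = (\<lambda>i. f (b (Suc i)) - f (b i) - g x \<bullet> (b (Suc i) - b i) - (real i / (real n)\<^sup>2) * (S h \<bullet> h))"
    have R: "\<bar>R i\<bar> \<le> (A - T) / (real n)\<^sup>2 * H\<^sup>2" if i: "i < n" for i
    proof -
      define \<rho> where "\<rho> = g (b i) - g x - S (z i - x)"
      have Sz: "S (z i - x) = (real i / n) *\<^sub>R S h"
        by (simp add: z_def linear_scale[OF lin])
      have "norm (g (b i) - g x - S (b i - x)) \<le> 1 / n * norm (b i - x)"
        using d2(2)[of "b i"] bx[of i] i H by simp
      also have "\<dots> \<le> 1 / n * (2 * H)" using bx[of i] i by (intro mult_left_mono) auto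
      finally have "norm (g (b i) - g x - S (b i - x)) \<le> 1 / n * (2 * H)" .
      moreover have "norm (S (b i - z i)) \<le> 1 / n * H * T"
      proof -
        have "norm (S (b i - z i)) \<le> norm (b i - z i) * T" by (rule T(2))
        also have "\<dots> \<le> (\<epsilon> * H) * T" using bz[of i] i T by (intro mult_right_mono) auto
        also have "\<dots> \<le> (1 / n * H) * T" using \<epsilon> H T by (intro mult_right_mono) auto
        finally show ?thesis .
      qed
      moreover have "\<rho> = (g (b i) - g x - S (b i - x)) + S (b i - z i)"
        unfolding \<rho>_def by (simp add: linear_diff[OF lin])
      ultimately have \<rho>: "norm \<rho> \<le> (T + 2) / n * H"
        using norm_triangle_ineq[of "g (b i) - g x - S (b i - x)" "S (b i - z i)"]
          distrib_right[of T 2 "1 / n * H"] by (simp add: mult_ac)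
      have e1: "\<bar>f (b (Suc i)) - f (b i) - g (b i) \<bullet> (b (Suc i) - b i)\<bar> \<le> 9 * C / (real n)\<^sup>2 * H\<^sup>2"
      proof -
        have "b (Suc i) \<in> ball x r" using bx[of "Suc i"] i H by (simp add: dist_norm norm_minus_commute)
        then have "\<bar>f (b (Suc i)) - f (b i) - g (b i) \<bullet> (b (Suc i) - b i)\<bar> \<le> C * (norm (b (Suc i) - b i))\<^sup>2"
          by (intro est bK i)
        also have "\<dots> \<le> C * (3 / n * H)\<^sup>2" using nstep[OF i] C by (intro mult_left_mono power_mono) auto
        finally show ?thesis by (simp add: power_mult_distrib power_divide mult_ac)
      qed
      have e2: "\<bar>\<rho> \<bullet> (b (Suc i) - b i)\<bar> \<le> 3 * (T + 2) / (real n)\<^sup>2 * H\<^sup>2"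
      proof -
        have "\<bar>\<rho> \<bullet> (b (Suc i) - b i)\<bar> \<le> norm \<rho> * norm (b (Suc i) - b i)" by (rule Cauchy_Schwarz_ineq2)
        also have "\<dots> \<le> ((T + 2) / n * H) * (3 / n * H)" using \<rho> nstep[OF i] T H by (intro mult_mono) auto
        finally show ?thesis by (simp add: power2_eq_square mult_ac)
      qed
      have e3: "\<bar>(real i / n) * (S h \<bullet> w i)\<bar> \<le> 2 * T / (real n)\<^sup>2 * H\<^sup>2"
      proof -
        have "\<bar>(real i / n) * (S h \<bullet> w i)\<bar> \<le> 1 * (norm (S h) * norm (w i))"
          unfolding abs_mult using i Cauchy_Schwarz_ineq2[of "S h" "w i"] by (intro mult_mono) auto
        also have "\<dots> \<le> 1 * ((H * T) * (2 * \<epsilon> * H))"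
          using T(2)[of h] w[OF i] T H by (intro mult_left_mono mult_mono) (auto simp: H_def)
        finally show ?thesis by (simp add: \<epsilon>_def power2_eq_square mult_ac)
      qed
      have split: "R i = (f (b (Suc i)) - f (b i) - g (b i) \<bullet> (b (Suc i) - b i)) + \<rho> \<bullet> (b (Suc i) - b i)
           + (real i / n) * (S h \<bullet> w i)"
      proof -
        have gb: "g (b i) = \<rho> + g x + (real i / n) *\<^sub>R S h" by (simp add: \<rho>_def Sz[symmetric])
        have "g (b i) \<bullet> (b (Suc i) - b i) = \<rho> \<bullet> (b (Suc i) - b i) + g x \<bullet> (b (Suc i) - b i)
            + (real i / n) * (S h \<bullet> (b (Suc i) - b i))"
          by (subst gb) (simp add: inner_add_left)
        moreover have "(real i / n) * (S h \<bullet> (b (Suc i) - b i)) = (real i / (real n)\<^sup>2) * (S h \<bullet> h) + (real i / n) * (S h \<bullet> w i)"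
          unfolding step by (simp add: inner_add_right distrib_left power2_eq_square)
        ultimately show ?thesis by (simp add: R_def)
      qed
      have "\<bar>R i\<bar> \<le> 9 * C / (real n)\<^sup>2 * H\<^sup>2 + 3 * (T + 2) / (real n)\<^sup>2 * H\<^sup>2 + 2 * T / (real n)\<^sup>2 * H\<^sup>2"
        unfolding split using e1 e2 e3 by linarith
      also have "\<dots> = (A - T) / (real n)\<^sup>2 * H\<^sup>2" by (simp add: A_def add_divide_distrib distrib_right)
      finally show ?thesis .
    qed
    have s1: "(\<Sum>i<n. R i) = (f (x + h) - f x) - g x \<bullet> h - (\<Sum>i<n. real i) / (real n)\<^sup>2 * (S h \<bullet> h)"
    proof -
      have "(\<Sum>i<n. f (b (Suc i)) - f (b i)) = f (x + h) - f x"
        using sum_lessThan_telescope[of "\<lambda>i. f (b i)" n] by (simp add: b0 bn)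
      moreover have "(\<Sum>i<n. g x \<bullet> (b (Suc i) - b i)) = g x \<bullet> h"
        using sum_lessThan_telescope[of b n] by (simp add: b0 bn inner_sum_right[symmetric])
      ultimately show ?thesis
        by (simp add: R_def sum_subtractf sum_distrib_right[symmetric] sum_divide_distrib[symmetric])
    qed
    have s2: "(\<Sum>i<n. real i) / (real n)\<^sup>2 = 1 / 2 - 1 / (2 * n)"
    proof -
      have "(\<Sum>i<n. real i) = real n * (real n - 1) / 2" by (induction n) (auto simp: field_simps)
      then show ?thesis using n1 by (simp add: power2_eq_square field_simps)
    qed
    have "(\<Sum>i<n. R i) = (f (x + h) - f x) - g x \<bullet> h - ((S h \<bullet> h) / 2 - 1 / (2 * n) * (S h \<bullet> h))"
      unfolding s1 s2 by (simp add: left_diff_distrib)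
    moreover have "\<bar>\<Sum>i<n. R i\<bar> \<le> n * ((A - T) / (real n)\<^sup>2 * H\<^sup>2)"
      using sum_bounded_above[of "{..<n}" "\<lambda>i. \<bar>R i\<bar>" "(A - T) / (real n)\<^sup>2 * H\<^sup>2"] R
        order_trans[OF sum_abs[of R "{..<n}"]] by simp
    moreover have "n * ((A - T) / (real n)\<^sup>2 * H\<^sup>2) = (A - T) / n * H\<^sup>2"
      using n1 by (simp add: power2_eq_square)
    moreover have "\<bar>1 / (2 * n) * (S h \<bullet> h)\<bar> \<le> T / n * H\<^sup>2"
    proof -
      have "\<bar>S h \<bullet> h\<bar> \<le> norm (S h) * norm h" by (rule Cauchy_Schwarz_ineq2)
      also have "\<dots> \<le> (H * T) * H" using T(1) T(2)[of h] H by (intro mult_mono) (auto simp: H_def)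
      finally have "\<bar>S h \<bullet> h\<bar> \<le> T * H\<^sup>2" by (simp add: power2_eq_square mult_ac)
      then have "1 / (2 * n) * \<bar>S h \<bullet> h\<bar> \<le> 1 / n * (T * H\<^sup>2)"
        using n1 by (intro mult_mono) (auto simp: field_simps)
      then show ?thesis by (simp add: abs_mult)
    qed
    ultimately have "\<bar>f (x + h) - f x - g x \<bullet> h - (S h \<bullet> h) / 2\<bar> \<le> (A - T) / n * H\<^sup>2 + T / n * H\<^sup>2"
      by linarith
    also have "\<dots> = A / n * H\<^sup>2" by (simp add: diff_divide_distrib left_diff_distrib)
    also have "\<dots> \<le> e * H\<^sup>2" using An by (intro mult_right_mono) auto
    finally show ?thesis by (simp add: H_def)
  qed
  with d show "\<exists>d>0. \<forall>h. norm h < d \<longrightarrow> \<bar>f (x + h) - f x - g x \<bullet> h - (S h \<bullet> h) / 2\<bar> \<le> e * (norm h)\<^sup>2"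
    by blast
qed

text \<open>
  The extension is the infimum of the cones \<open>g a + L dist x a\<close>.
\<close>
lemma McShane_extension:
  fixes g :: "'a::metric_space \<Rightarrow> real"
  assumes g: "L-lipschitz_on K g" and K: "K \<noteq> {}"
  obtains f where "L-lipschitz_on UNIV f" "\<And>x. x \<in> K \<Longrightarrow> f x = g x"
proof
  have L: "0 \<le> L" using g by (rule lipschitz_on_nonneg)
  have lip: "\<bar>g a - g b\<bar> \<le> L * dist a b" if "a \<in> K" "b \<in> K" for a b
    using lipschitz_onD[OF g that] by (simp add: dist_real_def)
  define f where "f = (\<lambda>x. INF a\<in>K. g a + L * dist x a)"
  obtain a0 where a0: "a0 \<in> K" using K by blast
  have bdd: "bdd_below ((\<lambda>a. g a + L * dist x a) ` K)" for x
  proof (rule bdd_belowI2)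
    fix a assume a: "a \<in> K"
    have "L * dist a0 a \<le> L * dist x a0 + L * dist x a"
      using L dist_triangle[of a0 a x] by (metis distrib_left dist_commute mult_left_mono)
    then show "g a0 - L * dist x a0 \<le> g a + L * dist x a" using lip[OF a0 a] by linarith
  qed
  have le: "f x \<le> f y + L * dist x y" for x y
  proof -
    have "f x - L * dist x y \<le> g a + L * dist y a" if a: "a \<in> K" for a
    proof -
      have "f x \<le> g a + L * dist x a" unfolding f_def by (rule cINF_lower[OF bdd a])
      moreover have "L * dist x a \<le> L * dist x y + L * dist y a"
        using L dist_triangle[of x a y] by (metis distrib_left mult_left_mono)
      ultimately show ?thesis by linarith
    qed
    then have "f x - L * dist x y \<le> f y" unfolding f_def[of] by (intro cINF_greatest K) (auto simp: f_def)
    then show ?thesis by linarith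
  qed
  show "L-lipschitz_on UNIV f"
  proof (rule lipschitz_onI[OF _ L])
    fix x y show "dist (f x) (f y) \<le> L * dist x y"
      using le[of x y] le[of y x] by (simp add: dist_real_def dist_commute abs_le_iff)
  qed
  show "f x = g x" if x: "x \<in> K" for x
  proof (rule antisym)
    show "f x \<le> g x" using cINF_lower[OF bdd x, of x] by (simp add: f_def)
    show "g x \<le> f x" unfolding f_def
      by (rule cINF_greatest[OF K]) (use lip[OF x] in \<open>fastforce simp: abs_le_iff\<close>)
  qed
qed

lemma zero_if_inner_ge_quadratic:
  fixes v :: "'a::real_inner"
  assumes d: "0 < d" and ge: "\<And>h. norm h < d \<Longrightarrow> v \<bullet> h \<ge> - (C * (norm h)\<^sup>2)"
  shows "v = 0"
proof (rule ccontr)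
  assume v: "v \<noteq> 0"
  define t where "t = min (d / (2 * norm v)) (1 / (2 * (\<bar>C\<bar> + 1)))"
  have t: "0 < t" using d v by (simp add: t_def add_nonneg_pos)
  have "t * norm v \<le> d / (2 * norm v) * norm v" unfolding t_def by (intro mult_right_mono) auto
  then have "norm (- t *\<^sub>R v) < d" using t d v by simp
  from ge[OF this] have "t * (norm v)\<^sup>2 \<le> C * (t * norm v)\<^sup>2" using t
    by (simp add: power2_norm_eq_inner)
  then have "t * (norm v)\<^sup>2 * 1 \<le> t * (norm v)\<^sup>2 * (C * t)" by (simp add: power2_eq_square mult_ac)
  then have "1 \<le> C * t" using t v by (subst (asm) mult_le_cancel_left_pos) auto
  also have "C * t \<le> \<bar>C\<bar> * (1 / (2 * (\<bar>C\<bar> + 1)))" unfolding t_def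
    using d by (intro mult_mono) auto
  also have "\<dots> < 1" by (simp add: field_simps add_nonneg_pos)
  finally show False by simp
qed

text \<open>
  This replaces the combination of Aleksandrov's theorem with Jensen's lemma. \<open>K\<close> is the set of points
  of the ball touched from above by a plane of slope at most \<open>\<delta>'\<close>, and \<open>G\<close> is the slope. Rademacher's
  theorem is applied to an extension of \<open>G\<close> and to the distance from \<open>K\<close>: at a point of \<open>K\<close> the latter
  has a minimum, so where it is differentiable its derivative vanishes, which is the density
  of \<open>K\<close> required by the preceding expansion lemma.
\<close>
lemma peano2_at_contact_point:
  fixes w :: "'a::euclidean_space \<Rightarrow> real"
  assumes \<rho>: "0 < \<rho>" and \<delta>: "0 < \<delta>" and C: "0 \<le> C"
    and cont: "continuous_on (cball x0 \<rho>) w"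
    and lower: "\<And>x. x \<in> ball x0 \<rho> \<Longrightarrow> \<exists>q. \<forall>y\<in>cball x0 \<rho>. w x + q \<bullet> (y - x) - C * (norm (y - x))\<^sup>2 \<le> w y"
    and strict: "\<And>y. y \<in> sphere x0 \<rho> \<Longrightarrow> w y < w x0"
  obtains x p S where "x \<in> ball x0 \<rho>" "norm p \<le> \<delta>" "peano2 w x p S" "\<And>h. S h \<bullet> h \<le> 0"
proof -
  let ?B = "cball x0 \<rho>"
  have x0B: "x0 \<in> ?B" using \<rho> by simp
  have "\<exists>m<w x0. \<forall>y\<in>sphere x0 \<rho>. w y \<le> m"
  proof (cases "sphere x0 \<rho> = {}")
    case True then show ?thesis by (intro exI[of _ "w x0 - 1"]) auto
  next
    case False
    have "continuous_on (sphere x0 \<rho>) w" by (rule continuous_on_subset[OF cont]) auto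
    then obtain y where "y \<in> sphere x0 \<rho>" "\<forall>z\<in>sphere x0 \<rho>. w z \<le> w y"
      using continuous_attains_sup[OF compact_sphere False] by blast
    then show ?thesis using strict by blast
  qed
  then obtain m where m: "m < w x0" "\<And>y. y \<in> sphere x0 \<rho> \<Longrightarrow> w y \<le> m" by blast
  define \<delta>' where "\<delta>' = min \<delta> ((w x0 - m) / (2 * \<rho>))"
  have \<delta>': "0 < \<delta>'" "\<delta>' \<le> \<delta>" using \<delta> m \<rho> by (auto simp: \<delta>'_def)
  have \<delta>'\<rho>: "m + \<delta>' * \<rho> < w x0"
  proof -
    have "\<delta>' * \<rho> \<le> (w x0 - m) / (2 * \<rho>) * \<rho>" unfolding \<delta>'_def using \<rho> by (intro mult_right_mono) auto
    then show ?thesis using m \<rho> by simp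
  qed
  \<comment> \<open>contact points paired with their slopes; its projection \<open>K\<close> is compact\<close>
  define Z where "Z = (cball x0 \<rho> \<times> cball 0 \<delta>') \<inter> (\<Inter>y\<in>?B. {(x, p). x \<in> ?B \<and> w y \<le> w x + p \<bullet> (y - x)})"
  define K where "K = fst ` Z"
  have Z: "(x, p) \<in> Z \<longleftrightarrow> x \<in> ?B \<and> norm p \<le> \<delta>' \<and> (\<forall>y\<in>?B. w y \<le> w x + p \<bullet> (y - x))" for x p
    using x0B by (auto simp: Z_def)
  have "compact Z"
  proof -
    have eq: "Z = (\<Inter>y\<in>?B. {xp\<in>?B \<times> cball 0 \<delta>'. w y \<le> w (fst xp) + snd xp \<bullet> (y - fst xp)})"
      unfolding Z_def using x0B by (auto dest: bspec[OF _ x0B])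
    have "closed {xp\<in>?B \<times> cball 0 \<delta>'. w y \<le> w (fst xp) + snd xp \<bullet> (y - fst xp)}" for y
    proof (rule continuous_on_closed_Collect_le)
      show "continuous_on (?B \<times> cball 0 \<delta>') (\<lambda>xp. w (fst xp) + snd xp \<bullet> (y - fst xp))"
        by (intro continuous_intros continuous_on_compose2[OF cont]) auto
    qed (auto intro!: closed_Times continuous_intros)
    then have "closed Z" unfolding eq by (intro closed_INT ballI)
    moreover have "bounded Z"
      by (rule bounded_subset[OF bounded_Times[OF bounded_cball bounded_cball]]) (auto simp: Z_def)
    ultimately show ?thesis by (simp add: compact_eq_bounded_closed)
  qed
  then have compK: "compact K" unfolding K_def by (intro compact_continuous_image continuous_intros)
  have contact: "x \<in> ball x0 \<rho>" if "(x, p) \<in> Z" for x p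
  proof (rule ccontr)
    assume "x \<notin> ball x0 \<rho>"
    then have x: "x \<in> sphere x0 \<rho>" using that by (auto simp: Z)
    have "w x0 \<le> w x + p \<bullet> (x0 - x)" using that x0B by (auto simp: Z)
    also have "p \<bullet> (x0 - x) \<le> norm p * norm (x0 - x)" by (rule norm_cauchy_schwarz)
    also have "\<dots> \<le> \<delta>' * \<rho>" using that x \<delta>' by (intro mult_mono) (auto simp: Z dist_norm)
    finally show False using m(2)[OF x] \<delta>'\<rho> by linarith
  qed
  have KB: "K \<subseteq> ball x0 \<rho>" using contact by (force simp: K_def)
  define G where "G = (\<lambda>x. SOME p. (x, p) \<in> Z)"
  have GZ: "(x, G x) \<in> Z" if "x \<in> K" for x
    using that unfolding K_def G_def by (metis (mono_tags, lifting) imageE prod.collapse someI_ex)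
  have slope: "w x + p \<bullet> (y - x) - C * (norm (y - x))\<^sup>2 \<le> w y" "w y \<le> w x + p \<bullet> (y - x)"
    if xp: "(x, p) \<in> Z" and y: "y \<in> ?B" for x p y
  proof -
    have xB: "x \<in> ball x0 \<rho>" using contact[OF xp] .
    then obtain q where q: "\<And>y. y \<in> ?B \<Longrightarrow> w x + q \<bullet> (y - x) - C * (norm (y - x))\<^sup>2 \<le> w y"
      using lower by blast
    have up: "w y \<le> w x + p \<bullet> (y - x)" if "y \<in> ?B" for y using xp that by (auto simp: Z)
    obtain d where d: "d > 0" "ball x d \<subseteq> ball x0 \<rho>" using openE[OF open_ball xB] by blast
    have "p - q = 0"
    proof (rule zero_if_inner_ge_quadratic[OF d(1)])
      fix h :: 'a assume "norm h < d"
      then have "x + h \<in> ball x d" by (simp add: dist_norm)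
      then have "x + h \<in> ?B" using d(2) by (auto simp: less_imp_le)
      from q[OF this] up[OF this] show "- (C * (norm h)\<^sup>2) \<le> (p - q) \<bullet> h" by (simp add: inner_diff_left)
    qed
    then show "w x + p \<bullet> (y - x) - C * (norm (y - x))\<^sup>2 \<le> w y" "w y \<le> w x + p \<bullet> (y - x)"
      using q[OF y] up[OF y] by auto
  qed
  have uniq: "p = G x" if xp: "(x, p) \<in> Z" for x p
  proof -
    have xK: "x \<in> K" using xp by (force simp: K_def)
    obtain d where d: "d > 0" "ball x d \<subseteq> ball x0 \<rho>"
      using openE[OF open_ball contact[OF xp]] by blast
    have "p - G x = 0"
    proof (rule zero_if_inner_ge_quadratic[OF d(1)])
      fix h :: 'a assume "norm h < d"
      then have "x + h \<in> ball x d" by (simp add: dist_norm)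
      then have "x + h \<in> ?B" using d(2) by (auto simp: less_imp_le)
      from slope(1)[OF GZ[OF xK] this] slope(2)[OF xp this]
      show "- (C * (norm h)\<^sup>2) \<le> (p - G x) \<bullet> h" by (simp add: inner_diff_left)
    qed
    then show ?thesis by simp
  qed
  obtain r where r: "r > 0" "\<And>a. a \<in> K \<Longrightarrow> cball a r \<subseteq> ball x0 \<rho>"
  proof -
    obtain r where r: "r > 0" "(\<Union>a\<in>K. cball a r) \<subseteq> ball x0 \<rho>"
      using compact_subset_open_imp_cball_epsilon_subset[OF compK open_ball KB] .
    then show ?thesis by (intro that[of r]) (auto simp del: cball_subset_ball_iff)
  qed
  define \<Lambda> where "\<Lambda> = max (2 * C) (2 * \<delta>' / r)"
  \<comment> \<open>test the two-sided bounds at the point that lies \<open>norm (a' - a)\<close> beyond \<open>a'\<close> in the direction of \<open>G a' - G a\<close>\<close>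
  have lipG: "norm (G a' - G a) \<le> \<Lambda> * norm (a' - a)" if a: "a \<in> K" and a': "a' \<in> K" for a a'
  proof (cases "a = a' \<or> G a' = G a")
    case True
    moreover have "0 \<le> \<Lambda>" using C by (simp add: \<Lambda>_def le_max_iff_disj)
    ultimately show ?thesis by auto
  next
    case False
    define t where "t = norm (a' - a)"
    have t: "0 < t" using False by (auto simp: t_def)
    show ?thesis
    proof (cases "t \<le> r")
      case True
      define v where "v = G a' - G a"
      define b where "b = a' + (t / norm v) *\<^sub>R v"
      have v: "norm v > 0" using \<open>\<not> (a = a' \<or> G a' = G a)\<close> by (auto simp: v_def)
      have nb: "norm (b - a') = t" using v t by (simp add: b_def)
      then have bB: "b \<in> ?B" using r(2)[OF a'] True by (auto simp: subset_iff dist_norm norm_minus_commute less_imp_le)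
      have a'B: "a' \<in> ?B" using KB a' by (auto simp: less_imp_le)
      have "w b \<le> w a + G a \<bullet> (b - a)" by (rule slope(2)[OF GZ[OF a] bB])
      moreover have "w a' + G a' \<bullet> (b - a') - C * t\<^sup>2 \<le> w b" using slope(1)[OF GZ[OF a'] bB] nb by simp
      moreover have "w a + G a \<bullet> (a' - a) - C * t\<^sup>2 \<le> w a'" using slope(1)[OF GZ[OF a] a'B] by (simp add: t_def)
      moreover have "v \<bullet> (b - a') = G a' \<bullet> (b - a') - (G a \<bullet> (b - a) - G a \<bullet> (a' - a))"
        by (simp add: v_def inner_diff_left inner_diff_right)
      ultimately have "v \<bullet> (b - a') \<le> 2 * C * t\<^sup>2" by linarith
      moreover have "v \<bullet> (b - a') = t * norm v"
        using v by (simp add: b_def power2_norm_eq_inner[symmetric] power2_eq_square)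
      ultimately have "t * norm v \<le> t * (2 * C * t)" by (simp add: power2_eq_square mult_ac)
      then have "norm v \<le> 2 * C * t" using t by (rule mult_left_le_imp_le)
      also have "\<dots> \<le> \<Lambda> * t" using t by (intro mult_right_mono) (auto simp: \<Lambda>_def)
      finally show ?thesis by (simp add: v_def t_def)
    next
      case False
      have "norm (G a' - G a) \<le> norm (G a') + norm (G a)" by (rule norm_triangle_ineq4)
      also have "\<dots> \<le> 2 * \<delta>'" using GZ[OF a] GZ[OF a'] by (auto simp: Z)
      also have "\<dots> \<le> 2 * \<delta>' / r * t" using False r \<delta>' by (simp add: field_simps)
      also have "\<dots> \<le> \<Lambda> * t" using t by (intro mult_right_mono) (auto simp: \<Lambda>_def)
      finally show ?thesis by (simp add: t_def)
    qed
  qed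
  have onto: "ball 0 \<delta>' \<subseteq> G ` K"
  proof
    fix p :: 'a assume p: "p \<in> ball 0 \<delta>'"
    have "continuous_on ?B (\<lambda>y. w y - p \<bullet> (y - x0))" by (intro continuous_intros cont)
    moreover have "?B \<noteq> {}" using x0B by auto
    ultimately obtain x where x: "x \<in> ?B" "\<And>y. y \<in> ?B \<Longrightarrow> w y - p \<bullet> (y - x0) \<le> w x - p \<bullet> (x - x0)"
      using continuous_attains_sup[OF compact_cball] by blast
    have "(x, p) \<in> Z" unfolding Z
    proof (intro conjI ballI)
      show "w y \<le> w x + p \<bullet> (y - x)" if "y \<in> ?B" for y using x(2)[OF that] by (simp add: inner_diff_right)
    qed (use x p in auto)
    then have "p = G x" "x \<in> K" by (rule uniq) (force simp: K_def intro: \<open>(x, p) \<in> Z\<close>)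
    then show "p \<in> G ` K" by blast
  qed
  have nonneg: "\<not> negligible K"
  proof
    assume "negligible K"
    then have "negligible (G ` K)"
      by (rule negligible_locally_Lipschitz_image[OF order_refl]) (use lipG in blast)
    then have "negligible (ball (0::'a) \<delta>')" using onto negligible_subset by blast
    then show False using open_not_negligible[of "ball (0::'a) \<delta>'"] \<delta>'(1) by auto
  qed
  then have Kne: "K \<noteq> {}" by auto
  have "\<Lambda> \<ge> 0" using C by (simp add: \<Lambda>_def le_max_iff_disj)
  then have "\<Lambda>-lipschitz_on K (\<lambda>x. G x \<bullet> i)" if "i \<in> Basis" for i
  proof (intro lipschitz_onI)
    fix a b assume "a \<in> K" "b \<in> K"
    then have "norm (G a - G b) \<le> \<Lambda> * dist a b" using lipG[of b a] by (simp add: dist_norm)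
    moreover have "\<bar>(G a - G b) \<bullet> i\<bar> \<le> norm (G a - G b)" by (rule Basis_le_norm[OF that])
    ultimately show "dist (G a \<bullet> i) (G b \<bullet> i) \<le> \<Lambda> * dist a b" by (simp add: dist_real_def inner_diff_left)
  qed
  then have "\<forall>i\<in>Basis. \<exists>f. \<Lambda>-lipschitz_on UNIV f \<and> (\<forall>x\<in>K. f x = G x \<bullet> i)"
    by (metis McShane_extension[OF _ Kne])
  then obtain f where f: "\<And>i. i \<in> Basis \<Longrightarrow> \<Lambda>-lipschitz_on UNIV (f i)"
    and fG: "\<And>i x. i \<in> Basis \<Longrightarrow> x \<in> K \<Longrightarrow> f i x = G x \<bullet> i" by metis
  have "\<forall>i\<in>Basis. \<exists>N. negligible N \<and> (\<forall>x. x \<notin> N \<longrightarrow> f i differentiable (at x))"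
    by (metis rademacher f)
  then obtain N where N: "\<And>i. i \<in> Basis \<Longrightarrow> negligible (N i)"
    and Nd: "\<And>i x. i \<in> Basis \<Longrightarrow> x \<notin> N i \<Longrightarrow> f i differentiable (at x)" by metis
  have "1-lipschitz_on UNIV (\<lambda>x. infdist x K)"
    by (rule lipschitz_onI) (auto simp: dist_real_def infdist_triangle_abs)
  then obtain M where M: "negligible M" "\<And>x. x \<notin> M \<Longrightarrow> (\<lambda>x. infdist x K) differentiable (at x)"
    by (metis rademacher)
  have "negligible (M \<union> (\<Union>i\<in>Basis. N i))"
    using M N by (intro negligible_Un negligible_Union) auto
  then obtain x where xK: "x \<in> K" and xM: "x \<notin> M" and xN: "\<And>i. i \<in> Basis \<Longrightarrow> x \<notin> N i"
    using nonneg negligible_subset[of _ K] by blast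
  define g where "g = (\<lambda>y. \<Sum>i\<in>Basis. f i y *\<^sub>R i)"
  have gG: "g a = G a" if "a \<in> K" for a
    unfolding g_def using fG that euclidean_representation[of "G a"] by simp
  have "g differentiable (at x)" unfolding g_def
    by (intro differentiable_sum differentiable_scaleR Nd xN finite_Basis ballI) auto
  then obtain S where S: "(g has_derivative S) (at x)" by (auto simp: differentiable_def)
  have dens: "\<exists>d>0. \<forall>y. norm (y - x) < d \<longrightarrow> (\<exists>a\<in>K. norm (a - y) \<le> e * norm (y - x))" if e: "0 < e" for e
  proof -
    obtain D where D: "((\<lambda>x. infdist x K) has_derivative D) (at x)"
      using M(2)[OF xM] by (auto simp: differentiable_def)
    have D0: "D = (\<lambda>h. 0)"
      by (rule has_derivative_local_min[OF D]) (use xK in \<open>simp add: infdist_nonneg\<close>)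
    obtain d where d: "d > 0" "\<And>y. norm (y - x) < d \<Longrightarrow> infdist y K \<le> e * norm (y - x)"
      using D e xK unfolding D0 has_derivative_at_alt by (auto simp: infdist_nonneg)
    have "\<exists>a\<in>K. norm (a - y) \<le> e * norm (y - x)" if y: "norm (y - x) < d" for y
    proof -
      obtain a where "a \<in> K" "infdist y K = dist y a"
        using infdist_attains_inf[OF compact_imp_closed[OF compK] Kne] by blast
      then show ?thesis using d(2)[OF y] by (auto simp: dist_norm norm_minus_commute)
    qed
    then show ?thesis using d(1) by blast
  qed
  have P: "peano2 w x (g x) S"
  proof (rule peano2_if_contact_density[OF xK r(1) C _ dens S])
    fix a b assume a: "a \<in> K" and b: "b \<in> ball x r"
    then have bB: "b \<in> ?B" using r(2)[OF xK] by (auto simp: subset_iff less_imp_le)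
    have "0 \<le> C * (norm (b - a))\<^sup>2" using C by simp
    then show "\<bar>w b - w a - g a \<bullet> (b - a)\<bar> \<le> C * (norm (b - a))\<^sup>2"
      using slope[OF GZ[OF a] bB] unfolding gG[OF a] abs_le_iff by linarith
  qed
  show thesis
  proof (rule that[of x "g x" S])
    show "x \<in> ball x0 \<rho>" using xK KB by blast
    show "norm (g x) \<le> \<delta>" using GZ[OF xK] \<delta>' gG[OF xK] by (auto simp: Z)
    show "peano2 w x (g x) S" by (rule P)
    show "S h \<bullet> h \<le> 0" for h
    proof (rule ccontr)
      assume "\<not> S h \<bullet> h \<le> 0"
      then have pos: "S h \<bullet> h > 0" by simp
      have lin: "linear S" using P by (simp add: peano2_def)
      have h0: "h \<noteq> 0" using pos by auto
      define e where "e = (S h \<bullet> h) / (4 * (norm h)\<^sup>2)"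
      have e: "0 < e" using pos h0 by (simp add: e_def)
      obtain d where d: "d > 0" "\<And>k. norm k < d \<Longrightarrow> \<bar>w (x + k) - w x - g x \<bullet> k - (S k \<bullet> k) / 2\<bar> \<le> e * (norm k)\<^sup>2"
        using P e unfolding peano2_def by blast
      define t where "t = min d r / (2 * norm h)"
      have t: "0 < t" using d r h0 by (simp add: t_def)
      have nt: "norm (t *\<^sub>R h) = min d r / 2" using d r h0 by (simp add: t_def)
      have "w (x + t *\<^sub>R h) \<le> w x + g x \<bullet> (t *\<^sub>R h)"
      proof -
        have "x + t *\<^sub>R h \<in> cball x r" using nt r by (simp add: dist_norm)
        then have "x + t *\<^sub>R h \<in> ?B" using r(2)[OF xK] by (auto simp: subset_iff less_imp_le)
        from slope(2)[OF GZ[OF xK] this] show ?thesis by (simp add: gG[OF xK])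
      qed
      moreover have "\<bar>w (x + t *\<^sub>R h) - w x - g x \<bullet> (t *\<^sub>R h) - (S (t *\<^sub>R h) \<bullet> (t *\<^sub>R h)) / 2\<bar> \<le> e * (norm (t *\<^sub>R h))\<^sup>2"
        by (rule d(2)) (use nt d r in auto)
      ultimately have "(S (t *\<^sub>R h) \<bullet> (t *\<^sub>R h)) / 2 \<le> e * (norm (t *\<^sub>R h))\<^sup>2" by linarith
      then have "t\<^sup>2 * (S h \<bullet> h) / 2 \<le> t\<^sup>2 * ((S h \<bullet> h) / 4)"
        using h0 by (simp add: linear_scale[OF lin] e_def power_mult_distrib power2_eq_square mult_ac)
      then have "t\<^sup>2 * ((S h \<bullet> h) / 2) \<le> t\<^sup>2 * ((S h \<bullet> h) / 4)" by simp
      then have "(S h \<bullet> h) / 2 \<le> (S h \<bullet> h) / 4" using t by (subst (asm) mult_le_cancel_left_pos) auto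
      then show False using pos by simp
    qed
  qed
qed

section \<open>Semicontinuous functions and sup-convolutions\<close>

lemma usc_on_iff:
  "usc_on S u \<longleftrightarrow> (\<forall>x\<in>S. \<forall>y. u x < y \<longrightarrow> (\<exists>U. open U \<and> x \<in> U \<and> (\<forall>z\<in>S \<inter> U. u z < y)))"
proof -
  have "(\<forall>\<^sub>F z in at x within S. u z < y) \<longleftrightarrow> (\<exists>U. open U \<and> x \<in> U \<and> (\<forall>z\<in>S \<inter> U. u z < y))"
    if "u x < y" for x y
    unfolding eventually_at_topological by (rule arg_cong[where f=Ex], rule ext) (use that in auto)
  then show ?thesis unfolding usc_on_def by auto
qed

lemma lsc_on_iff_usc_on_uminus: "lsc_on S v \<longleftrightarrow> usc_on S (\<lambda>x. - v x)"
  unfolding lsc_on_def usc_on_def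
proof (intro ball_cong refl iffI allI impI)
  fix x y assume "\<forall>y<v x. \<forall>\<^sub>F z in at x within S. y < v z" "- v x < y"
  then show "\<forall>\<^sub>F z in at x within S. - v z < y" by (auto dest: spec[of _ "- y"] simp: minus_less_iff)
next
  fix x y assume "\<forall>y. - v x < y \<longrightarrow> (\<forall>\<^sub>F z in at x within S. - v z < y)" "y < v x"
  then show "\<forall>\<^sub>F z in at x within S. y < v z" by (auto dest: spec[of _ "- y"])
qed

lemma usc_on_subset: "usc_on S u \<Longrightarrow> T \<subseteq> S \<Longrightarrow> usc_on T u"
  unfolding usc_on_def by (meson filter_leD at_le subsetD)

lemma usc_on_continuous:
  fixes c :: "'a::topological_space \<Rightarrow> real"
  assumes "continuous_on S c" shows "usc_on S c"
  using assms unfolding usc_on_def continuous_on_def by (auto intro: order_tendstoD(2))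

lemma usc_on_add:
  assumes u: "usc_on S u" and v: "usc_on S v" shows "usc_on S (\<lambda>x. u x + v x)"
  unfolding usc_on_def
proof (intro ballI allI impI)
  fix x y assume x: "x \<in> S" and y: "u x + v x < y"
  define e where "e = (y - (u x + v x)) / 2"
  have "e > 0" using y by (simp add: e_def)
  then have "\<forall>\<^sub>F z in at x within S. u z < u x + e" "\<forall>\<^sub>F z in at x within S. v z < v x + e"
    using u v x by (simp_all add: usc_on_def)
  then show "\<forall>\<^sub>F z in at x within S. u z + v z < y"
    by eventually_elim (simp add: e_def field_simps)
qed

lemma usc_on_compose:
  assumes u: "usc_on S u" and f: "continuous_on T f" "f ` T \<subseteq> S"
  shows "usc_on T (\<lambda>x. u (f x))"
  unfolding usc_on_iff
proof (intro ballI allI impI)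
  fix x y assume x: "x \<in> T" and y: "u (f x) < y"
  have "f x \<in> S" using x f(2) by blast
  from u[unfolded usc_on_iff, rule_format, OF this y]
  obtain U where U: "open U" "f x \<in> U" "\<And>z. z \<in> S \<inter> U \<Longrightarrow> u z < y" by blast
  from f(1)[unfolded continuous_on_open_invariant, rule_format, OF U(1)]
  obtain V where V: "open V" "V \<inter> T = f -` U \<inter> T" by blast
  have "x \<in> V" using V(2) U(2) x by blast
  moreover have "u (f z) < y" if "z \<in> T \<inter> V" for z
    using that V(2) f(2) by (intro U(3)) blast
  ultimately show "\<exists>U. open U \<and> x \<in> U \<and> (\<forall>z\<in>T \<inter> U. u (f z) < y)"
    using V(1) by blast
qed

lemma usc_on_attains_sup:
  fixes u :: "'a::topological_space \<Rightarrow> real"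
  assumes S: "compact S" "S \<noteq> {}" and u: "usc_on S u"
  obtains x where "x \<in> S" "\<And>y. y \<in> S \<Longrightarrow> u y \<le> u x"
proof (rule ccontr)
  assume "\<not> thesis"
  then have "\<forall>x\<in>S. \<exists>y\<in>S. u x < u y" using that by (metis not_le)
  then obtain s where s: "\<And>x. x \<in> S \<Longrightarrow> s x \<in> S \<and> u x < u (s x)" by metis
  then have "\<forall>x\<in>S. \<exists>U. open U \<and> x \<in> U \<and> (\<forall>z\<in>S \<inter> U. u z < u (s x))"
    using u unfolding usc_on_iff by blast
  then obtain U where U: "\<And>x. x \<in> S \<Longrightarrow> open (U x) \<and> x \<in> U x \<and> (\<forall>z\<in>S \<inter> U x. u z < u (s x))" by metis
  obtain C where C: "C \<subseteq> S" "finite C" "S \<subseteq> (\<Union>x\<in>C. U x)"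
    using compactE_image[OF S(1), of S U] U by blast
  have "C \<noteq> {}" using C(3) S(2) by auto
  then obtain c where c: "c \<in> C" "\<And>x. x \<in> C \<Longrightarrow> u (s x) \<le> u (s c)"
  proof -
    have "Max ((\<lambda>x. u (s x)) ` C) \<in> (\<lambda>x. u (s x)) ` C" using C(2) \<open>C \<noteq> {}\<close> by (intro Max_in) auto
    then obtain c where "c \<in> C" "Max ((\<lambda>x. u (s x)) ` C) = u (s c)" by blast
    then show ?thesis using C(2) by (intro that[of c]) (auto simp flip: \<open>Max _ = _\<close>)
  qed
  have "s c \<in> S" using s c C by blast
  then obtain x where x: "x \<in> C" "s c \<in> U x" using C(3) by blast
  then have "u (s c) < u (s x)" using U C(1) \<open>s c \<in> S\<close> by blast
  then show False using c(2)[OF x(1)] by simp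
qed

definition sup_conv :: "real \<Rightarrow> 'a::euclidean_space set \<Rightarrow> ('a \<Rightarrow> real) \<Rightarrow> 'a \<Rightarrow> real" where
  "sup_conv \<epsilon> S u x = (SUP z\<in>S. u z - (norm (x - z))\<^sup>2 / (2 * \<epsilon>))"

lemma sup_conv_attained:
  fixes u :: "'a::euclidean_space \<Rightarrow> real"
  assumes S: "compact S" "S \<noteq> {}" and u: "usc_on S u"
  shows "\<exists>z\<in>S. sup_conv \<epsilon> S u x = u z - (norm (x - z))\<^sup>2 / (2 * \<epsilon>)"
    and "z \<in> S \<Longrightarrow> u z - (norm (x - z))\<^sup>2 / (2 * \<epsilon>) \<le> sup_conv \<epsilon> S u x"
proof -
  have "usc_on S (\<lambda>z. u z + - ((norm (x - z))\<^sup>2 / (2 * \<epsilon>)))"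
  proof (cases "\<epsilon> = 0")
    case False
    then show ?thesis by (intro usc_on_add u usc_on_continuous continuous_intros) simp
  qed (simp add: u)
  then obtain z0 where z0: "z0 \<in> S" "\<And>z. z \<in> S \<Longrightarrow> u z - (norm (x - z))\<^sup>2 / (2 * \<epsilon>) \<le> u z0 - (norm (x - z0))\<^sup>2 / (2 * \<epsilon>)"
    using usc_on_attains_sup[OF S] by (metis (no_types, lifting) diff_conv_add_uminus)
  have eq: "sup_conv \<epsilon> S u x = u z0 - (norm (x - z0))\<^sup>2 / (2 * \<epsilon>)"
    unfolding sup_conv_def by (rule cSup_eq_maximum) (use z0 in auto)
  then show "\<exists>z\<in>S. sup_conv \<epsilon> S u x = u z - (norm (x - z))\<^sup>2 / (2 * \<epsilon>)" using z0 by blast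
  show "u z - (norm (x - z))\<^sup>2 / (2 * \<epsilon>) \<le> sup_conv \<epsilon> S u x" if "z \<in> S" using z0(2)[OF that] eq by simp
qed

text \<open>
  The maximising paraboloid at \<open>x\<close> lies below the sup-convolution everywhere.
\<close>
lemma sup_conv_lower:
  fixes u :: "'a::euclidean_space \<Rightarrow> real"
  assumes S: "compact S" "S \<noteq> {}" and u: "usc_on S u" and \<epsilon>: "0 < \<epsilon>"
    and z: "z \<in> S" "sup_conv \<epsilon> S u x = u z - (norm (x - z))\<^sup>2 / (2 * \<epsilon>)"
  shows "sup_conv \<epsilon> S u x + ((z - x) /\<^sub>R \<epsilon>) \<bullet> (y - x) - (norm (y - x))\<^sup>2 / (2 * \<epsilon>) \<le> sup_conv \<epsilon> S u y"
proof -
  have "(norm (y - z))\<^sup>2 = (norm (y - x))\<^sup>2 - 2 * ((z - x) \<bullet> (y - x)) + (norm (x - z))\<^sup>2"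
    unfolding power2_norm_eq_inner by (simp add: inner_diff_left inner_diff_right inner_commute algebra_simps)
  moreover have "((z - x) /\<^sub>R \<epsilon>) \<bullet> (y - x) = 2 * ((z - x) \<bullet> (y - x)) / (2 * \<epsilon>)"
    using \<epsilon> by (simp add: inverse_eq_divide)
  ultimately have "(norm (y - z))\<^sup>2 / (2 * \<epsilon>) = (norm (y - x))\<^sup>2 / (2 * \<epsilon>) - ((z - x) /\<^sub>R \<epsilon>) \<bullet> (y - x) + (norm (x - z))\<^sup>2 / (2 * \<epsilon>)"
    by (simp only: add_divide_distrib diff_divide_distrib)
  then show ?thesis using sup_conv_attained(2)[OF S u z(1), of y \<epsilon>] z(2) by linarith
qed

text \<open>
  After adding \<open>|x|^2 / (2 \<epsilon>)\<close> the sup-convolution is a supremum of affine functions, hence convex and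
  finite.
\<close>
lemma continuous_on_sup_conv:
  fixes u :: "'a::euclidean_space \<Rightarrow> real"
  assumes S: "compact S" "S \<noteq> {}" and u: "usc_on S u" and \<epsilon>: "0 < \<epsilon>"
  shows "continuous_on A (sup_conv \<epsilon> S u)"
proof -
  let ?W = "sup_conv \<epsilon> S u" and ?f = "\<lambda>x. sup_conv \<epsilon> S u x + (norm x)\<^sup>2 / (2 * \<epsilon>)"
  have supp: "\<exists>q. \<forall>y. ?f x + q \<bullet> (y - x) \<le> ?f y" for x
  proof -
    obtain z where z: "z \<in> S" "?W x = u z - (norm (x - z))\<^sup>2 / (2 * \<epsilon>)"
      using sup_conv_attained(1)[OF S u] by blast
    have "?f x + (z /\<^sub>R \<epsilon>) \<bullet> (y - x) \<le> ?f y" for y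
    proof -
      have "(norm y)\<^sup>2 = (norm (y - x))\<^sup>2 + 2 * (x \<bullet> (y - x)) + (norm x)\<^sup>2"
        unfolding power2_norm_eq_inner by (simp add: inner_diff_left inner_diff_right inner_commute algebra_simps)
      moreover have "(x /\<^sub>R \<epsilon>) \<bullet> (y - x) = 2 * (x \<bullet> (y - x)) / (2 * \<epsilon>)"
        using \<epsilon> by (simp add: inverse_eq_divide)
      ultimately have "(norm y)\<^sup>2 / (2 * \<epsilon>) = (norm (y - x))\<^sup>2 / (2 * \<epsilon>) + (x /\<^sub>R \<epsilon>) \<bullet> (y - x) + (norm x)\<^sup>2 / (2 * \<epsilon>)"
        by (simp only: add_divide_distrib)
      moreover have "((z - x) /\<^sub>R \<epsilon>) \<bullet> (y - x) = (z /\<^sub>R \<epsilon>) \<bullet> (y - x) - (x /\<^sub>R \<epsilon>) \<bullet> (y - x)"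
        by (simp add: scaleR_diff_right inner_diff_left)
      ultimately show ?thesis using sup_conv_lower[OF S u \<epsilon> z, of y] by linarith
    qed
    then show ?thesis by blast
  qed
  have "convex_on UNIV ?f"
  proof (rule convex_onI)
    fix t :: real and x y :: 'a assume t: "0 < t" "t < 1"
    let ?m = "(1 - t) *\<^sub>R x + t *\<^sub>R y"
    obtain q where q: "\<And>y. ?f ?m + q \<bullet> (y - ?m) \<le> ?f y" using supp by blast
    have "(1 - t) * (?f ?m + q \<bullet> (x - ?m)) + t * (?f ?m + q \<bullet> (y - ?m)) \<le> (1 - t) * ?f x + t * ?f y"
      using t by (intro add_mono mult_left_mono q) auto
    moreover have "(1 - t) * (?f ?m + q \<bullet> (x - ?m)) + t * (?f ?m + q \<bullet> (y - ?m)) = ?f ?m"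
    proof -
      have "(1 - t) * (q \<bullet> (x - ?m)) + t * (q \<bullet> (y - ?m)) = q \<bullet> ((1 - t) *\<^sub>R (x - ?m) + t *\<^sub>R (y - ?m))"
        by (simp add: inner_add_right)
      also have "(1 - t) *\<^sub>R (x - ?m) + t *\<^sub>R (y - ?m) = 0" by (simp add: algebra_simps)
      finally have *: "(1 - t) * (q \<bullet> (x - ?m)) + t * (q \<bullet> (y - ?m)) = 0" by simp
      have "(1 - t) * (c + a) + t * (c + b) = c + ((1 - t) * a + t * b)" for a b c :: real
        by (simp add: algebra_simps)
      then show ?thesis by (simp only: * add_0_right)
    qed
    ultimately show "?f ?m \<le> (1 - t) * ?f x + t * ?f y" by linarith
  qed simp
  then have "continuous_on UNIV ?f" by (intro convex_on_continuous) auto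
  then have "continuous_on UNIV (\<lambda>x. ?f x - (norm x)\<^sup>2 / (2 * \<epsilon>))"
    by (rule continuous_on_diff) (use \<epsilon> in \<open>auto intro!: continuous_intros\<close>)
  then have "continuous_on UNIV ?W" by simp
  then show ?thesis using continuous_on_subset by blast
qed

text \<open>
  If \<open>z\<close> attains the supremum at \<open>x\<close>, then by translation \<open>u (z + h) - |x - z|^2 / (2 \<epsilon>)\<close> lies below the
  sup-convolution at \<open>x + h\<close>, with equality for \<open>h = 0\<close>. So expansions at \<open>x\<close> are test functions for \<open>u\<close> at \<open>z\<close>.
\<close>
lemma sup_conv_touching:
  fixes u :: "'a::euclidean_space \<Rightarrow> real"
  assumes S: "compact S" "S \<noteq> {}" and u: "usc_on S u" and \<eta>: "0 < \<eta>"
    and z: "z \<in> interior S" "sup_conv \<epsilon> S u x = u z - (norm (x - z))\<^sup>2 / (2 * \<epsilon>)"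
    and P: "peano2 (sup_conv \<epsilon> S u) x p A"
  shows "\<forall>\<^sub>F y in nhds z. u y \<le> u z + p \<bullet> (y - z) + (A (y - z) + \<eta> *\<^sub>R (y - z)) \<bullet> (y - z) / 2"
proof -
  obtain d where d: "d > 0" "\<And>h. norm h < d \<Longrightarrow>
     \<bar>sup_conv \<epsilon> S u (x + h) - sup_conv \<epsilon> S u x - p \<bullet> h - (A h \<bullet> h) / 2\<bar> \<le> \<eta> / 2 * (norm h)\<^sup>2"
    using P \<eta> unfolding peano2_def by (meson half_gt_zero)
  have "\<forall>\<^sub>F y in nhds z. y \<in> interior S" using z(1) by (intro eventually_nhds_in_open) auto
  moreover have "\<forall>\<^sub>F y in nhds z. dist y z < d" using d(1) by (auto simp: eventually_nhds_metric)
  ultimately show ?thesis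
  proof eventually_elim
    case (elim y)
    define h where "h = y - z"
    have "y \<in> S" using elim interior_subset by blast
    from sup_conv_attained(2)[OF S u this, of "x + h" \<epsilon>]
    have "u y - (norm (x - z))\<^sup>2 / (2 * \<epsilon>) \<le> sup_conv \<epsilon> S u (x + h)" by (simp add: h_def)
    moreover have "\<bar>sup_conv \<epsilon> S u (x + h) - sup_conv \<epsilon> S u x - p \<bullet> h - (A h \<bullet> h) / 2\<bar> \<le> \<eta> / 2 * (norm h)\<^sup>2"
      using elim by (intro d(2)) (simp add: h_def dist_norm)
    moreover have "(A h + \<eta> *\<^sub>R h) \<bullet> h / 2 = (A h \<bullet> h) / 2 + \<eta> / 2 * (norm h)\<^sup>2"
      by (simp add: inner_add_left power2_norm_eq_inner add_divide_distrib)
    ultimately show ?case using z(2) unfolding h_def[symmetric] by linarith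
  qed
qed

section \<open>The theorem on sums\<close>

lemma peano2_unique:
  assumes A: "peano2 f x p A" and B: "peano2 f x p B"
  shows "A h \<bullet> h = B h \<bullet> h"
proof (rule ccontr)
  assume ne: "A h \<bullet> h \<noteq> B h \<bullet> h"
  have lin: "linear A" "linear B" using A B by (auto simp: peano2_def)
  have h: "h \<noteq> 0" using ne by auto
  define D where "D = \<bar>A h \<bullet> h - B h \<bullet> h\<bar>"
  have D: "D > 0" using ne by (simp add: D_def)
  define e where "e = D / (8 * (norm h)\<^sup>2)"
  have e: "e > 0" using D h by (simp add: e_def)
  obtain d1 where d1: "d1 > 0" "\<And>k. norm k < d1 \<Longrightarrow> \<bar>f (x + k) - f x - p \<bullet> k - (A k \<bullet> k) / 2\<bar> \<le> e * (norm k)\<^sup>2"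
    using A e unfolding peano2_def by blast
  obtain d2 where d2: "d2 > 0" "\<And>k. norm k < d2 \<Longrightarrow> \<bar>f (x + k) - f x - p \<bullet> k - (B k \<bullet> k) / 2\<bar> \<le> e * (norm k)\<^sup>2"
    using B e unfolding peano2_def by blast
  define t where "t = min d1 d2 / (2 * norm h)"
  have t: "t > 0" using d1 d2 h by (simp add: t_def)
  have nt: "norm (t *\<^sub>R h) < d1" "norm (t *\<^sub>R h) < d2" using d1 d2 h by (auto simp: t_def min_def)
  have "\<bar>A (t *\<^sub>R h) \<bullet> (t *\<^sub>R h) - B (t *\<^sub>R h) \<bullet> (t *\<^sub>R h)\<bar> \<le> 4 * (e * (norm (t *\<^sub>R h))\<^sup>2)"
    using d1(2)[OF nt(1)] d2(2)[OF nt(2)] by linarith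
  moreover have "A (t *\<^sub>R h) \<bullet> (t *\<^sub>R h) - B (t *\<^sub>R h) \<bullet> (t *\<^sub>R h) = t\<^sup>2 * (A h \<bullet> h - B h \<bullet> h)"
    by (simp add: linear_scale[OF lin(1)] linear_scale[OF lin(2)] power2_eq_square right_diff_distrib)
  moreover have "4 * (e * (norm (t *\<^sub>R h))\<^sup>2) = t\<^sup>2 * (D / 2)"
    using h by (simp add: e_def power_mult_distrib)
  ultimately have "t\<^sup>2 * D \<le> t\<^sup>2 * (D / 2)" by (simp add: D_def abs_mult)
  then have "D \<le> D / 2" using t by (subst (asm) mult_le_cancel_left_pos) auto
  then show False using D by simp
qed

lemma peano2_add_quadratic:
  assumes P: "peano2 w x p A" and M: "linear M"
    and q: "\<And>h. q (x + h) = q x + g \<bullet> h + (M h \<bullet> h) / 2"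
    and w: "\<And>z. f z = w z + q z"
  shows "peano2 f x (p + g) (\<lambda>h. A h + M h)"
  unfolding peano2_def
proof (intro conjI allI impI)
  show "linear (\<lambda>h. A h + M h)" using P M unfolding peano2_def by (intro linear_compose_add) auto
  have "f (x + h) - f x - (p + g) \<bullet> h - (A h + M h) \<bullet> h / 2 = w (x + h) - w x - p \<bullet> h - (A h \<bullet> h) / 2" for h
    by (simp add: w q inner_add_left add_divide_distrib)
  then show "\<exists>d>0. \<forall>h. norm h < d \<longrightarrow> \<bar>f (x + h) - f x - (p + g) \<bullet> h - (A h + M h) \<bullet> h / 2\<bar> \<le> e * (norm h)\<^sup>2"
    if "0 < e" for e using P that by (simp add: peano2_def)
qed

text \<open>
  A sum of a function of \<open>x\<close> and a function of \<open>y\<close> has no mixed second order term: restricting the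
  expansion to either factor gives expansions of the summands, whose sum is again an expansion of
  the whole, and the quadratic form of an expansion is unique.
\<close>
lemma peano2_separate:
  fixes a :: "'a::euclidean_space \<Rightarrow> real" and b :: "'b::euclidean_space \<Rightarrow> real"
  assumes P: "peano2 (\<lambda>z. a (fst z) + b (snd z)) (x, y) (p, q) A"
  shows "peano2 a x p (\<lambda>h. fst (A (h, 0)))" "peano2 b y q (\<lambda>k. snd (A (0, k)))"
    "fst (A (h, 0)) \<bullet> h + snd (A (0, k)) \<bullet> k = A (h, k) \<bullet> (h, k)"
proof -
  have lin: "linear A" and exp: "\<And>e. e > 0 \<Longrightarrow> \<exists>d>0. \<forall>h. norm h < d \<longrightarrow>
      \<bar>a (fst ((x, y) + h)) + b (snd ((x, y) + h)) - (a (fst (x, y)) + b (snd (x, y))) - (p, q) \<bullet> h - (A h \<bullet> h) / 2\<bar> \<le> e * (norm h)\<^sup>2"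
    using P by (auto simp: peano2_def)
  have l1: "linear (\<lambda>h. fst (A (h, 0)))" and l2: "linear (\<lambda>k. snd (A (0, k)))"
  proof -
    have "A (u + v, 0) = A (u, 0) + A (v, 0)" "A (c *\<^sub>R u, 0) = c *\<^sub>R A (u, 0)" for u v :: 'a and c
      using linear_add[OF lin, of "(u, 0)" "(v, 0)"] linear_scale[OF lin, of c "(u, 0)"] by simp_all
    then show "linear (\<lambda>h. fst (A (h, 0)))" by (intro linearI) simp_all
    have "A (0, u + v) = A (0, u) + A (0, v)" "A (0, c *\<^sub>R u) = c *\<^sub>R A (0, u)" for u v :: 'b and c
      using linear_add[OF lin, of "(0, u)" "(0, v)"] linear_scale[OF lin, of c "(0, u)"] by simp_all
    then show "linear (\<lambda>k. snd (A (0, k)))" by (intro linearI) simp_all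
  qed
  have i1: "A (h, 0) \<bullet> (h, 0) = fst (A (h, 0)) \<bullet> h" and i2: "A (0, k) \<bullet> (0, k) = snd (A (0, k)) \<bullet> k" for h k
    by (cases "A (h, 0)"; simp) (cases "A (0, k)"; simp)
  show p1: "peano2 a x p (\<lambda>h. fst (A (h, 0)))" unfolding peano2_def
  proof (intro conjI allI impI l1)
    fix e :: real assume "0 < e"
    from exp[OF this] obtain d where d: "d > 0" "\<And>h. norm h < d \<Longrightarrow>
      \<bar>a (fst ((x, y) + h)) + b (snd ((x, y) + h)) - (a (fst (x, y)) + b (snd (x, y))) - (p, q) \<bullet> h - (A h \<bullet> h) / 2\<bar> \<le> e * (norm h)\<^sup>2" by blast
    have "\<bar>a (x + h) - a x - p \<bullet> h - (fst (A (h, 0)) \<bullet> h) / 2\<bar> \<le> e * (norm h)\<^sup>2" if "norm h < d" for h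
      using d(2)[of "(h, 0)"] that i1[of h] by (simp add: norm_Pair)
    with d(1) show "\<exists>d>0. \<forall>h. norm h < d \<longrightarrow> \<bar>a (x + h) - a x - p \<bullet> h - (fst (A (h, 0)) \<bullet> h) / 2\<bar> \<le> e * (norm h)\<^sup>2" by blast
  qed
  show p2: "peano2 b y q (\<lambda>k. snd (A (0, k)))" unfolding peano2_def
  proof (intro conjI allI impI l2)
    fix e :: real assume "0 < e"
    from exp[OF this] obtain d where d: "d > 0" "\<And>h. norm h < d \<Longrightarrow>
      \<bar>a (fst ((x, y) + h)) + b (snd ((x, y) + h)) - (a (fst (x, y)) + b (snd (x, y))) - (p, q) \<bullet> h - (A h \<bullet> h) / 2\<bar> \<le> e * (norm h)\<^sup>2" by blast
    have "\<bar>b (y + h) - b y - q \<bullet> h - (snd (A (0, h)) \<bullet> h) / 2\<bar> \<le> e * (norm h)\<^sup>2" if "norm h < d" for h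
      using d(2)[of "(0, h)"] that i2[of h] by (simp add: norm_Pair)
    with d(1) show "\<exists>d>0. \<forall>h. norm h < d \<longrightarrow> \<bar>b (y + h) - b y - q \<bullet> h - (snd (A (0, h)) \<bullet> h) / 2\<bar> \<le> e * (norm h)\<^sup>2" by blast
  qed
  have "peano2 (\<lambda>z. a (fst z) + b (snd z)) (x, y) (p, q) (\<lambda>z. (fst (A (fst z, 0)), snd (A (0, snd z))))"
    unfolding peano2_def
  proof (intro conjI allI impI)
    show "linear (\<lambda>z. (fst (A (fst z, 0)), snd (A (0, snd z))))"
      by (intro linearI) (simp_all add: linear_add[OF l1] linear_add[OF l2] linear_scale[OF l1] linear_scale[OF l2])
    fix e :: real assume e: "0 < e"
    obtain d1 where d1: "d1 > 0" "\<And>h. norm h < d1 \<Longrightarrow> \<bar>a (x + h) - a x - p \<bullet> h - (fst (A (h, 0)) \<bullet> h) / 2\<bar> \<le> e * (norm h)\<^sup>2"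
      using p1 e unfolding peano2_def by blast
    obtain d2 where d2: "d2 > 0" "\<And>h. norm h < d2 \<Longrightarrow> \<bar>b (y + h) - b y - q \<bullet> h - (snd (A (0, h)) \<bullet> h) / 2\<bar> \<le> e * (norm h)\<^sup>2"
      using p2 e unfolding peano2_def by blast
    have "\<bar>a (fst ((x, y) + z)) + b (snd ((x, y) + z)) - (a (fst (x, y)) + b (snd (x, y))) - (p, q) \<bullet> z
        - ((fst (A (fst z, 0)), snd (A (0, snd z))) \<bullet> z) / 2\<bar> \<le> e * (norm z)\<^sup>2" if z: "norm z < min d1 d2" for z
    proof -
      have n: "norm (fst z) < d1" "norm (snd z) < d2"
        using z norm_fst_le[of "fst z" "snd z"] norm_snd_le[of "snd z" "fst z"] by auto
      have "(norm z)\<^sup>2 = (norm (fst z))\<^sup>2 + (norm (snd z))\<^sup>2" by (simp add: norm_prod_def)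
      then have "e * (norm z)\<^sup>2 = e * (norm (fst z))\<^sup>2 + e * (norm (snd z))\<^sup>2" by (simp add: distrib_left)
      moreover have "(p, q) \<bullet> z = p \<bullet> fst z + q \<bullet> snd z"
        "(fst (A (fst z, 0)), snd (A (0, snd z))) \<bullet> z / 2 = fst (A (fst z, 0)) \<bullet> fst z / 2 + snd (A (0, snd z)) \<bullet> snd z / 2"
        by (simp_all add: inner_prod_def add_divide_distrib)
      moreover have "fst ((x, y) + z) = x + fst z" "snd ((x, y) + z) = y + snd z" "fst (x, y) = x" "snd (x, y) = y" by simp_all
      ultimately show ?thesis using d1(2)[OF n(1)] d2(2)[OF n(2)] unfolding abs_le_iff by (simp only:) linarith
    qed
    then show "\<exists>d>0. \<forall>z. norm z < d \<longrightarrow> \<bar>a (fst ((x, y) + z)) + b (snd ((x, y) + z)) - (a (fst (x, y)) + b (snd (x, y))) - (p, q) \<bullet> z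
        - ((fst (A (fst z, 0)), snd (A (0, snd z))) \<bullet> z) / 2\<bar> \<le> e * (norm z)\<^sup>2"
      using d1(1) d2(1) by (intro exI[of _ "min d1 d2"]) auto
  qed
  from peano2_unique[OF this P, of "(h, k)"]
  show "fst (A (h, 0)) \<bullet> h + snd (A (0, k)) \<bullet> k = A (h, k) \<bullet> (h, k)" by simp
qed


text \<open>
  The sup-convolution parameter tends to \<open>0\<close> with \<open>\<eta>\<close>, so the matrix inequality has the Hessian \<open>B\<close> of the
  penalty itself on the right and no term quadratic in \<open>B\<close>. A term \<open>\<theta> / 2 |(x, y) - (xb, yb)|^2\<close> makes the maximum strict.
\<close>
theorem theorem_on_sums:
  fixes u v :: "'a::euclidean_space \<Rightarrow> real"
  assumes \<rho>: "0 < \<rho>" and \<eta>: "0 < \<eta>"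
    and u: "usc_on (cball xb \<rho>) u" and v: "lsc_on (cball yb \<rho>) v"
    and Ku: "\<And>x. x \<in> cball xb \<rho> \<Longrightarrow> \<bar>u x\<bar> \<le> K" and Kv: "\<And>y. y \<in> cball yb \<rho> \<Longrightarrow> \<bar>v y\<bar> \<le> K"
    and B: "linear B" and symB: "\<And>a b. B a \<bullet> b = a \<bullet> B b"
    and max: "\<And>x y. x \<in> cball xb \<rho> \<Longrightarrow> y \<in> cball yb \<rho> \<Longrightarrow>
       u x - v y \<le> u xb - v yb + p \<bullet> (x - y - (xb - yb)) + (B (x - y - (xb - yb)) \<bullet> (x - y - (xb - yb))) / 2"
  obtains x y p' q' X Y where
    "norm (x - xb) < \<eta>" "norm (y - yb) < \<eta>" "norm (p' - p) < \<eta>" "norm (q' - p) < \<eta>"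
    "linear X" "linear Y"
    "\<forall>\<^sub>F z in nhds x. u z \<le> u x + p' \<bullet> (z - x) + (X (z - x) \<bullet> (z - x)) / 2"
    "\<forall>\<^sub>F z in nhds y. v y + q' \<bullet> (z - y) + (Y (z - y) \<bullet> (z - y)) / 2 \<le> v z"
    "\<And>h k. X h \<bullet> h - Y k \<bullet> k \<le> B (h - k) \<bullet> (h - k) + \<eta> * ((norm h)\<^sup>2 + (norm k)\<^sup>2)"
proof -
  let ?S = "cball xb \<rho>" and ?T = "cball yb \<rho>"
  have xbS: "xb \<in> ?S" and ybT: "yb \<in> ?T" using \<rho> by auto
  have K0: "0 \<le> K" using Ku[OF xbS] by linarith
  define v' where "v' = (\<lambda>y. - v y)"
  have v': "usc_on ?T v'" using v by (simp add: v'_def lsc_on_iff_usc_on_uminus)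
  obtain b where b: "b > 0" "\<And>h. norm (B h) \<le> norm h * b"
    using bounded_linear.pos_bounded[OF linear_conv_bounded_linear[THEN iffD1, OF B]] by blast
  define \<theta> where "\<theta> = \<eta> / 4"
  have \<theta>: "0 < \<theta>" using \<eta> by (simp add: \<theta>_def)
  have b\<theta>: "0 < 2 * b + \<theta>" using b \<theta> by simp
  \<comment> \<open>radius of the ball on which the contact point is sought; the gradient of the penalty varies little on it\<close>
  define \<rho>1 where "\<rho>1 = min (min (\<rho> / 2) (\<eta> / 2)) (\<eta> / (4 * (2 * b + \<theta>)))"
  have \<rho>1: "0 < \<rho>1" "\<rho>1 \<le> \<rho> / 2" "\<rho>1 \<le> \<eta> / 2"
  proof -
    show "0 < \<rho>1" using \<rho> \<eta> b\<theta> unfolding \<rho>1_def by (simp only: min_less_iff_conj) simp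
    have "\<rho>1 \<le> min (\<rho> / 2) (\<eta> / 2)" unfolding \<rho>1_def by (rule min.cobounded1)
    then show "\<rho>1 \<le> \<rho> / 2" "\<rho>1 \<le> \<eta> / 2" unfolding min.bounded_iff by blast+
  qed
  have \<rho>1\<eta>: "(2 * b + \<theta>) * \<rho>1 \<le> \<eta> / 4"
  proof -
    have "\<rho>1 \<le> \<eta> / (4 * (2 * b + \<theta>))" unfolding \<rho>1_def by (rule min.cobounded2)
    then have "\<rho>1 * (4 * (2 * b + \<theta>)) \<le> \<eta>" using b\<theta> by (subst (asm) pos_le_divide_eq) auto
    then show ?thesis by (simp add: mult_ac)
  qed
  define \<Lambda> where "\<Lambda> = norm p + 2 * \<rho> * b"
  have \<Lambda>: "0 \<le> \<Lambda>" using b \<rho> by (simp add: \<Lambda>_def)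
  define \<tau> where "\<tau> = min (min (\<rho> / 4) (\<eta> / 4)) (\<theta> * \<rho>1\<^sup>2 / (8 * (\<Lambda> + 1)))"
  have \<tau>: "0 < \<tau>" "\<tau> \<le> \<rho> / 4" "\<tau> \<le> \<eta> / 4"
  proof -
    show "0 < \<tau>" using \<rho> \<eta> \<theta> \<rho>1 \<Lambda> unfolding \<tau>_def by (simp only: min_less_iff_conj) (simp add: add_nonneg_pos)
    have "\<tau> \<le> min (\<rho> / 4) (\<eta> / 4)" unfolding \<tau>_def by (rule min.cobounded1)
    then show "\<tau> \<le> \<rho> / 4" "\<tau> \<le> \<eta> / 4" unfolding min.bounded_iff by blast+
  qed
  have \<Lambda>\<tau>: "2 * \<Lambda> * \<tau> < \<theta> / 2 * \<rho>1\<^sup>2"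
  proof -
    have "\<tau> \<le> \<theta> * \<rho>1\<^sup>2 / (8 * (\<Lambda> + 1))" unfolding \<tau>_def by (rule min.cobounded2)
    then have "\<tau> * (8 * (\<Lambda> + 1)) \<le> \<theta> * \<rho>1\<^sup>2" using \<Lambda> by (subst (asm) pos_le_divide_eq) auto
    then have "8 * (\<Lambda> * \<tau>) + 8 * \<tau> \<le> \<theta> * \<rho>1\<^sup>2" by (simp add: algebra_simps)
    moreover have "0 \<le> \<Lambda> * \<tau>" using \<Lambda> \<tau> by simp
    ultimately show ?thesis using \<tau>(1) by simp
  qed
  \<comment> \<open>then the supremum at a point of the balls is attained within distance \<open>\<tau>\<close>\<close>
  define \<epsilon> where "\<epsilon> = \<tau>\<^sup>2 / (4 * (K + 1))"
  have \<epsilon>: "0 < \<epsilon>" using \<tau> K0 by (simp add: \<epsilon>_def add_nonneg_pos)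
  define W1 where "W1 = sup_conv \<epsilon> ?S u"
  define W2 where "W2 = sup_conv \<epsilon> ?T v'"
  have S: "compact ?S" "?S \<noteq> {}" and T: "compact ?T" "?T \<noteq> {}" using \<rho> by auto
  have near: "norm (x - z) \<le> \<tau>"
    if u: "usc_on (cball c \<rho>) f" and K: "\<And>x. x \<in> cball c \<rho> \<Longrightarrow> \<bar>f x\<bar> \<le> K"
      and x: "x \<in> cball c \<rho>" and z: "z \<in> cball c \<rho>" "sup_conv \<epsilon> (cball c \<rho>) f x = f z - (norm (x - z))\<^sup>2 / (2 * \<epsilon>)"
    for f and c x z :: 'a
  proof -
    have "cball c \<rho> \<noteq> {}" using \<rho> by auto
    from sup_conv_attained(2)[OF compact_cball this u x, of x \<epsilon>]
    have "f x \<le> f z - (norm (x - z))\<^sup>2 / (2 * \<epsilon>)" using z(2) by simp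
    then have "(norm (x - z))\<^sup>2 / (2 * \<epsilon>) \<le> 2 * K" using K[OF x] K[OF z(1)] by linarith
    then have "(norm (x - z))\<^sup>2 \<le> 2 * K * (2 * \<epsilon>)" using \<epsilon> by (simp add: field_simps)
    also have "\<dots> \<le> 4 * (K + 1) * \<epsilon>" using \<epsilon> by (simp add: algebra_simps)
    also have "\<dots> = \<tau>\<^sup>2" using K0 by (simp add: \<epsilon>_def)
    finally show ?thesis using \<tau> by (simp add: power2_le_iff_abs_le)
  qed
  define \<psi> where "\<psi> = (\<lambda>d. p \<bullet> d + (B d \<bullet> d) / 2)"
  define s0 where "s0 = xb - yb"
  have \<psi>_add: "\<psi> (d + k) = \<psi> d + (p + B d) \<bullet> k + (B k \<bullet> k) / 2" for d k
    unfolding \<psi>_def using symB[of k d] symB[of d k]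
    by (simp add: linear_add[OF B] inner_add_left inner_add_right inner_commute[of k "B d"] add_divide_distrib)
  have Bb: "\<bar>B a \<bullet> c\<bar> \<le> b * norm a * norm c" for a c
  proof -
    have "\<bar>B a \<bullet> c\<bar> \<le> norm (B a) * norm c" by (rule Cauchy_Schwarz_ineq2)
    also have "\<dots> \<le> (norm a * b) * norm c" by (intro mult_right_mono b) auto
    finally show ?thesis by (simp add: mult_ac)
  qed
  have B2\<rho>: "B e \<bullet> a \<le> 2 * \<rho> * b * norm e" if "norm a \<le> 2 * \<rho>" for e a
  proof -
    have "b * norm e * norm a \<le> b * norm e * (2 * \<rho>)" using that b by (intro mult_left_mono) auto
    moreover have "b * norm e * (2 * \<rho>) = 2 * \<rho> * b * norm e" by simp
    ultimately show ?thesis using Bb[of e a] by linarith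
  qed
  have \<psi>_lip: "\<psi> a - \<psi> c \<le> \<Lambda> * norm (a - c)" if "norm a \<le> 2 * \<rho>" "norm c \<le> 2 * \<rho>" for a c
  proof -
    have "\<psi> a - \<psi> c = p \<bullet> (a - c) + (B (a - c) \<bullet> a) / 2 + (B (a - c) \<bullet> c) / 2"
      unfolding \<psi>_def using symB[of a c]
      by (simp add: linear_diff[OF B] inner_diff_left inner_diff_right inner_commute[of a "B c"] add_divide_distrib diff_divide_distrib)
    moreover have "p \<bullet> (a - c) \<le> norm p * norm (a - c)" by (rule norm_cauchy_schwarz)
    moreover have "B (a - c) \<bullet> a \<le> 2 * \<rho> * b * norm (a - c)" "B (a - c) \<bullet> c \<le> 2 * \<rho> * b * norm (a - c)"
      by (rule B2\<rho>; fact)+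
    ultimately show ?thesis unfolding \<Lambda>_def distrib_right by linarith
  qed
  define M where "M = (\<lambda>H. (B (fst H - snd H) + \<theta> *\<^sub>R fst H, - B (fst H - snd H) + \<theta> *\<^sub>R snd H))"
  have linM: "linear M" unfolding M_def
    by (rule linearI) (simp_all add: linear_diff[OF B] linear_add[OF B] linear_scale[OF B] algebra_simps)
  have MH: "M H \<bullet> H = B (fst H - snd H) \<bullet> (fst H - snd H) + \<theta> * ((norm (fst H))\<^sup>2 + (norm (snd H))\<^sup>2)" for H
    unfolding M_def inner_prod_def
    by (simp add: inner_add_left inner_diff_left inner_diff_right power2_norm_eq_inner distrib_left)
  define q where "q = (\<lambda>z. \<psi> (fst z - snd z - s0) + \<theta> / 2 * ((norm (fst z - xb))\<^sup>2 + (norm (snd z - yb))\<^sup>2))"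
  define g where "g = (\<lambda>z. (p + B (fst z - snd z - s0) + \<theta> *\<^sub>R (fst z - xb), - (p + B (fst z - snd z - s0)) + \<theta> *\<^sub>R (snd z - yb)))"
  have q_add: "q (z + H) = q z + g z \<bullet> H + (M H \<bullet> H) / 2" for z H
  proof -
    have n: "(norm (a + h))\<^sup>2 = (norm a)\<^sup>2 + 2 * (a \<bullet> h) + (norm h)\<^sup>2" for a h :: 'a
      unfolding power2_norm_eq_inner by (simp add: inner_add_left inner_add_right inner_commute)
    have e1: "fst (z + H) - snd (z + H) - s0 = (fst z - snd z - s0) + (fst H - snd H)"
      "fst (z + H) - xb = (fst z - xb) + fst H" "snd (z + H) - yb = (snd z - yb) + snd H" by simp_all
    define c where "c = p + B (fst z - snd z - s0)"
    have "g z \<bullet> H = c \<bullet> fst H + \<theta> * ((fst z - xb) \<bullet> fst H) + (\<theta> * ((snd z - yb) \<bullet> snd H) - c \<bullet> snd H)"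
      unfolding g_def c_def[symmetric] inner_prod_def fst_conv snd_conv
      by (simp only: inner_add_left inner_minus_left inner_scaleR_left)
    moreover have "c \<bullet> (fst H - snd H) = c \<bullet> fst H - c \<bullet> snd H" by (rule inner_diff_right)
    ultimately show ?thesis unfolding q_def e1 \<psi>_add n MH c_def[symmetric]
      by (simp add: field_simps)
  qed
  have M_le: "\<bar>M H \<bullet> H\<bar> \<le> (2 * b + \<theta>) * (norm H)\<^sup>2" for H
  proof -
    have n: "(norm H)\<^sup>2 = (norm (fst H))\<^sup>2 + (norm (snd H))\<^sup>2" by (simp add: norm_prod_def)
    have "(norm (fst H - snd H))\<^sup>2 \<le> (norm (fst H) + norm (snd H))\<^sup>2"
      by (intro power_mono norm_triangle_ineq4) auto
    also have "\<dots> \<le> 2 * (norm H)\<^sup>2"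
      unfolding n using sum_squares_bound[of "norm (fst H)" "norm (snd H)"] by (simp add: power2_sum)
    finally have "b * (norm (fst H - snd H))\<^sup>2 \<le> b * (2 * (norm H)\<^sup>2)" using b by (intro mult_left_mono) auto
    moreover have "\<bar>B (fst H - snd H) \<bullet> (fst H - snd H)\<bar> \<le> b * (norm (fst H - snd H))\<^sup>2"
      using Bb[of "fst H - snd H" "fst H - snd H"] by (simp add: power2_eq_square mult_ac)
    moreover have "0 \<le> \<theta> * (norm H)\<^sup>2" using \<theta> by simp
    ultimately show ?thesis unfolding MH n[symmetric] distrib_right abs_le_iff by linarith
  qed
  define w where "w = (\<lambda>z. W1 (fst z) + W2 (snd z) - q z)"
  define C where "C = 1 / (2 * \<epsilon>) + (2 * b + \<theta>) / 2"
  have C: "0 \<le> C" using \<epsilon> b\<theta> by (simp add: C_def)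
  have lower: "\<exists>r. \<forall>z'. w z + r \<bullet> (z' - z) - C * (norm (z' - z))\<^sup>2 \<le> w z'" for z
  proof -
    obtain z1 where z1: "z1 \<in> ?S" "W1 (fst z) = u z1 - (norm (fst z - z1))\<^sup>2 / (2 * \<epsilon>)"
      unfolding W1_def using sup_conv_attained(1)[OF S u] by blast
    obtain z2 where z2: "z2 \<in> ?T" "W2 (snd z) = v' z2 - (norm (snd z - z2))\<^sup>2 / (2 * \<epsilon>)"
      unfolding W2_def using sup_conv_attained(1)[OF T v'] by blast
    define r1 where "r1 = (z1 - fst z) /\<^sub>R \<epsilon>"
    define r2 where "r2 = (z2 - snd z) /\<^sub>R \<epsilon>"
    have "w z + ((r1, r2) - g z) \<bullet> (z' - z) - C * (norm (z' - z))\<^sup>2 \<le> w z'" for z'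
    proof -
      define H where "H = z' - z"
      have z': "z' = z + H" by (simp add: H_def)
      have "W1 (fst z) + r1 \<bullet> fst H - (norm (fst H))\<^sup>2 / (2 * \<epsilon>) \<le> W1 (fst z')"
        using sup_conv_lower[OF S u \<epsilon> z1[unfolded W1_def], of "fst z'"] unfolding W1_def r1_def H_def by simp
      moreover have "W2 (snd z) + r2 \<bullet> snd H - (norm (snd H))\<^sup>2 / (2 * \<epsilon>) \<le> W2 (snd z')"
        using sup_conv_lower[OF T v' \<epsilon> z2[unfolded W2_def], of "snd z'"] unfolding W2_def r2_def H_def by simp
      moreover have "q z' = q z + g z \<bullet> H + (M H \<bullet> H) / 2" unfolding z' by (rule q_add)
      moreover have "M H \<bullet> H \<le> (2 * b + \<theta>) * (norm H)\<^sup>2" using M_le[of H] by simp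
      moreover have "C * (norm H)\<^sup>2 = (norm (fst H))\<^sup>2 / (2 * \<epsilon>) + (norm (snd H))\<^sup>2 / (2 * \<epsilon>) + (2 * b + \<theta>) * (norm H)\<^sup>2 / 2"
        by (simp add: C_def distrib_right norm_prod_def add_divide_distrib)
      moreover have "((r1, r2) - g z) \<bullet> H = r1 \<bullet> fst H + r2 \<bullet> snd H - g z \<bullet> H"
        by (simp add: inner_diff_left inner_prod_def)
      ultimately show ?thesis unfolding H_def[symmetric] w_def by linarith
    qed
    then show ?thesis by blast
  qed
  have contw: "continuous_on A w" for A
  proof -
    have "continuous_on A B'" if "linear B'" for A and B' :: "'a \<Rightarrow> 'a"
      using that linear_continuous_on linear_conv_bounded_linear by blast
    then have "continuous_on (UNIV::'a set) B" using B by blast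
    then have cB: "continuous_on A (\<lambda>z. B (fst z - snd z - s0))"
      by (rule continuous_on_compose2) (auto intro!: continuous_intros)
    have c1: "continuous_on A (\<lambda>z. W1 (fst z))" unfolding W1_def
      by (rule continuous_on_compose2[OF continuous_on_sup_conv[OF S u \<epsilon>, of UNIV]]) (auto intro!: continuous_intros)
    have c2: "continuous_on A (\<lambda>z. W2 (snd z))" unfolding W2_def
      by (rule continuous_on_compose2[OF continuous_on_sup_conv[OF T v' \<epsilon>, of UNIV]]) (auto intro!: continuous_intros)
    show ?thesis unfolding w_def q_def \<psi>_def by (intro continuous_intros c1 c2 cB) auto
  qed
  have dist_fst: "norm (fst z - xb) \<le> r" "norm (snd z - yb) \<le> r" if "z \<in> cball (xb, yb) r" for z r
  proof -
    have "dist z (xb, yb) \<le> r" using that by (simp only: mem_cball dist_commute)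
    then have "dist (fst z) xb \<le> r" "dist (snd z) yb \<le> r"
      using dist_fst_le[of z "(xb, yb)"] dist_snd_le[of z "(xb, yb)"] by auto
    then show "norm (fst z - xb) \<le> r" "norm (snd z - yb) \<le> r" by (simp_all only: dist_norm)
  qed
  have w0: "u xb - v yb \<le> w (xb, yb)"
    using sup_conv_attained(2)[OF S u xbS, of xb \<epsilon>] sup_conv_attained(2)[OF T v' ybT, of yb \<epsilon>]
    by (simp add: w_def q_def \<psi>_def s0_def W1_def W2_def v'_def linear_0[OF B])
  have strict: "w z < w (xb, yb)" if z: "z \<in> sphere (xb, yb) \<rho>1" for z
  proof -
    have zc: "z \<in> cball (xb, yb) \<rho>1" using z by simp
    note d = dist_fst[OF zc]
    have zS: "fst z \<in> ?S" and zT: "snd z \<in> ?T" using d \<rho>1 \<rho> by (auto simp: dist_norm norm_minus_commute)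
    obtain z1 where z1: "z1 \<in> ?S" "W1 (fst z) = u z1 - (norm (fst z - z1))\<^sup>2 / (2 * \<epsilon>)"
      unfolding W1_def using sup_conv_attained(1)[OF S u] by blast
    obtain z2 where z2: "z2 \<in> ?T" "W2 (snd z) = v' z2 - (norm (snd z - z2))\<^sup>2 / (2 * \<epsilon>)"
      unfolding W2_def using sup_conv_attained(1)[OF T v'] by blast
    have n1: "norm (fst z - z1) \<le> \<tau>" by (rule near[OF u Ku zS z1[unfolded W1_def]])
    have n2: "norm (snd z - z2) \<le> \<tau>" by (rule near[OF v' _ zT z2[unfolded W2_def]]) (use Kv in \<open>simp add: v'_def\<close>)
    have "W1 (fst z) \<le> u z1" "W2 (snd z) \<le> - v z2" using z1(2) z2(2) \<epsilon> by (auto simp: v'_def)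
    moreover have "u z1 - v z2 \<le> u xb - v yb + \<psi> (z1 - z2 - s0)"
      using max[OF z1(1) z2(1)] by (simp add: \<psi>_def s0_def)
    moreover have "\<psi> (z1 - z2 - s0) - \<psi> (fst z - snd z - s0) \<le> \<Lambda> * (2 * \<tau>)"
    proof -
      have bnd: "norm (a - c - s0) \<le> 2 * \<rho>" if "a \<in> ?S" "c \<in> ?T" for a c
      proof -
        have eq: "a - c - s0 = (a - xb) - (c - yb)" by (simp add: s0_def)
        have "norm (a - xb) \<le> \<rho>" "norm (c - yb) \<le> \<rho>"
          using that by (simp_all add: dist_norm norm_minus_commute)
        then show ?thesis unfolding eq using norm_triangle_ineq4[of "a - xb" "c - yb"] by linarith
      qed
      have "\<psi> (z1 - z2 - s0) - \<psi> (fst z - snd z - s0) \<le> \<Lambda> * norm ((z1 - z2 - s0) - (fst z - snd z - s0))"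
        by (rule \<psi>_lip) (rule bnd; fact)+
      also have "(z1 - z2 - s0) - (fst z - snd z - s0) = (snd z - z2) - (fst z - z1)" by simp
      also have "\<Lambda> * norm ((snd z - z2) - (fst z - z1)) \<le> \<Lambda> * (2 * \<tau>)"
        using norm_triangle_ineq4[of "snd z - z2" "fst z - z1"] n1 n2 \<Lambda> by (intro mult_left_mono) auto
      finally show ?thesis .
    qed
    moreover have "w z = W1 (fst z) + W2 (snd z) - (\<psi> (fst z - snd z - s0) + \<theta> / 2 * \<rho>1\<^sup>2)"
    proof -
      have "norm (z - (xb, yb)) = \<rho>1" using z by (simp add: dist_norm norm_minus_commute)
      then have "(norm (z - (xb, yb)))\<^sup>2 = \<rho>1\<^sup>2" by simp
      then have "(norm (fst z - xb))\<^sup>2 + (norm (snd z - yb))\<^sup>2 = \<rho>1\<^sup>2" by (simp add: norm_prod_def)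
      then show ?thesis by (simp only: w_def q_def)
    qed
    moreover have "\<Lambda> * (2 * \<tau>) = 2 * \<Lambda> * \<tau>" by simp
    ultimately show ?thesis using w0 \<Lambda>\<tau> by linarith
  qed
  obtain z P A where z: "z \<in> ball (xb, yb) \<rho>1" and Pn: "norm P \<le> \<eta> / 4"
    and Pe: "peano2 w z P A" and neg: "\<And>H. A H \<bullet> H \<le> 0"
    by (rule peano2_at_contact_point[OF \<rho>1(1) _ C contw, of "\<eta> / 4" "(xb, yb)"])
      (use \<eta> lower strict in \<open>blast | simp\<close>)+
  define A1 where "A1 = (\<lambda>H. A H + M H)"
  define p' where "p' = fst (P + g z)"
  define q' where "q' = snd (P + g z)"
  have "peano2 (\<lambda>z. W1 (fst z) + W2 (snd z)) z (P + g z) A1"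
    unfolding A1_def by (rule peano2_add_quadratic[OF Pe linM q_add]) (simp add: w_def)
  then have "peano2 (\<lambda>z. W1 (fst z) + W2 (snd z)) (fst z, snd z) (p', q') A1"
    by (simp only: p'_def q'_def prod.collapse)
  note sep = peano2_separate[OF this]
  have zc: "z \<in> cball (xb, yb) \<rho>1" using z by simp
  note d = dist_fst[OF zc]
  have zS: "fst z \<in> ?S" and zT: "snd z \<in> ?T" using d \<rho>1 \<rho> by (auto simp: dist_norm norm_minus_commute)
  obtain z1 where z1: "z1 \<in> ?S" "W1 (fst z) = u z1 - (norm (fst z - z1))\<^sup>2 / (2 * \<epsilon>)"
    unfolding W1_def using sup_conv_attained(1)[OF S u] by blast
  obtain z2 where z2: "z2 \<in> ?T" "W2 (snd z) = v' z2 - (norm (snd z - z2))\<^sup>2 / (2 * \<epsilon>)"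
    unfolding W2_def using sup_conv_attained(1)[OF T v'] by blast
  have n1: "norm (fst z - z1) \<le> \<tau>" by (rule near[OF u Ku zS z1[unfolded W1_def]])
  have n2: "norm (snd z - z2) \<le> \<tau>" by (rule near[OF v' _ zT z2[unfolded W2_def]]) (use Kv in \<open>simp add: v'_def\<close>)
  have d1: "norm (z1 - xb) \<le> \<rho>1 + \<tau>"
    using norm_triangle_ineq[of "fst z - xb" "z1 - fst z"] d(1) n1 by (simp add: norm_minus_commute)
  have d2: "norm (z2 - yb) \<le> \<rho>1 + \<tau>"
    using norm_triangle_ineq[of "snd z - yb" "z2 - snd z"] d(2) n2 by (simp add: norm_minus_commute)
  have i1: "z1 \<in> interior ?S" and i2: "z2 \<in> interior ?T"
    using d1 d2 \<rho>1 \<tau> \<rho> by (auto simp: dist_norm norm_minus_commute)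
  define X where "X = (\<lambda>h. fst (A1 (h, 0)) + \<theta> *\<^sub>R h)"
  define Y where "Y = (\<lambda>k. - (snd (A1 (0, k)) + \<theta> *\<^sub>R k))"
  have Bd: "norm (B (fst z - snd z - s0)) \<le> 2 * b * \<rho>1"
  proof -
    have eq: "fst z - snd z - s0 = (fst z - xb) - (snd z - yb)" by (simp add: s0_def)
    have "norm (fst z - snd z - s0) \<le> 2 * \<rho>1"
      unfolding eq using norm_triangle_ineq4[of "fst z - xb" "snd z - yb"] d by linarith
    then have "norm (fst z - snd z - s0) * b \<le> 2 * \<rho>1 * b" using b by (intro mult_right_mono) auto
    then show ?thesis using b(2)[of "fst z - snd z - s0"] by (simp add: mult_ac)
  qed
  have Pn': "norm (fst P) \<le> \<eta> / 4" "norm (snd P) \<le> \<eta> / 4"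
    using Pn norm_fst_le[of "fst P" "snd P"] norm_snd_le[of "snd P" "fst P"] by auto
  have \<theta>d: "norm (\<theta> *\<^sub>R (fst z - xb)) \<le> \<theta> * \<rho>1" "norm (\<theta> *\<^sub>R (snd z - yb)) \<le> \<theta> * \<rho>1"
    using d \<theta> by (auto intro!: mult_left_mono)
  show thesis
  proof (rule that[of z1 z2 p' "- q'" X Y])
    show "norm (z1 - xb) < \<eta>" "norm (z2 - yb) < \<eta>" using d1 d2 \<rho>1 \<tau> \<eta> by auto
    have "p' - p = fst P + B (fst z - snd z - s0) + \<theta> *\<^sub>R (fst z - xb)"
      by (simp add: p'_def g_def)
    then have "norm (p' - p) \<le> norm (fst P) + norm (B (fst z - snd z - s0)) + norm (\<theta> *\<^sub>R (fst z - xb))"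
      by (metis norm_triangle_le add_right_mono norm_triangle_ineq)
    then show "norm (p' - p) < \<eta>"
      using Bd Pn' \<theta>d \<rho>1\<eta>[unfolded distrib_right] \<eta> by linarith
    have "- q' - p = - snd P + B (fst z - snd z - s0) + - (\<theta> *\<^sub>R (snd z - yb))"
      by (simp add: q'_def g_def)
    then have "norm (- q' - p) \<le> norm (- snd P) + norm (B (fst z - snd z - s0)) + norm (- (\<theta> *\<^sub>R (snd z - yb)))"
      by (metis norm_triangle_le add_right_mono norm_triangle_ineq)
    then show "norm (- q' - p) < \<eta>"
      using Bd Pn' \<theta>d \<rho>1\<eta>[unfolded distrib_right] \<eta> unfolding norm_minus_cancel by linarith
    have l: "linear (\<lambda>h. fst (A1 (h, 0)))" "linear (\<lambda>k. snd (A1 (0, k)))"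
      using sep(1,2) by (auto simp: peano2_def)
    show "linear X" "linear Y" unfolding X_def Y_def
      by (auto intro!: linearI simp: linear_add[OF l(1)] linear_add[OF l(2)]
          linear_scale[OF l(1)] linear_scale[OF l(2)] algebra_simps)
    show "\<forall>\<^sub>F z in nhds z1. u z \<le> u z1 + p' \<bullet> (z - z1) + (X (z - z1) \<bullet> (z - z1)) / 2"
      unfolding X_def by (rule sup_conv_touching[OF S u \<theta> i1 z1(2)[unfolded W1_def] sep(1)[unfolded W1_def]])
    have "\<forall>\<^sub>F z in nhds z2. v' z \<le> v' z2 + q' \<bullet> (z - z2) + ((snd (A1 (0, z - z2)) + \<theta> *\<^sub>R (z - z2)) \<bullet> (z - z2)) / 2"
      by (rule sup_conv_touching[OF T v' \<theta> i2 z2(2)[unfolded W2_def] sep(2)[unfolded W2_def]])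
    then show "\<forall>\<^sub>F z in nhds z2. v z2 + (- q') \<bullet> (z - z2) + (Y (z - z2) \<bullet> (z - z2)) / 2 \<le> v z"
      by (rule eventually_mono) (unfold Y_def v'_def inner_minus_left minus_divide_left[symmetric], linarith)
    fix h k
    have "X h \<bullet> h - Y k \<bullet> k = A1 (h, k) \<bullet> (h, k) + \<theta> * ((norm h)\<^sup>2 + (norm k)\<^sup>2)"
      unfolding sep(3)[symmetric] X_def Y_def by (simp add: inner_add_left inner_diff_left power2_norm_eq_inner distrib_left)
    also have "\<dots> \<le> M (h, k) \<bullet> (h, k) + \<theta> * ((norm h)\<^sup>2 + (norm k)\<^sup>2)"
      using neg[of "(h, k)"] unfolding A1_def inner_add_left by linarith
    also have "\<dots> = B (h - k) \<bullet> (h - k) + 2 * \<theta> * ((norm h)\<^sup>2 + (norm k)\<^sup>2)" unfolding MH by simp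
    also have "\<dots> \<le> B (h - k) \<bullet> (h - k) + \<eta> * ((norm h)\<^sup>2 + (norm k)\<^sup>2)"
      using \<eta> by (intro add_left_mono mult_right_mono) (auto simp: \<theta>_def)
    finally show "X h \<bullet> h - Y k \<bullet> k \<le> B (h - k) \<bullet> (h - k) + \<eta> * ((norm h)\<^sup>2 + (norm k)\<^sup>2)" .
  qed
qed

section \<open>Quadratic test functions and symmetric matrices\<close>

lemma sym_matrix_inner:
  fixes M :: "real^'n^'n"
  assumes "M \<in> sym_matrices"
  shows "(M *v a) \<bullet> b = a \<bullet> (M *v b)"
  using assms by (metis (mono_tags) dot_lmul_matrix sym_matrices_def mem_Collect_eq vector_transpose_matrix)

lemma C2_near_quadratic:
  fixes M :: "real^'n^'n"
  assumes M: "M \<in> sym_matrices"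
  shows "C2_near (\<lambda>z. p \<bullet> (z - x) + ((M *v (z - x)) \<bullet> (z - x)) / 2) (\<lambda>z. p + M *v (z - x)) (\<lambda>z. M) x"
  unfolding C2_near_def
proof (intro exI[of _ UNIV] conjI ballI)
  fix z
  have lin: "((\<lambda>z. M *v (z - x)) has_derivative (\<lambda>h. M *v h)) (at z)"
    by (rule has_derivative_eq_rhs, rule bounded_linear.has_derivative[OF matrix_vector_mul_bounded_linear])
      (auto intro!: derivative_eq_intros)
  show "((\<lambda>z. p + M *v (z - x)) has_derivative (\<lambda>h. M *v h)) (at z)"
    using has_derivative_add[OF has_derivative_const[of p] lin] by simp
  have "((\<lambda>z. p \<bullet> (z - x) + ((M *v (z - x)) \<bullet> (z - x)) / 2) has_derivative
      (\<lambda>h. p \<bullet> h + ((M *v (z - x)) \<bullet> h + (M *v h) \<bullet> (z - x)) / 2)) (at z)"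
    by (rule has_derivative_eq_rhs, (rule derivative_intros lin)+) auto
  moreover have "(M *v h) \<bullet> (z - x) = (M *v (z - x)) \<bullet> h" for h
    using sym_matrix_inner[OF M, of h "z - x"] by (simp add: inner_commute)
  ultimately show "GDERIV (\<lambda>z. p \<bullet> (z - x) + ((M *v (z - x)) \<bullet> (z - x)) / 2) z :> p + M *v (z - x)"
    unfolding gderiv_def by (simp add: inner_add_right inner_commute)
qed auto

text \<open>
  At a point near which the solution is constant, every touching quadratic has zero gradient. So a touching
  quadratic with nonzero gradient puts the point in the case of the definition where test functions count.
\<close>
lemma gradient_zero_if_touching_constant:
  fixes M :: "real^'n^'n"
  assumes "\<forall>\<^sub>F z in nhds x. 0 \<le> p \<bullet> (z - x) + ((M *v (z - x)) \<bullet> (z - x)) / 2"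
  shows "p = 0"
proof -
  obtain d where d: "d > 0" "\<And>z. dist z x < d \<Longrightarrow> 0 \<le> p \<bullet> (z - x) + ((M *v (z - x)) \<bullet> (z - x)) / 2"
    using assms unfolding eventually_nhds_metric by blast
  obtain T where T: "T > 0" "\<And>h. norm (M *v h) \<le> norm h * T"
    using bounded_linear.pos_bounded[OF matrix_vector_mul_bounded_linear[of M]] by blast
  show ?thesis
  proof (rule zero_if_inner_ge_quadratic[OF d(1)])
    fix h :: "real^'n" assume h: "norm h < d"
    have "(M *v h) \<bullet> h \<le> norm (M *v h) * norm h" by (rule norm_cauchy_schwarz)
    also have "\<dots> \<le> (norm h * T) * norm h" by (intro mult_right_mono T) auto
    finally have "(M *v h) \<bullet> h \<le> T * (norm h)\<^sup>2" by (simp add: power2_eq_square mult_ac)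
    moreover have "0 \<le> p \<bullet> h + ((M *v h) \<bullet> h) / 2" using d(2)[of "x + h"] h by (simp add: dist_norm)
    moreover have "0 \<le> T * (norm h)\<^sup>2" using T by simp
    ultimately show "- (T * (norm h)\<^sup>2) \<le> p \<bullet> h" by linarith
  qed
qed

lemma subsolution_quadratic_test:
  assumes sub: "viscosity_subsolution F b \<beta> h \<Omega> u" and x: "x \<in> \<Omega>" and M: "M \<in> sym_matrices" and p: "p \<noteq> 0"
    and touch: "\<forall>\<^sub>F z in nhds x. u z \<le> u x + p \<bullet> (z - x) + ((M *v (z - x)) \<bullet> (z - x)) / 2"
  shows "- F p M + b x * norm p powr \<beta> \<le> h x"
proof -
  have "\<not> (\<forall>\<^sub>F z in nhds x. u z = u x)"
  proof
    assume "\<forall>\<^sub>F z in nhds x. u z = u x"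
    with touch have "\<forall>\<^sub>F z in nhds x. 0 \<le> p \<bullet> (z - x) + ((M *v (z - x)) \<bullet> (z - x)) / 2"
      by eventually_elim simp
    then show False using gradient_zero_if_touching_constant p by blast
  qed
  then have "\<forall>\<phi> D H. C2_near \<phi> D H x \<and> (\<forall>\<^sub>F z in nhds x. u z - \<phi> z \<le> u x - \<phi> x) \<and> D x \<noteq> 0 \<longrightarrow>
      - F (D x) (H x) + b x * norm (D x) powr \<beta> \<le> h x"
    using bspec[OF conjunct2[OF sub[unfolded viscosity_subsolution_def]] x] by (simp only: if_False)
  then have test: "C2_near \<phi> D H x \<Longrightarrow> \<forall>\<^sub>F z in nhds x. u z - \<phi> z \<le> u x - \<phi> x \<Longrightarrow> D x \<noteq> 0 \<Longrightarrow>
      - F (D x) (H x) + b x * norm (D x) powr \<beta> \<le> h x" for \<phi> D H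
    by blast
  show ?thesis
    using test[OF C2_near_quadratic[OF M, of p x]] touch p by (simp add: algebra_simps)
qed

lemma supersolution_quadratic_test:
  assumes super: "viscosity_supersolution F b \<beta> h \<Omega> u" and x: "x \<in> \<Omega>" and M: "M \<in> sym_matrices" and p: "p \<noteq> 0"
    and touch: "\<forall>\<^sub>F z in nhds x. u x + p \<bullet> (z - x) + ((M *v (z - x)) \<bullet> (z - x)) / 2 \<le> u z"
  shows "h x \<le> - F p M + b x * norm p powr \<beta>"
proof -
  have "\<not> (\<forall>\<^sub>F z in nhds x. u z = u x)"
  proof
    assume "\<forall>\<^sub>F z in nhds x. u z = u x"
    with touch have "\<forall>\<^sub>F z in nhds x. 0 \<le> (- p) \<bullet> (z - x) + (((- M) *v (z - x)) \<bullet> (z - x)) / 2"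
    proof eventually_elim
      case (elim z)
      have "(- M) *v (z - x) = - (M *v (z - x))"
        using matrix_vector_mult_diff_rdistrib[of 0 M "z - x"] by simp
      then show ?case using elim by simp
    qed
    then show False using gradient_zero_if_touching_constant[of "- p"] p by auto
  qed
  then have "\<forall>\<phi> D H. C2_near \<phi> D H x \<and> (\<forall>\<^sub>F z in nhds x. u z - \<phi> z \<ge> u x - \<phi> x) \<and> D x \<noteq> 0 \<longrightarrow>
      - F (D x) (H x) + b x * norm (D x) powr \<beta> \<ge> h x"
    using bspec[OF conjunct2[OF super[unfolded viscosity_supersolution_def]] x] by (simp only: if_False)
  then have test: "C2_near \<phi> D H x \<Longrightarrow> \<forall>\<^sub>F z in nhds x. u x - \<phi> x \<le> u z - \<phi> z \<Longrightarrow> D x \<noteq> 0 \<Longrightarrow>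
      h x \<le> - F (D x) (H x) + b x * norm (D x) powr \<beta>" for \<phi> D H
    by blast
  show ?thesis
    using test[OF C2_near_quadratic[OF M, of p x]] touch p by (simp add: algebra_simps)
qed

definition sym_part :: "(real^'n \<Rightarrow> real^'n) \<Rightarrow> real^'n^'n" where
  "sym_part X = (1 / 2) *\<^sub>R (matrix X + transpose (matrix X))"

lemma transpose_scaleR: "transpose (c *\<^sub>R M) = c *\<^sub>R transpose (M :: real^'n^'m)"
  by (simp add: transpose_def vec_eq_iff)

lemma transpose_add: "transpose (M + N) = transpose M + transpose (N :: real^'n^'m)"
  by (simp add: transpose_def vec_eq_iff)

lemma transpose_diff: "transpose (M - N) = transpose M - transpose (N :: real^'n^'m)"
  by (simp add: transpose_def vec_eq_iff)

lemma sym_matrices_intros: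
  shows "M \<in> sym_matrices \<Longrightarrow> N \<in> sym_matrices \<Longrightarrow> M + N \<in> sym_matrices"
    and "M \<in> sym_matrices \<Longrightarrow> N \<in> sym_matrices \<Longrightarrow> M - N \<in> sym_matrices"
    and "M \<in> sym_matrices \<Longrightarrow> c *\<^sub>R M \<in> sym_matrices"
    and "mat 1 \<in> sym_matrices" and "sym_part X \<in> sym_matrices"
  by (simp_all add: sym_matrices_def sym_part_def transpose_add transpose_diff transpose_scaleR add.commute)

lemma sym_part_form:
  assumes "linear X" shows "(sym_part X *v h) \<bullet> h = X h \<bullet> h"
proof -
  have "(transpose (matrix X) *v h) \<bullet> h = h \<bullet> (matrix X *v h)"
    by (metis dot_lmul_matrix vector_transpose_matrix transpose_transpose inner_commute)
  then show ?thesis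
    by (simp add: sym_part_def matrix_vector_mult_add_rdistrib scaleR_matrix_vector_assoc[symmetric]
        inner_add_left inner_add_right matrix_works[OF assms[folded linear_matrix_vector_mul_eq]] inner_commute)
qed

lemma psd_form: "psd M \<longleftrightarrow> (\<forall>h. 0 \<le> (M *v h) \<bullet> h)"
  by (simp add: psd_def inner_commute)

lemma form_expand: "((M :: real^'n^'n) *v h) \<bullet> h = (\<Sum>i\<in>UNIV. \<Sum>j\<in>UNIV. h $ i * h $ j * M $ i $ j)"
  by (simp add: inner_vec_def matrix_vector_mult_def sum_distrib_right sum_distrib_left mult_ac)

text \<open>
  Summing \<open>0 \<le> w \<bullet> M w\<close> over the vectors \<open>w = h_j e_i - h_i e_j\<close> avoids diagonalising \<open>M\<close>.
\<close>
lemma psd_form_le_trace: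
  fixes M :: "real^'n^'n"
  assumes psd: "psd M" and sym: "M \<in> sym_matrices"
  shows "(M *v h) \<bullet> h \<le> trace M * (norm h)\<^sup>2"
proof -
  have sm: "M $ i $ j = M $ j $ i" for i j
    using sym by (simp add: sym_matrices_def) (metis transpose_def vec_lambda_beta)
  have key: "2 * (h $ i * h $ j * M $ i $ j) \<le> (h $ j)\<^sup>2 * M $ i $ i + (h $ i)\<^sup>2 * M $ j $ j" for i j
  proof -
    define w where "w = (h $ j) *\<^sub>R axis i 1 - (h $ i) *\<^sub>R axis j (1::real)"
    have Mx: "(M *v axis k 1) $ l = M $ l $ k" for k l
      by (simp add: matrix_vector_mult_basis column_def)
    have "0 \<le> (M *v w) \<bullet> w" using psd by (simp add: psd_form)
    also have "(M *v w) \<bullet> w = (h $ j)\<^sup>2 * M $ i $ i - 2 * (h $ i * h $ j * M $ i $ j) + (h $ i)\<^sup>2 * M $ j $ j"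
      unfolding w_def using sm[of i j]
      by (simp add: matrix_vector_mult_diff_distrib matrix_vector_mult_scaleR inner_diff_left inner_diff_right
          inner_axis Mx power2_eq_square algebra_simps)
    finally show ?thesis by linarith
  qed
  have "2 * ((M *v h) \<bullet> h) = (\<Sum>i\<in>UNIV. \<Sum>j\<in>UNIV. 2 * (h $ i * h $ j * M $ i $ j))"
    unfolding form_expand by (simp add: sum_distrib_left)
  also have "\<dots> \<le> (\<Sum>i\<in>UNIV. \<Sum>j\<in>UNIV. (h $ j)\<^sup>2 * M $ i $ i + (h $ i)\<^sup>2 * M $ j $ j)"
    by (intro sum_mono key)
  also have "\<dots> = (\<Sum>i\<in>UNIV. \<Sum>j\<in>UNIV. (h $ j)\<^sup>2 * M $ i $ i) + (\<Sum>j\<in>UNIV. \<Sum>i\<in>UNIV. (h $ i)\<^sup>2 * M $ j $ j)"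
    unfolding sum.distrib by (subst (2) sum.swap) simp
  also have "\<dots> = 2 * (trace M * (norm h)\<^sup>2)"
  proof -
    have "(norm h)\<^sup>2 = (\<Sum>j\<in>UNIV. (h $ j)\<^sup>2)"
      by (simp add: norm_vec_def L2_set_def sum_nonneg)
    then show ?thesis
      by (simp add: trace_def sum_distrib_right sum_distrib_left mult.commute) (rule sum.swap)
  qed
  finally show ?thesis by simp
qed

text \<open>
  By polarisation and the parallelogram identity every entry of \<open>M\<close> is at most \<open>t\<close>.
\<close>
lemma norm_matrix_le_form:
  fixes M :: "real^'n^'n"
  assumes sym: "M \<in> sym_matrices" and t: "\<And>h. \<bar>(M *v h) \<bullet> h\<bar> \<le> t * (norm h)\<^sup>2"
  shows "norm M \<le> (real CARD('n))\<^sup>2 * t"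
proof -
  have sm: "M $ i $ j = M $ j $ i" for i j
    using sym by (simp add: sym_matrices_def) (metis transpose_def vec_lambda_beta)
  have Mx: "(M *v axis k 1) $ l = M $ l $ k" for k l
    by (simp add: matrix_vector_mult_basis column_def)
  have entry: "\<bar>M $ i $ j\<bar> \<le> t" for i j
  proof -
    define a b where "a = (axis i 1 :: real^'n)" and "b = (axis j 1 :: real^'n)"
    have "4 * M $ i $ j = (M *v (a + b)) \<bullet> (a + b) - (M *v (a - b)) \<bullet> (a - b)"
      unfolding a_def b_def using sm[of i j]
      by (simp add: matrix_vector_mult_diff_distrib matrix_vector_right_distrib inner_diff_left inner_diff_right
          inner_add_left inner_add_right inner_axis Mx)
    then have "\<bar>4 * M $ i $ j\<bar> \<le> t * (norm (a + b))\<^sup>2 + t * (norm (a - b))\<^sup>2"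
      using t[of "a + b"] t[of "a - b"] by linarith
    also have "\<dots> = t * ((norm (a + b))\<^sup>2 + (norm (a - b))\<^sup>2)" by (simp add: distrib_left)
    also have "(norm (a + b))\<^sup>2 + (norm (a - b))\<^sup>2 = 4"
      by (simp add: power2_norm_eq_inner inner_add_left inner_add_right inner_diff_left inner_diff_right a_def b_def
          inner_axis_axis)
    finally show ?thesis by simp
  qed
  have "norm M \<le> (\<Sum>i\<in>UNIV. norm (M $ i))"
    unfolding norm_vec_def[of M] by (rule L2_set_le_sum) simp
  also have "\<dots> \<le> (\<Sum>i\<in>(UNIV::'n set). \<Sum>j\<in>(UNIV::'n set). t)"
    by (intro sum_mono order_trans[OF norm_le_l1_cart] entry)
  finally show ?thesis by (simp add: power2_eq_square)
qed

section \<open>The inequality at a maximum of the doubled function\<close>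

lemma trace_arith:
  "trace (M + N) = trace M + trace (N :: real^'n^'n)" "trace (c *\<^sub>R M) = c * trace (M :: real^'n^'n)"
  "trace (mat 1 :: real^'n^'n) = real CARD('n)"
  by (simp_all add: trace_def sum.distrib sum_distrib_left mat_def)

text \<open>
  Let \<open>X\<close> and \<open>Y\<close> be the Hessians from the theorem on sums, for \<open>u - L |x - x0|^2\<close> and \<open>v\<close>. Putting \<open>h = k\<close> in
  the matrix inequality gives \<open>X \<le> Y\<close>, and \<open>h = e = - k\<close> gives \<open>X e \<bullet> e - Y e \<bullet> e \<le> 4 B e \<bullet> e\<close>, up to \<open>O(\<eta>)\<close>;
  hence \<open>G = tr (Y - X) \<ge> 4 \<kappa>\<close>. Putting \<open>h = 0\<close> or \<open>k = 0\<close> gives \<open>X \<le> B\<close> and \<open>Y \<ge> - B\<close>, so that \<open>X\<close> is bounded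
  by \<open>\<mu> + G\<close>. The error \<open>c |X| D\<close> caused by the two different gradients is thus at most a multiple of
  \<open>(\<mu> + G) D\<close>, and for small \<open>D\<close> its part with \<open>G\<close> is absorbed by the ellipticity term \<open>a |p|^\<alpha> G\<close>.
\<close>
lemma ishii_lions_at_maximum:
  fixes F :: "real^'n \<Rightarrow> real^'n^'n \<Rightarrow> real" and u v b f g :: "real^'n \<Rightarrow> real"
  assumes ell: "\<And>p M N. M \<in> sym_matrices \<Longrightarrow> N \<in> sym_matrices \<Longrightarrow> p \<noteq> 0 \<Longrightarrow> psd N \<Longrightarrow>
        a * norm p powr \<alpha> * trace N \<le> F p (M + N) - F p M \<and> F p (M + N) - F p M \<le> A * norm p powr \<alpha> * trace N"
    and grad: "\<And>p q M. M \<in> sym_matrices \<Longrightarrow> p \<noteq> 0 \<Longrightarrow> q \<noteq> 0 \<Longrightarrow>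
        \<bar>F p M - F q M\<bar> \<le> c * norm M * \<bar>norm p powr \<alpha> - norm q powr \<alpha>\<bar>"
    and a: "0 < a" and A: "0 \<le> A" and c: "0 \<le> c" and L: "0 \<le> L"
    and sub: "viscosity_subsolution F b \<beta> g \<Omega> u" and super: "viscosity_supersolution F b \<beta> f \<Omega> v"
    and \<Omega>: "open \<Omega>" "cball xb \<rho> \<subseteq> \<Omega>" "cball yb \<rho> \<subseteq> \<Omega>" and \<rho>: "0 < \<rho>"
    and Ku: "\<And>x. x \<in> \<Omega> \<Longrightarrow> \<bar>u x\<bar> \<le> K" and Kv: "\<And>x. x \<in> \<Omega> \<Longrightarrow> \<bar>v x\<bar> \<le> K"
    and cont: "continuous_on \<Omega> f" "continuous_on \<Omega> g" "continuous_on \<Omega> b"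
    and B: "linear B" and symB: "\<And>a b. B a \<bullet> b = a \<bullet> B b" and \<mu>: "0 \<le> \<mu>" "\<And>h. B h \<bullet> h \<le> \<mu> * (norm h)\<^sup>2"
    and e: "norm e = 1" "B e \<bullet> e \<le> - \<kappa>" and \<kappa>: "0 \<le> \<kappa>"
    and max: "\<And>x y. x \<in> cball xb \<rho> \<Longrightarrow> y \<in> cball yb \<rho> \<Longrightarrow>
       u x - L * (norm (x - x0))\<^sup>2 - v y \<le> u xb - L * (norm (xb - x0))\<^sup>2 - v yb
         + p \<bullet> (x - y - (xb - yb)) + (B (x - y - (xb - yb)) \<bullet> (x - y - (xb - yb))) / 2"
    and p: "p \<noteq> 0" and P: "P = p + (2 * L) *\<^sub>R (xb - x0)" "P \<noteq> 0"
    and D: "D = \<bar>norm p powr \<alpha> - norm P powr \<alpha>\<bar>" and c': "c' = c * (real CARD('n))\<^sup>2"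
    and small: "c' * D < a * norm p powr \<alpha>"
  shows "4 * \<kappa> * (a * norm p powr \<alpha> - c' * D) \<le> 2 * A * L * real CARD('n) * norm P powr \<alpha> + c' * \<mu> * D
      + g xb - f yb + b yb * norm p powr \<beta> - b xb * norm P powr \<beta>"
proof -
  define N where "N = real CARD('n)"
  define DD where "DD = (\<lambda>(p :: real^'n) (P :: real^'n). \<bar>norm p powr \<alpha> - norm P powr \<alpha>\<bar>)"
  define lhs where "lhs = (\<lambda>p P. 4 * \<kappa> * (a * norm p powr \<alpha> - c' * DD p P))"
  define rhs where "rhs = (\<lambda>\<eta> x y p P. A * norm P powr \<alpha> * ((2 * L + 2 * \<eta>) * N) + c' * (\<mu> + \<eta>) * DD p P
      + g x - f y + b y * norm p powr \<beta> - b x * norm P powr \<beta>)"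
  have N: "0 \<le> N" by (simp add: N_def)
  have c'0: "0 \<le> c'" using c by (simp add: c')
  have approx: "\<exists>x y p' q'. norm (x - xb) < \<eta> \<and> norm (y - yb) < \<eta> \<and> norm (p' - p) < \<eta> \<and> norm (q' - p) < \<eta> \<and>
      (q' \<noteq> 0 \<longrightarrow> p' + (2 * L) *\<^sub>R (x - x0) \<noteq> 0 \<longrightarrow>
       0 < a * norm q' powr \<alpha> - c' * DD q' (p' + (2 * L) *\<^sub>R (x - x0)) \<longrightarrow>
       lhs q' (p' + (2 * L) *\<^sub>R (x - x0)) \<le> rhs \<eta> x y q' (p' + (2 * L) *\<^sub>R (x - x0)))"
    if \<eta>: "0 < \<eta>" "\<eta> \<le> \<rho>" for \<eta>
  proof -
    define U where "U = (\<lambda>x. u x - L * (norm (x - x0))\<^sup>2)"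
    have "usc_on \<Omega> u" using sub by (simp add: viscosity_subsolution_def)
    then have "usc_on (cball xb \<rho>) u" using \<Omega> usc_on_subset by blast
    then have "usc_on (cball xb \<rho>) (\<lambda>x. u x + - (L * (norm (x - x0))\<^sup>2))"
      by (rule usc_on_add) (intro usc_on_continuous continuous_intros)
    then have uU: "usc_on (cball xb \<rho>) U" by (simp add: U_def)
    have vv: "lsc_on (cball yb \<rho>) v"
      using super \<Omega>(3) unfolding viscosity_supersolution_def lsc_on_iff_usc_on_uminus by (blast intro: usc_on_subset)
    define K' where "K' = K + L * (\<rho> + norm (xb - x0))\<^sup>2"
    have KU: "\<bar>U x\<bar> \<le> K'" if "x \<in> cball xb \<rho>" for x
    proof -
      have "norm (x - x0) \<le> norm (x - xb) + norm (xb - x0)" using norm_triangle_ineq[of "x - xb" "xb - x0"] by simp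
      also have "\<dots> \<le> \<rho> + norm (xb - x0)" using that by (simp add: dist_norm norm_minus_commute)
      finally have "L * (norm (x - x0))\<^sup>2 \<le> L * (\<rho> + norm (xb - x0))\<^sup>2" using L by (intro mult_left_mono power_mono) auto
      moreover have "0 \<le> L * (norm (x - x0))\<^sup>2" using L by simp
      moreover have "\<bar>u x\<bar> \<le> K" using that \<Omega> Ku by blast
      ultimately show ?thesis unfolding U_def K'_def by linarith
    qed
    have KV: "\<bar>v y\<bar> \<le> K'" if "y \<in> cball yb \<rho>" for y
    proof -
      have "\<bar>v y\<bar> \<le> K" using that \<Omega> Kv by blast
      moreover have "0 \<le> L * (\<rho> + norm (xb - x0))\<^sup>2" using L by simp
      ultimately show ?thesis unfolding K'_def by linarith
    qed
    obtain x y p' q' X Y where near: "norm (x - xb) < \<eta>" "norm (y - yb) < \<eta>" "norm (p' - p) < \<eta>" "norm (q' - p) < \<eta>"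
      and lin: "linear X" "linear Y"
      and tX: "\<forall>\<^sub>F z in nhds x. U z \<le> U x + p' \<bullet> (z - x) + (X (z - x) \<bullet> (z - x)) / 2"
      and tY: "\<forall>\<^sub>F z in nhds y. v y + q' \<bullet> (z - y) + (Y (z - y) \<bullet> (z - y)) / 2 \<le> v z"
      and XY: "\<And>h k. X h \<bullet> h - Y k \<bullet> k \<le> B (h - k) \<bullet> (h - k) + \<eta> * ((norm h)\<^sup>2 + (norm k)\<^sup>2)"
      by (rule theorem_on_sums[OF \<rho> \<eta>(1) uU vv KU KV B symB, of p]) (use max in \<open>auto simp: U_def\<close>)
    define P' where "P' = p' + (2 * L) *\<^sub>R (x - x0)"
    have "lhs q' P' \<le> rhs \<eta> x y q' P'" if q0: "q' \<noteq> 0" and P0: "P' \<noteq> 0" and pos: "0 < a * norm q' powr \<alpha> - c' * DD q' P'"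
    proof -
      define Xm where "Xm = sym_part X"
      define Ym where "Ym = sym_part Y"
      define I where "I = (mat 1 :: real^'n^'n)"
      have Xs: "Xm \<in> sym_matrices" and Ys: "Ym \<in> sym_matrices" and Is: "I \<in> sym_matrices"
        by (simp_all add: Xm_def Ym_def I_def sym_matrices_intros)
      have Xf: "(Xm *v h) \<bullet> h = X h \<bullet> h" and Yf: "(Ym *v h) \<bullet> h = Y h \<bullet> h" for h
        by (simp_all add: Xm_def Ym_def sym_part_form lin)
      have If: "(r *\<^sub>R I *v h) \<bullet> h = r * (norm h)\<^sup>2" for r h
        by (simp add: I_def scaleR_matrix_vector_assoc[symmetric] power2_norm_eq_inner)
      have mvadd: "((M + M') *v h) \<bullet> h = (M *v h) \<bullet> h + (M' *v h) \<bullet> h"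
        "((M - M') *v h) \<bullet> h = (M *v h) \<bullet> h - (M' *v h) \<bullet> h" for M M' :: "real^'n^'n" and h
        by (simp_all add: matrix_vector_mult_add_rdistrib matrix_vector_mult_diff_rdistrib inner_add_left inner_diff_left)
      \<comment> \<open>the shift by \<open>2 \<eta>\<close> makes \<open>Z\<close> positive semidefinite in spite of the error term in the matrix inequality\<close>
      define X1 where "X1 = Xm - (2 * \<eta>) *\<^sub>R I"
      define Z where "Z = Ym - X1"
      have X1s: "X1 \<in> sym_matrices" and Zs: "Z \<in> sym_matrices"
        by (simp_all add: X1_def Z_def sym_matrices_intros Xs Ys Is)
      have X1f: "(X1 *v h) \<bullet> h = X h \<bullet> h - 2 * \<eta> * (norm h)\<^sup>2" for h
        unfolding X1_def mvadd If Xf ..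
      have Zf: "(Z *v h) \<bullet> h = Y h \<bullet> h - X h \<bullet> h + 2 * \<eta> * (norm h)\<^sup>2" for h
        unfolding Z_def mvadd Yf X1f by simp
      have Zpsd: "psd Z" unfolding psd_form
      proof
        fix h show "0 \<le> (Z *v h) \<bullet> h" using XY[of h h] linear_0[OF B] by (simp add: Zf)
      qed
      define G where "G = trace Z"
      have Gge: "4 * \<kappa> \<le> G"
      proof -
        have "X e \<bullet> e - Y (- e) \<bullet> (- e) \<le> B (2 *\<^sub>R e) \<bullet> (2 *\<^sub>R e) + \<eta> * 2"
          using XY[of e "- e"] e(1) by (simp add: scaleR_2)
        moreover have "Y (- e) \<bullet> (- e) = Y e \<bullet> e" by (simp add: linear_neg[OF lin(2)])
        moreover have "B (2 *\<^sub>R e) \<bullet> (2 *\<^sub>R e) = 4 * (B e \<bullet> e)" by (simp add: linear_scale[OF B])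
        moreover have "(Z *v e) \<bullet> e \<le> G"
          using psd_form_le_trace[OF Zpsd Zs, of e] e(1) by (simp add: G_def)
        ultimately show ?thesis using e unfolding Zf by simp
      qed
      have G0: "0 \<le> G" using Gge \<kappa> by simp
      have X1n: "norm X1 \<le> N\<^sup>2 * (\<mu> + \<eta> + G)"
        unfolding N_def
      proof (rule norm_matrix_le_form[OF X1s])
        fix h :: "real^'n"
        have "X h \<bullet> h \<le> B h \<bullet> h + \<eta> * (norm h)\<^sup>2" using XY[of h 0] linear_0[OF lin(2)] by simp
        moreover have "- (Y h \<bullet> h) \<le> B h \<bullet> h + \<eta> * (norm h)\<^sup>2"
          using XY[of 0 h] linear_0[OF lin(1)] linear_neg[OF B, of h] by simp
        moreover have "(Z *v h) \<bullet> h \<le> G * (norm h)\<^sup>2" unfolding G_def by (rule psd_form_le_trace[OF Zpsd Zs])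
        moreover have "0 \<le> G * (norm h)\<^sup>2" "0 \<le> \<eta> * (norm h)\<^sup>2" using G0 \<eta> by auto
        moreover have "2 * \<eta> * (norm h)\<^sup>2 = \<eta> * (norm h)\<^sup>2 + \<eta> * (norm h)\<^sup>2" by simp
        ultimately show "\<bar>(X1 *v h) \<bullet> h\<bar> \<le> (\<mu> + \<eta> + G) * (norm h)\<^sup>2"
          using \<mu>(2)[of h] unfolding X1f Zf distrib_right abs_le_iff by linarith
      qed
      have tests: "- F P' (Xm + (2 * L) *\<^sub>R I) + b x * norm P' powr \<beta> \<le> g x"
        "f y \<le> - F q' Ym + b y * norm q' powr \<beta>"
      proof -
        have x\<Omega>: "x \<in> \<Omega>" and y\<Omega>: "y \<in> \<Omega>" using near \<eta> \<Omega> by (auto simp: dist_norm norm_minus_commute subset_iff)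
        show "- F P' (Xm + (2 * L) *\<^sub>R I) + b x * norm P' powr \<beta> \<le> g x"
        proof (rule subsolution_quadratic_test[OF sub x\<Omega> _ P0])
          show "Xm + (2 * L) *\<^sub>R I \<in> sym_matrices" by (simp add: sym_matrices_intros Xs Is)
          show "\<forall>\<^sub>F z in nhds x. u z \<le> u x + P' \<bullet> (z - x) + (((Xm + (2 * L) *\<^sub>R I) *v (z - x)) \<bullet> (z - x)) / 2"
            using tX
          proof eventually_elim
            case (elim z)
            have "(norm (z - x0))\<^sup>2 = (norm (x - x0))\<^sup>2 + 2 * ((x - x0) \<bullet> (z - x)) + (norm (z - x))\<^sup>2"
              unfolding power2_norm_eq_inner by (simp add: inner_diff_left inner_diff_right inner_commute)
            then have "L * (norm (z - x0))\<^sup>2 = L * (norm (x - x0))\<^sup>2 + 2 * L * ((x - x0) \<bullet> (z - x)) + L * (norm (z - x))\<^sup>2"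
              by (simp add: distrib_left)
            moreover have "P' \<bullet> (z - x) = p' \<bullet> (z - x) + 2 * L * ((x - x0) \<bullet> (z - x))"
              by (simp add: P'_def inner_add_left)
            ultimately show ?case using elim unfolding U_def mvadd If Xf add_divide_distrib by simp
          qed
        qed
        show "f y \<le> - F q' Ym + b y * norm q' powr \<beta>"
          by (rule supersolution_quadratic_test[OF super y\<Omega> Ys q0]) (use tY in \<open>simp add: Yf\<close>)
      qed
      have f1: "a * norm q' powr \<alpha> * G \<le> F q' Ym - F q' X1"
        using ell[OF X1s Zs q0 Zpsd] by (simp add: G_def Z_def)
      have f2: "F P' (Xm + (2 * L) *\<^sub>R I) - F P' X1 \<le> A * norm P' powr \<alpha> * ((2 * L + 2 * \<eta>) * N)"
      proof -
        have "psd ((2 * L + 2 * \<eta>) *\<^sub>R I)" unfolding psd_form If using L \<eta> by simp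
        moreover have "X1 + (2 * L + 2 * \<eta>) *\<^sub>R I = Xm + (2 * L) *\<^sub>R I" by (simp add: X1_def algebra_simps)
        moreover have "trace ((2 * L + 2 * \<eta>) *\<^sub>R I) = (2 * L + 2 * \<eta>) * N"
          by (simp only: trace_arith I_def N_def)
        ultimately show ?thesis
          using ell[OF X1s sym_matrices_intros(3)[OF Is] P0, of "2 * L + 2 * \<eta>"] by simp
      qed
      have f3: "F P' X1 - F q' X1 \<le> c' * (\<mu> + \<eta> + G) * DD q' P'"
      proof -
        have "F P' X1 - F q' X1 \<le> c * norm X1 * DD q' P'"
          using grad[OF X1s q0 P0] unfolding DD_def by linarith
        also have "\<dots> \<le> c * (N\<^sup>2 * (\<mu> + \<eta> + G)) * DD q' P'"
          using X1n c by (intro mult_right_mono mult_left_mono) (auto simp: DD_def)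
        finally show ?thesis by (simp add: c' N_def mult.assoc)
      qed
      have "(a * norm q' powr \<alpha> - c' * DD q' P') * (4 * \<kappa>) \<le> (a * norm q' powr \<alpha> - c' * DD q' P') * G"
        using pos Gge by (intro mult_left_mono) auto
      moreover have "lhs q' P' = (a * norm q' powr \<alpha> - c' * DD q' P') * (4 * \<kappa>)" by (simp add: lhs_def)
      moreover have "(a * norm q' powr \<alpha> - c' * DD q' P') * G = a * norm q' powr \<alpha> * G - c' * G * DD q' P'"
        by (simp add: algebra_simps)
      moreover have "c' * (\<mu> + \<eta> + G) * DD q' P' = c' * (\<mu> + \<eta>) * DD q' P' + c' * G * DD q' P'"
        by (simp add: algebra_simps)
      ultimately show ?thesis using f1 f2 f3 tests unfolding rhs_def by linarith
    qed
    then show ?thesis using near unfolding P'_def by blast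
  qed
  define \<eta> where "\<eta> = (\<lambda>n. \<rho> / real (Suc n))"
  have \<eta>: "0 < \<eta> n" "\<eta> n \<le> \<rho>" for n
  proof -
    show "0 < \<eta> n" using \<rho> by (simp add: \<eta>_def)
    have "\<rho> * 1 \<le> \<rho> * real (Suc n)" using \<rho> by (intro mult_left_mono) auto
    then show "\<eta> n \<le> \<rho>" by (simp add: \<eta>_def divide_le_eq)
  qed
  have \<eta>0: "\<eta> \<longlonglongrightarrow> 0" unfolding \<eta>_def by (rule LIMSEQ_Suc[OF lim_const_over_n])
  obtain x y p' q' where near: "\<And>n. norm (x n - xb) < \<eta> n" "\<And>n. norm (y n - yb) < \<eta> n"
    "\<And>n. norm (p' n - p) < \<eta> n" "\<And>n. norm (q' n - p) < \<eta> n"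
    and ineq: "\<And>n. q' n \<noteq> 0 \<Longrightarrow> p' n + (2 * L) *\<^sub>R (x n - x0) \<noteq> 0 \<Longrightarrow>
       0 < a * norm (q' n) powr \<alpha> - c' * DD (q' n) (p' n + (2 * L) *\<^sub>R (x n - x0)) \<Longrightarrow>
       lhs (q' n) (p' n + (2 * L) *\<^sub>R (x n - x0)) \<le> rhs (\<eta> n) (x n) (y n) (q' n) (p' n + (2 * L) *\<^sub>R (x n - x0))"
    using approx[OF \<eta>] by metis
  have lim: "s \<longlonglongrightarrow> l" if "\<And>n. norm (s n - l) < \<eta> n" for s :: "nat \<Rightarrow> real^'n" and l
  proof -
    have "(\<lambda>n. s n - l) \<longlonglongrightarrow> 0"
      by (rule Lim_null_comparison[OF _ \<eta>0]) (use that in \<open>auto intro!: always_eventually less_imp_le\<close>)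
    then show ?thesis by (simp add: LIM_zero_iff)
  qed
  have xl: "x \<longlonglongrightarrow> xb" and yl: "y \<longlonglongrightarrow> yb" and pl: "p' \<longlonglongrightarrow> p" and ql: "q' \<longlonglongrightarrow> p"
    using near by (auto intro: lim)
  define P' where "P' = (\<lambda>n. p' n + (2 * L) *\<^sub>R (x n - x0))"
  have Pl: "P' \<longlonglongrightarrow> P" unfolding P'_def P(1) by (intro tendsto_intros pl xl)
  have nq: "(\<lambda>n. norm (q' n) powr r) \<longlonglongrightarrow> norm p powr r" for r
    using p by (intro tendsto_powr tendsto_norm ql tendsto_const) auto
  have nP: "(\<lambda>n. norm (P' n) powr r) \<longlonglongrightarrow> norm P powr r" for r
    using P by (intro tendsto_powr tendsto_norm Pl tendsto_const) auto
  have DDl: "(\<lambda>n. DD (q' n) (P' n)) \<longlonglongrightarrow> D"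
    unfolding DD_def D by (intro tendsto_intros nq nP)
  have xb\<Omega>: "xb \<in> \<Omega>" and yb\<Omega>: "yb \<in> \<Omega>" using \<Omega> \<rho> by auto
  have ct: "(\<lambda>n. h (s n)) \<longlonglongrightarrow> h l" if "continuous_on \<Omega> h" "s \<longlonglongrightarrow> l" "l \<in> \<Omega>" for h :: "real^'n \<Rightarrow> real" and s l
    using continuous_on_eq_continuous_at[OF \<Omega>(1)] that isCont_tendsto_compose by blast
  have coef: "(\<lambda>n. a * norm (q' n) powr \<alpha> - c' * DD (q' n) (P' n)) \<longlonglongrightarrow> a * norm p powr \<alpha> - c' * D"
    by (intro tendsto_intros nq DDl)
  have ev: "\<forall>\<^sub>F n in sequentially. lhs (q' n) (P' n) \<le> rhs (\<eta> n) (x n) (y n) (q' n) (P' n)"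
  proof -
    have "\<forall>\<^sub>F n in sequentially. q' n \<noteq> 0" using tendsto_imp_eventually_ne[OF ql p] .
    moreover have "\<forall>\<^sub>F n in sequentially. P' n \<noteq> 0" using tendsto_imp_eventually_ne[OF Pl P(2)] .
    moreover have "\<forall>\<^sub>F n in sequentially. 0 < a * norm (q' n) powr \<alpha> - c' * DD (q' n) (P' n)"
      by (rule order_tendstoD(1)[OF coef]) (use small in simp)
    ultimately show ?thesis by eventually_elim (use ineq in \<open>simp add: P'_def\<close>)
  qed
  have l1: "(\<lambda>n. lhs (q' n) (P' n)) \<longlonglongrightarrow> 4 * \<kappa> * (a * norm p powr \<alpha> - c' * D)"
    unfolding lhs_def by (intro tendsto_mult tendsto_const coef)
  have l2: "(\<lambda>n. rhs (\<eta> n) (x n) (y n) (q' n) (P' n)) \<longlonglongrightarrow>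
      A * norm P powr \<alpha> * ((2 * L + 2 * 0) * N) + c' * (\<mu> + 0) * D + g xb - f yb + b yb * norm p powr \<beta> - b xb * norm P powr \<beta>"
    unfolding rhs_def by (intro tendsto_intros nP nq DDl \<eta>0 ct[OF cont(1) yl yb\<Omega>] ct[OF cont(2) xl xb\<Omega>]
        ct[OF cont(3) yl yb\<Omega>] ct[OF cont(3) xl xb\<Omega>])
  from tendsto_le[OF _ l2 l1 ev] show ?thesis by (simp add: N_def mult_ac)
qed

section \<open>Radial penalties\<close>

lemma peano_second_order:
  fixes \<psi> d\<psi> :: "real \<Rightarrow> real"
  assumes d0: "0 < d0" and der: "\<And>t. \<bar>t - s\<bar> < d0 \<Longrightarrow> (\<psi> has_real_derivative d\<psi> t) (at t)"
    and der2: "(d\<psi> has_real_derivative k) (at s)" and \<delta>: "0 < \<delta>"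
  shows "\<exists>r>0. \<forall>t. \<bar>t - s\<bar> < r \<longrightarrow> \<bar>\<psi> t - \<psi> s - d\<psi> s * (t - s) - k / 2 * (t - s)\<^sup>2\<bar> \<le> \<delta> * (t - s)\<^sup>2"
proof -
  obtain r1 where r1: "r1 > 0" "\<And>t. \<bar>t - s\<bar> < r1 \<Longrightarrow> \<bar>d\<psi> t - d\<psi> s - k * (t - s)\<bar> \<le> \<delta> * \<bar>t - s\<bar>"
    using der2[unfolded has_field_derivative_def has_derivative_at_alt] \<delta> by auto
  define r where "r = min d0 r1"
  define R where "R = (\<lambda>t. \<psi> t - d\<psi> s * (t - s) - k / 2 * (t - s)\<^sup>2)"
  have R': "(R has_real_derivative d\<psi> t - d\<psi> s - k * (t - s)) (at t)" if "\<bar>t - s\<bar> < r" for t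
    unfolding R_def using that by (auto intro!: derivative_eq_intros der simp: r_def)
  have "\<bar>R t - R s\<bar> \<le> \<delta> * (t - s)\<^sup>2" if t: "\<bar>t - s\<bar> < r" for t
  proof (cases "t = s")
    case False
    have "\<exists>z. \<bar>z - s\<bar> \<le> \<bar>t - s\<bar> \<and> \<bar>R t - R s\<bar> = \<bar>t - s\<bar> * \<bar>d\<psi> z - d\<psi> s - k * (z - s)\<bar>"
    proof (cases "s < t")
      case True
      have "\<exists>z. s < z \<and> z < t \<and> R t - R s = (t - s) * (d\<psi> z - d\<psi> s - k * (z - s))"
        by (rule MVT2[OF True]) (use t True in \<open>auto intro!: R'\<close>)
      then obtain z where "s < z" "z < t" "R t - R s = (t - s) * (d\<psi> z - d\<psi> s - k * (z - s))" by blast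
      then show ?thesis by (intro exI[of _ z]) (simp add: abs_mult)
    next
      case False
      then have ts: "t < s" using \<open>t \<noteq> s\<close> by simp
      have "\<exists>z. t < z \<and> z < s \<and> R s - R t = (s - t) * (d\<psi> z - d\<psi> s - k * (z - s))"
        by (rule MVT2[OF ts]) (use t ts in \<open>auto intro!: R'\<close>)
      then obtain z where z: "t < z" "z < s" "R s - R t = (s - t) * (d\<psi> z - d\<psi> s - k * (z - s))" by blast
      have "\<bar>R t - R s\<bar> = \<bar>R s - R t\<bar>" "\<bar>s - t\<bar> = \<bar>t - s\<bar>" by (simp_all add: abs_minus_commute)
      then show ?thesis using z by (intro exI[of _ z]) (simp add: abs_mult)
    qed
    then obtain z where z: "\<bar>z - s\<bar> \<le> \<bar>t - s\<bar>" "\<bar>R t - R s\<bar> = \<bar>t - s\<bar> * \<bar>d\<psi> z - d\<psi> s - k * (z - s)\<bar>" by blast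
    have "\<bar>d\<psi> z - d\<psi> s - k * (z - s)\<bar> \<le> \<delta> * \<bar>z - s\<bar>" using z(1) t by (intro r1(2)) (simp add: r_def)
    also have "\<dots> \<le> \<delta> * \<bar>t - s\<bar>" using z(1) \<delta> by (intro mult_left_mono) auto
    finally have "\<bar>R t - R s\<bar> \<le> \<bar>t - s\<bar> * (\<delta> * \<bar>t - s\<bar>)" unfolding z(2) by (intro mult_left_mono) auto
    also have "\<dots> = \<delta> * \<bar>t - s\<bar>\<^sup>2" by (simp add: power2_eq_square)
    finally show ?thesis by simp
  qed simp
  moreover have "r > 0" using d0 r1 by (simp add: r_def)
  moreover have "R t - R s = \<psi> t - \<psi> s - d\<psi> s * (t - s) - k / 2 * (t - s)\<^sup>2" for t by (simp add: R_def)
  ultimately show ?thesis by metis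
qed

text \<open>
  With \<open>\<tau> = |z0 + k| - s\<close> the identity \<open>2 s \<tau> + \<tau>^2 = 2 s (e \<bullet> k) + |k|^2\<close> expresses \<open>\<tau>\<close> exactly through \<open>e \<bullet> k\<close> and
  \<open>|k|^2 - \<tau>^2\<close>; replacing \<open>\<tau>^2\<close> by \<open>(e \<bullet> k)^2\<close> costs only \<open>O(|k|^3)\<close>.
\<close>
lemma radial_upper_expansion:
  fixes z0 :: "'a::real_inner"
  assumes s: "0 < s" "norm z0 = s" and der: "\<And>t. 0 < t \<Longrightarrow> (\<psi> has_real_derivative d\<psi> t) (at t)"
    and der2: "(d\<psi> has_real_derivative - \<kappa>) (at s)" and \<delta>: "0 < \<delta>" and m: "0 \<le> d\<psi> s" and \<kappa>: "0 \<le> \<kappa>"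
    and e: "e = z0 /\<^sub>R s"
  shows "\<exists>r>0. \<forall>k. norm k < r \<longrightarrow> \<psi> (norm (z0 + k)) \<le> \<psi> s + (d\<psi> s *\<^sub>R e) \<bullet> k
     + ((d\<psi> s / s) * ((norm k)\<^sup>2 - (e \<bullet> k)\<^sup>2) - \<kappa> * (e \<bullet> k)\<^sup>2) / 2 + \<delta> * (norm k)\<^sup>2"
proof -
  obtain r1 where r1: "r1 > 0" "\<And>t. \<bar>t - s\<bar> < r1 \<Longrightarrow>
      \<bar>\<psi> t - \<psi> s - d\<psi> s * (t - s) - (- \<kappa>) / 2 * (t - s)\<^sup>2\<bar> \<le> \<delta> / 2 * (t - s)\<^sup>2"
    using peano_second_order[OF s(1) der der2, of "\<delta> / 2"] \<delta> by (auto simp: abs_less_iff)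
  define w where "w = (d\<psi> s / s + \<kappa>) / s"
  have w: "0 \<le> w" using s m \<kappa> by (simp add: w_def)
  define r where "r = min r1 (\<delta> / (w + 1))"
  have r: "r > 0" using r1 \<delta> w by (simp add: r_def add_nonneg_pos)
  have "\<psi> (norm (z0 + k)) \<le> \<psi> s + (d\<psi> s *\<^sub>R e) \<bullet> k
     + ((d\<psi> s / s) * ((norm k)\<^sup>2 - (e \<bullet> k)\<^sup>2) - \<kappa> * (e \<bullet> k)\<^sup>2) / 2 + \<delta> * (norm k)\<^sup>2" if k: "norm k < r" for k
  proof -
    define \<tau> where "\<tau> = norm (z0 + k) - s"
    define E where "E = e \<bullet> k"
    have \<tau>k: "\<bar>\<tau>\<bar> \<le> norm k" unfolding \<tau>_def s(2)[symmetric]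
      using norm_triangle_ineq3[of "z0 + k" z0] by simp
    have ne: "norm e = 1" using s by (simp add: e)
    have Ek: "\<bar>E\<bar> \<le> norm k" using Cauchy_Schwarz_ineq2[of e k] ne by (simp add: E_def)
    have "(norm (z0 + k))\<^sup>2 = s\<^sup>2 + 2 * s * E + (norm k)\<^sup>2"
    proof -
      have "z0 \<bullet> k = s * E" using s by (simp add: e E_def)
      moreover have "(norm (z0 + k))\<^sup>2 = (norm z0)\<^sup>2 + 2 * (z0 \<bullet> k) + (norm k)\<^sup>2"
        unfolding power2_norm_eq_inner by (simp add: inner_add_left inner_add_right inner_commute)
      ultimately show ?thesis by (simp add: s(2))
    qed
    moreover have "(norm (z0 + k))\<^sup>2 = s\<^sup>2 + 2 * s * \<tau> + \<tau>\<^sup>2" by (simp add: \<tau>_def power2_eq_square algebra_simps)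
    ultimately have key: "2 * s * \<tau> + \<tau>\<^sup>2 = 2 * s * E + (norm k)\<^sup>2" by simp
    have \<tau>2: "\<tau>\<^sup>2 \<le> (norm k)\<^sup>2" using \<tau>k by (simp add: abs_le_square_iff[symmetric])
    have \<tau>E: "s * (\<tau> - E) = ((norm k)\<^sup>2 - \<tau>\<^sup>2) / 2" using key by (simp add: algebra_simps)
    have "s * \<bar>\<tau> - E\<bar> = \<bar>s * (\<tau> - E)\<bar>" using s by (simp add: abs_mult)
    also have "\<dots> \<le> (norm k)\<^sup>2 / 2" unfolding \<tau>E using \<tau>2 by simp
    finally have d1: "s * \<bar>\<tau> - E\<bar> \<le> (norm k)\<^sup>2 / 2" .
    have "s * (E\<^sup>2 - \<tau>\<^sup>2) \<le> s * \<bar>\<tau> - E\<bar> * \<bar>\<tau> + E\<bar>"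
    proof -
      have "E\<^sup>2 - \<tau>\<^sup>2 = - ((\<tau> - E) * (\<tau> + E))" by (simp add: power2_eq_square algebra_simps)
      also have "\<dots> \<le> \<bar>\<tau> - E\<bar> * \<bar>\<tau> + E\<bar>" by (metis abs_ge_minus_self abs_mult)
      finally show ?thesis using s mult_left_mono by fastforce
    qed
    also have "\<dots> \<le> (norm k)\<^sup>2 / 2 * (2 * norm k)"
      using d1 \<tau>k Ek by (intro mult_mono) auto
    finally have d2: "s * (E\<^sup>2 - \<tau>\<^sup>2) \<le> (norm k)\<^sup>2 * norm k" by simp
    have "(d\<psi> s / s + \<kappa>) * (E\<^sup>2 - \<tau>\<^sup>2) = w * (s * (E\<^sup>2 - \<tau>\<^sup>2))" using s by (simp add: w_def)
    also have "\<dots> \<le> w * ((norm k)\<^sup>2 * norm k)" by (intro mult_left_mono d2 w)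
    also have "\<dots> = (norm k)\<^sup>2 * (w * norm k)" by simp
    also have "\<dots> \<le> (norm k)\<^sup>2 * \<delta>"
    proof (intro mult_left_mono)
      have "norm k \<le> \<delta> / (w + 1)" using k by (simp add: r_def)
      then have "norm k * (w + 1) \<le> \<delta>" using w by (subst (asm) pos_le_divide_eq) auto
      then have "norm k * w + norm k \<le> \<delta>" by (simp add: distrib_left)
      then show "w * norm k \<le> \<delta>" using norm_ge_zero[of k] mult.commute[of w "norm k"] by linarith
    qed simp
    finally have d3: "(d\<psi> s / s + \<kappa>) * (E\<^sup>2 - \<tau>\<^sup>2) \<le> \<delta> * (norm k)\<^sup>2" by (simp add: mult.commute)
    have t: "\<tau> = E + ((norm k)\<^sup>2 - \<tau>\<^sup>2) / (2 * s)" using \<tau>E s by (simp add: field_simps)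
    have "\<psi> (norm (z0 + k)) \<le> \<psi> s + d\<psi> s * \<tau> - \<kappa> / 2 * \<tau>\<^sup>2 + \<delta> / 2 * \<tau>\<^sup>2"
    proof -
      have "\<bar>\<tau>\<bar> < r1" using \<tau>k k unfolding r_def by linarith
      then have "\<bar>\<psi> (norm (z0 + k)) - \<psi> s - d\<psi> s * \<tau> - (- \<kappa>) / 2 * \<tau>\<^sup>2\<bar> \<le> \<delta> / 2 * \<tau>\<^sup>2"
        using r1(2)[of "norm (z0 + k)"] unfolding \<tau>_def by blast
      moreover have "(- \<kappa>) / 2 * \<tau>\<^sup>2 = - (\<kappa> / 2 * \<tau>\<^sup>2)" by simp
      ultimately show ?thesis by linarith
    qed
    also have "\<dots> \<le> \<psi> s + d\<psi> s * \<tau> - \<kappa> / 2 * \<tau>\<^sup>2 + \<delta> / 2 * (norm k)\<^sup>2"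
      using \<tau>2 \<delta> by (intro add_left_mono mult_left_mono) auto
    also have "d\<psi> s * \<tau> = d\<psi> s * E + (d\<psi> s / s) * ((norm k)\<^sup>2 - \<tau>\<^sup>2) / 2"
      by (subst t) (simp add: distrib_left)
    also have "\<psi> s + (d\<psi> s * E + (d\<psi> s / s) * ((norm k)\<^sup>2 - \<tau>\<^sup>2) / 2) - \<kappa> / 2 * \<tau>\<^sup>2 + \<delta> / 2 * (norm k)\<^sup>2
       = \<psi> s + d\<psi> s * E + ((d\<psi> s / s) * ((norm k)\<^sup>2 - E\<^sup>2) - \<kappa> * E\<^sup>2) / 2
         + ((d\<psi> s / s + \<kappa>) * (E\<^sup>2 - \<tau>\<^sup>2)) / 2 + \<delta> / 2 * (norm k)\<^sup>2"
    proof -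
      have "\<psi>s + (mE + q * (n - t) / 2) - \<kappa> / 2 * t + d = \<psi>s + mE + (q * (n - E) - \<kappa> * E) / 2 + ((q + \<kappa>) * (E - t)) / 2 + d"
        for \<psi>s mE q n t E d :: real by (simp add: field_simps)
      then show ?thesis .
    qed
    finally have fin: "\<psi> (norm (z0 + k)) \<le> \<psi> s + d\<psi> s * E + ((d\<psi> s / s) * ((norm k)\<^sup>2 - E\<^sup>2) - \<kappa> * E\<^sup>2) / 2
         + ((d\<psi> s / s + \<kappa>) * (E\<^sup>2 - \<tau>\<^sup>2)) / 2 + \<delta> / 2 * (norm k)\<^sup>2" .
    have "a \<le> b + \<delta> * n" if "a \<le> b + Q / 2 + \<delta> / 2 * n" "Q \<le> \<delta> * n" for a b Q n :: real
      using that by simp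
    from this[OF fin d3] show ?thesis unfolding E_def inner_scaleR_left .
  qed
  with r show ?thesis by blast
qed

text \<open>
  By scaling, the Lipschitz bound for \<open>r powr \<gamma>\<close> on \<open>[1/2, 3/2]\<close> serves for all \<open>m\<close>.
\<close>
lemma powr_relative_difference:
  obtains C where "0 \<le> C" "\<And>m t. 0 < m \<Longrightarrow> \<bar>t - m\<bar> \<le> m / 2 \<Longrightarrow>
     \<bar>t powr \<gamma> - m powr \<gamma>\<bar> \<le> C * (\<bar>t - m\<bar> / m) * m powr (\<gamma>::real)"
proof -
  let ?S = "{1/2..3/2::real}"
  have "continuous_on ?S (\<lambda>r. \<gamma> * r powr (\<gamma> - 1))" by (intro continuous_intros) auto
  then have "bounded ((\<lambda>r. \<gamma> * r powr (\<gamma> - 1)) ` ?S)"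
    by (intro compact_imp_bounded compact_continuous_image) auto
  then obtain C where "\<forall>x\<in>(\<lambda>r. \<gamma> * r powr (\<gamma> - 1)) ` ?S. norm x \<le> C" unfolding bounded_iff by blast
  then have C: "\<bar>\<gamma> * r powr (\<gamma> - 1)\<bar> \<le> C" if "r \<in> ?S" for r using that by (simp only: ball_simps real_norm_def)
  have C0: "0 \<le> C" using C[of 1] by auto
  show thesis
  proof (rule that[OF C0])
    fix m t :: real assume m: "0 < m" and t: "\<bar>t - m\<bar> \<le> m / 2"
    define r where "r = t / m"
    have r: "r \<in> ?S" and rm: "\<bar>r - 1\<bar> = \<bar>t - m\<bar> / m" and trm: "t = m * r"
    proof -
      show tr: "t = m * r" using m by (simp add: r_def)
      have "t - m = (r - 1) * m" unfolding tr by (simp add: algebra_simps)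
      then have "\<bar>t - m\<bar> = \<bar>r - 1\<bar> * m" using m by (simp only: abs_mult abs_of_pos)
      then show e: "\<bar>r - 1\<bar> = \<bar>t - m\<bar> / m" using m by (simp add: field_simps)
      have "\<bar>t - m\<bar> / m \<le> 1 / 2" using t m by (simp add: field_simps)
      then have "\<bar>r - 1\<bar> \<le> 1 / 2" unfolding e .
      then show "r \<in> ?S" unfolding atLeastAtMost_iff by linarith
    qed
    have "norm (r powr \<gamma> - 1 powr \<gamma>) \<le> C * norm (r - 1)"
    proof (rule field_differentiable_bound[of ?S "\<lambda>r. r powr \<gamma>" "\<lambda>r. \<gamma> * r powr (\<gamma> - 1)"])
      show "((\<lambda>r. r powr \<gamma>) has_field_derivative \<gamma> * z powr (\<gamma> - 1)) (at z within ?S)" if "z \<in> ?S" for z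
        by (rule has_field_derivative_at_within, rule has_real_derivative_powr) (use that in simp)
      show "norm (\<gamma> * z powr (\<gamma> - 1)) \<le> C" if "z \<in> ?S" for z
        using C[OF that] by (simp only: real_norm_def)
      show "r \<in> ?S" by (rule r)
      show "1 \<in> ?S" by simp
      show "convex ?S" by (rule convex_real_interval)
    qed
    then have "\<bar>r powr \<gamma> - 1\<bar> \<le> C * (\<bar>t - m\<bar> / m)" by (simp add: rm)
    then have "\<bar>r powr \<gamma> - 1\<bar> * m powr \<gamma> \<le> C * (\<bar>t - m\<bar> / m) * m powr \<gamma>" by (rule mult_right_mono) simp
    moreover have "t powr \<gamma> - m powr \<gamma> = (r powr \<gamma> - 1) * m powr \<gamma>"
      unfolding trm using m r by (simp add: powr_mult algebra_simps)
    ultimately show "\<bar>t powr \<gamma> - m powr \<gamma>\<bar> \<le> C * (\<bar>t - m\<bar> / m) * m powr \<gamma>" by (simp add: abs_mult)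
  qed
qed

text \<open>
  At an interior maximum \<open>(xb, yb)\<close> of the doubled function with a radial penalty \<open>\<psi>\<close>, the concavity
  \<open>\<kappa> = - \<psi>''\<close> is bounded by lower order quantities. The property mentions \<open>u\<close> and \<open>v\<close> but not the equations:
  it is all that the two regularity steps below take from them.
\<close>
definition concavity_bound :: "(real^'n \<Rightarrow> real) \<Rightarrow> (real^'n \<Rightarrow> real) \<Rightarrow> real \<Rightarrow> real \<Rightarrow> real \<Rightarrow> bool" where
  "concavity_bound u v L C M0 \<longleftrightarrow> (\<forall>\<psi> d\<psi> \<kappa> xb yb x0 \<rho>.
      xb \<in> ball 0 1 \<longrightarrow> yb \<in> ball 0 1 \<longrightarrow> x0 \<in> ball 0 1 \<longrightarrow> xb \<noteq> yb \<longrightarrow>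
      (\<forall>t>0. (\<psi> has_real_derivative d\<psi> t) (at t)) \<longrightarrow>
      (d\<psi> has_real_derivative - \<kappa>) (at (norm (xb - yb))) \<longrightarrow> 0 < \<kappa> \<longrightarrow> M0 \<le> d\<psi> (norm (xb - yb)) \<longrightarrow> 0 < \<rho> \<longrightarrow>
      (\<forall>x\<in>ball xb \<rho>. \<forall>y\<in>ball yb \<rho>.
        u x - v y - \<psi> (norm (x - y)) - L * (norm (x - x0))\<^sup>2
        \<le> u xb - v yb - \<psi> (norm (xb - yb)) - L * (norm (xb - x0))\<^sup>2) \<longrightarrow>
      \<kappa> \<le> C * (1 + norm (xb - x0) / norm (xb - yb) + d\<psi> (norm (xb - yb))
              + norm (xb - yb) * (d\<psi> (norm (xb - yb)))\<^sup>2 + norm (xb - x0) * d\<psi> (norm (xb - yb))))"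

text \<open>
  The Hessian of the penalty is \<open>(m / s) (I - e e^T) - \<kappa> e e^T\<close> with \<open>m = \<psi>' s\<close>; the multiple \<open>\<kappa> / 2\<close> of the
  identity is added to it so that the quadratic dominates the penalty near \<open>xb - yb\<close>, which still leaves
  \<open>- \<kappa> / 2\<close> in the direction \<open>e\<close>. Everything is compared with \<open>W = m^\<alpha>\<close>: for \<open>m \<ge> M0\<close> the two gradients differ by the
  relative amount \<open>\<theta> = 2 L d / m\<close> only, and \<open>\<beta> \<le> \<alpha> + 2\<close> makes the Hamiltonian terms at most
  multiples of \<open>m^2 W\<close>.
\<close>
lemma concavity_bound_at_maximum:
  fixes F :: "real^'n \<Rightarrow> real^'n^'n \<Rightarrow> real" and u v b f g :: "real^'n \<Rightarrow> real"
  assumes \<alpha>: "\<alpha> > -1" and \<beta>: "\<beta> \<le> \<alpha> + 2" and F: "structural_assms \<alpha> F"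
    and b: "Lb-lipschitz_on (ball 0 1) b"
    and cont: "continuous_on (ball 0 1) f" "continuous_on (ball 0 1) g"
    and K: "\<And>x. x \<in> ball 0 1 \<Longrightarrow> \<bar>u x\<bar> \<le> K \<and> \<bar>v x\<bar> \<le> K \<and> \<bar>f x\<bar> \<le> K \<and> \<bar>g x\<bar> \<le> K"
    and sub: "viscosity_subsolution F b \<beta> g (ball 0 1) u"
    and super: "viscosity_supersolution F b \<beta> f (ball 0 1) v" and L: "0 \<le> L"
  obtains C M0 where "0 \<le> C" "concavity_bound u v L C M0"
proof -
  let ?\<Omega> = "ball 0 1 :: (real^'n) set"
  obtain a A where aA: "0 < a" "a \<le> A" and
    ell: "\<forall>p. \<forall>M\<in>sym_matrices. \<forall>N\<in>sym_matrices. p \<noteq> 0 \<and> psd N \<longrightarrow>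
           a * norm p powr \<alpha> * trace N \<le> F p (M + N) - F p M \<and> F p (M + N) - F p M \<le> A * norm p powr \<alpha> * trace N"
    using F unfolding structural_assms_def by blast
  obtain c where c: "0 < c" and
    grad: "\<forall>p q. \<forall>M\<in>sym_matrices. p \<noteq> 0 \<and> q \<noteq> 0 \<longrightarrow>
        \<bar>F p M - F q M\<bar> \<le> c * norm M * \<bar>norm p powr \<alpha> - norm q powr \<alpha>\<bar>"
    using F unfolding structural_assms_def by blast
  obtain Ca where Ca: "0 \<le> Ca" and pa: "\<And>m t. 0 < m \<Longrightarrow> \<bar>t - m\<bar> \<le> m / 2 \<Longrightarrow>
     \<bar>t powr \<alpha> - m powr \<alpha>\<bar> \<le> Ca * (\<bar>t - m\<bar> / m) * m powr \<alpha>" using powr_relative_difference by blast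
  obtain Cb where Cb: "0 \<le> Cb" and pb: "\<And>m t. 0 < m \<Longrightarrow> \<bar>t - m\<bar> \<le> m / 2 \<Longrightarrow>
     \<bar>t powr \<beta> - m powr \<beta>\<bar> \<le> Cb * (\<bar>t - m\<bar> / m) * m powr \<beta>" using powr_relative_difference by blast
  define N where "N = real CARD('n)"
  define c' where "c' = c * (real CARD('n))\<^sup>2"
  define Kb where "Kb = \<bar>b 0\<bar> + Lb"
  have Lb: "0 \<le> Lb" using b by (rule lipschitz_on_nonneg)
  have bl: "\<bar>b x - b y\<bar> \<le> Lb * norm (x - y)" if "x \<in> ?\<Omega>" "y \<in> ?\<Omega>" for x y
    using lipschitz_onD[OF b that] by (simp add: dist_norm)
  have bK: "\<bar>b x\<bar> \<le> Kb" if "x \<in> ?\<Omega>" for x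
  proof -
    have "\<bar>b x - b 0\<bar> \<le> Lb * norm x" using bl[OF that, of 0] by simp
    also have "\<dots> \<le> Lb * 1" using that Lb by (intro mult_left_mono) auto
    finally show ?thesis unfolding Kb_def by linarith
  qed
  have Kb: "0 \<le> Kb" using Lb by (simp add: Kb_def)
  have c'0: "0 \<le> c'" using c by (simp add: c'_def)
  have N0: "0 \<le> N" by (simp add: N_def)
  have K0: "0 \<le> K" using K[of 0] by auto
  \<comment> \<open>from \<open>8 L\<close> on, \<open>norm P\<close> lies within \<open>m / 2\<close> of \<open>m\<close>; the last term makes \<open>c' D \<le> a W / 4\<close>\<close>
  define M0 where "M0 = 1 + 8 * L + 16 * c' * Ca * L / a"
  define k1 where "k1 = 2 * A * L * N * (1 + Ca)"
  define k2 where "k2 = 2 * c' * Ca * L"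
  define k3 where "k3 = 2 * K"
  define k4 where "k4 = Lb"
  define k5 where "k5 = 2 * Kb * Cb * L"
  have ks: "0 \<le> k1" "0 \<le> k2" "0 \<le> k3" "0 \<le> k4" "0 \<le> k5"
    using aA L N0 Ca c'0 K0 Lb Kb Cb by (simp_all add: k1_def k2_def k3_def k4_def k5_def)
  define C where "C = (k1 + k2 + k3 + k4 + k5) / a"
  show thesis
  proof (rule that[of C M0])
    show "0 \<le> C" using ks aA by (simp add: C_def)
    show "concavity_bound u v L C M0"
      unfolding concavity_bound_def
    proof (intro allI impI)
    fix \<psi> d\<psi> :: "real \<Rightarrow> real" and \<kappa> and xb yb x0 :: "real^'n" and \<rho>
    assume xb: "xb \<in> ?\<Omega>" and yb: "yb \<in> ?\<Omega>" and x0: "x0 \<in> ?\<Omega>" and ne: "xb \<noteq> yb"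
      and der0: "\<forall>t>0. (\<psi> has_real_derivative d\<psi> t) (at t)"
      and der2: "(d\<psi> has_real_derivative - \<kappa>) (at (norm (xb - yb)))" and \<kappa>: "0 < \<kappa>"
      and M0: "M0 \<le> d\<psi> (norm (xb - yb))" and \<rho>: "0 < \<rho>"
      and mx: "\<forall>x\<in>ball xb \<rho>. \<forall>y\<in>ball yb \<rho>.
        u x - v y - \<psi> (norm (x - y)) - L * (norm (x - x0))\<^sup>2
        \<le> u xb - v yb - \<psi> (norm (xb - yb)) - L * (norm (xb - x0))\<^sup>2"
    have der: "(\<psi> has_real_derivative d\<psi> t) (at t)" if "0 < t" for t using der0 that by blast
    define s where "s = norm (xb - yb)"
    define m where "m = d\<psi> s"
    define d where "d = norm (xb - x0)"
    define e where "e = (xb - yb) /\<^sub>R s"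
    have s: "0 < s" using ne by (simp add: s_def)
    have ne1: "norm e = 1" using s by (simp add: e_def s_def)
    have q0: "0 \<le> 16 * c' * Ca * L / a" using c'0 Ca L aA by simp
    have m1: "1 \<le> m" "8 * L \<le> m" "16 * c' * Ca * L / a \<le> m"
      using M0 L q0 unfolding M0_def m_def s_def by linarith+
    have d2: "0 \<le> d" "d \<le> 2"
      using norm_triangle_ineq4[of xb x0] xb x0 by (auto simp: d_def)
    define \<delta> where "\<delta> = \<kappa> / 4"
    have \<delta>: "0 < \<delta>" using \<kappa> by (simp add: \<delta>_def)
    define B where "B = (\<lambda>k. (m / s) *\<^sub>R (k - (e \<bullet> k) *\<^sub>R e) - (\<kappa> * (e \<bullet> k)) *\<^sub>R e + (2 * \<delta>) *\<^sub>R k)"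
    have Bl: "linear B" unfolding B_def
      by (rule linearI) (simp_all add: inner_add_right algebra_simps)
    have Bin: "B k \<bullet> l = (m / s) * (k \<bullet> l - (e \<bullet> k) * (e \<bullet> l)) - \<kappa> * (e \<bullet> k) * (e \<bullet> l) + 2 * \<delta> * (k \<bullet> l)" for k l
      unfolding B_def by (simp add: inner_add_left inner_diff_left algebra_simps)
    have Bsym: "B k \<bullet> l = k \<bullet> B l" for k l
      using Bin[of k l] Bin[of l k] by (simp add: inner_commute mult_ac)
    define \<mu> where "\<mu> = m / s + \<kappa> / 2"
    have ms: "0 \<le> m / s" using m1 s by simp
    have \<mu>: "0 \<le> \<mu>" using ms \<kappa> by (simp add: \<mu>_def)
    have B\<mu>: "B h \<bullet> h \<le> \<mu> * (norm h)\<^sup>2" for h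
    proof -
      have "0 \<le> (m / s) * ((e \<bullet> h) * (e \<bullet> h))" "0 \<le> \<kappa> * ((e \<bullet> h) * (e \<bullet> h))"
        using mult_nonneg_nonneg[OF ms zero_le_square] mult_nonneg_nonneg[OF less_imp_le[OF \<kappa>] zero_le_square] by blast+
      moreover have "B h \<bullet> h = (m / s) * (h \<bullet> h) - (m / s) * ((e \<bullet> h) * (e \<bullet> h)) - \<kappa> * ((e \<bullet> h) * (e \<bullet> h)) + \<kappa> / 2 * (h \<bullet> h)"
        unfolding Bin \<delta>_def by (simp add: right_diff_distrib)
      moreover have "\<mu> * (norm h)\<^sup>2 = (m / s) * (h \<bullet> h) + \<kappa> / 2 * (h \<bullet> h)"
        unfolding \<mu>_def power2_norm_eq_inner by (rule distrib_right)
      ultimately show ?thesis by linarith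
    qed
    have "e \<bullet> e = 1" using ne1 by (simp add: norm_eq_1)
    then have Be: "B e \<bullet> e \<le> - (\<kappa> / 2)" unfolding Bin \<delta>_def by simp
    have xys: "norm (xb - yb) = s" by (simp add: s_def)
    obtain r where r: "0 < r" "\<And>k. norm k < r \<Longrightarrow> \<psi> (norm ((xb - yb) + k)) \<le> \<psi> s + (m *\<^sub>R e) \<bullet> k
       + ((m / s) * ((norm k)\<^sup>2 - (e \<bullet> k)\<^sup>2) - \<kappa> * (e \<bullet> k)\<^sup>2) / 2 + \<delta> * (norm k)\<^sup>2"
      using radial_upper_expansion[OF s xys der der2[folded s_def] \<delta>, of e] m1 \<kappa> e_def unfolding m_def[symmetric] by auto
    obtain r1 where r1: "0 < r1" "ball xb r1 \<subseteq> ?\<Omega>" using openE[OF open_ball xb] by blast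
    obtain r2 where r2: "0 < r2" "ball yb r2 \<subseteq> ?\<Omega>" using openE[OF open_ball yb] by blast
    define \<rho>' where "\<rho>' = Min {\<rho>, r, r1, r2} / 3"
    have \<rho>': "0 < \<rho>'" "\<rho>' < \<rho>" "2 * \<rho>' < r" "\<rho>' < r1" "\<rho>' < r2"
      using \<rho> r(1) r1(1) r2(1) unfolding \<rho>'_def by auto
    have c1: "cball xb \<rho>' \<subseteq> ?\<Omega>" and c2: "cball yb \<rho>' \<subseteq> ?\<Omega>"
      using r1(2) r2(2) \<rho>' by (auto simp: subset_iff)
    define p where "p = m *\<^sub>R e"
    have np: "norm p = m" using ne1 m1 by (simp add: p_def)
    have p0: "p \<noteq> 0" using np m1 by auto
    define P where "P = p + (2 * L) *\<^sub>R (xb - x0)"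
    have Pm: "\<bar>norm P - m\<bar> \<le> 2 * L * d"
      using norm_triangle_ineq3[of P p] L unfolding np by (simp add: P_def d_def)
    have Ld: "2 * L * d \<le> 4 * L" using d2 L mult_left_mono[of d 2 "2 * L"] by simp
    have Pm2: "\<bar>norm P - m\<bar> \<le> m / 2" using Pm Ld m1 by linarith
    have P0: "P \<noteq> 0" using Pm2 m1 by auto
    define \<theta> where "\<theta> = 2 * L * d / m"
    have m0: "0 < m" using m1 by simp
    have rel: "\<bar>norm P - m\<bar> / m \<le> \<theta>" unfolding \<theta>_def using Pm m0 by (intro divide_right_mono) auto
    have \<theta>: "0 \<le> \<theta>" "\<theta> \<le> 1" "c' * (Ca * \<theta>) \<le> a / 4"
    proof -
      show "0 \<le> \<theta>" using L d2 m0 by (simp add: \<theta>_def)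
      have t4: "\<theta> \<le> 4 * L / m" unfolding \<theta>_def using Ld m0 by (intro divide_right_mono) auto
      also have "\<dots> \<le> 1" using m1 m0 L by (simp add: divide_le_eq)
      finally show "\<theta> \<le> 1" .
      have "16 * c' * Ca * L \<le> m * a" using m1(3) aA by (subst (asm) pos_divide_le_eq) auto
      then have "c' * Ca * (4 * L / m) \<le> a / 4" using m0 by (simp add: field_simps)
      moreover have "c' * Ca * \<theta> \<le> c' * Ca * (4 * L / m)" using t4 c'0 Ca by (intro mult_left_mono) auto
      ultimately show "c' * (Ca * \<theta>) \<le> a / 4" unfolding mult.assoc[symmetric] by linarith
    qed
    define W where "W = m powr \<alpha>"
    have W: "0 < W" using m0 by (simp add: W_def)
    define D where "D = \<bar>norm p powr \<alpha> - norm P powr \<alpha>\<bar>"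
    have DW: "D \<le> Ca * \<theta> * W"
    proof -
      have "D \<le> Ca * (\<bar>norm P - m\<bar> / m) * W"
        using pa[OF m0 Pm2] by (simp add: D_def np W_def abs_minus_commute)
      also have "\<dots> \<le> Ca * \<theta> * W" using rel Ca W by (intro mult_right_mono mult_left_mono) auto
      finally show ?thesis .
    qed
    have c'D: "c' * D \<le> a / 4 * W"
    proof -
      have "c' * D \<le> c' * (Ca * \<theta> * W)" by (intro mult_left_mono DW c'0)
      also have "\<dots> = c' * (Ca * \<theta>) * W" by simp
      also have "\<dots> \<le> a / 4 * W" using \<theta>(3) W by (intro mult_right_mono) auto
      finally show ?thesis .
    qed
    have aW: "0 < a * W" using aA W by simp
    have "4 * (\<kappa> / 2) * (a * norm p powr \<alpha> - c' * D) \<le> 2 * A * L * real CARD('n) * norm P powr \<alpha> + c' * \<mu> * D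
      + g xb - f yb + b yb * norm p powr \<beta> - b xb * norm P powr \<beta>"
    proof (rule ishii_lions_at_maximum[where F=F and a=a and c=c and \<Omega>="?\<Omega>" and u=u and v=v and K=K and B=B and e=e and \<rho>=\<rho>' and ?x0.0=x0])
      show "continuous_on ?\<Omega> b" using b by (rule lipschitz_on_continuous_on)
      show "c' * D < a * norm p powr \<alpha>" using c'D aW by (simp add: np W_def[symmetric])
      show "u x - L * (norm (x - x0))\<^sup>2 - v y \<le> u xb - L * (norm (xb - x0))\<^sup>2 - v yb
         + p \<bullet> (x - y - (xb - yb)) + (B (x - y - (xb - yb)) \<bullet> (x - y - (xb - yb))) / 2"
        if x: "x \<in> cball xb \<rho>'" and y: "y \<in> cball yb \<rho>'" for x y
      proof -
        define k where "k = x - y - (xb - yb)"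
        have k': "k = (x - xb) - (y - yb)" by (simp add: k_def)
        have "norm (x - xb) \<le> \<rho>'" "norm (y - yb) \<le> \<rho>'" using x y by (simp_all add: dist_norm norm_minus_commute)
        then have "norm k < r" using norm_triangle_ineq4[of "x - xb" "y - yb"] \<rho>'(3) unfolding k' by linarith
        from r(2)[OF this]
        have "\<psi> (norm (x - y)) \<le> \<psi> s + p \<bullet> k + ((m / s) * ((norm k)\<^sup>2 - (e \<bullet> k)\<^sup>2) - \<kappa> * (e \<bullet> k)\<^sup>2) / 2 + \<delta> * (norm k)\<^sup>2"
          by (simp add: k_def p_def)
        also have "((m / s) * ((norm k)\<^sup>2 - (e \<bullet> k)\<^sup>2) - \<kappa> * (e \<bullet> k)\<^sup>2) / 2 = (B k \<bullet> k) / 2 - \<delta> * (norm k)\<^sup>2"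
        proof -
          have "B k \<bullet> k = ((m / s) * ((norm k)\<^sup>2 - (e \<bullet> k)\<^sup>2) - \<kappa> * (e \<bullet> k)\<^sup>2) + 2 * (\<delta> * (norm k)\<^sup>2)"
            unfolding Bin power2_norm_eq_inner by (simp add: power2_eq_square mult.assoc)
          moreover have "X / 2 = Y / 2 - Z" if "Y = X + 2 * Z" for X Y Z :: real using that by linarith
          ultimately show ?thesis by blast
        qed
        finally have "\<psi> (norm (x - y)) \<le> \<psi> s + p \<bullet> k + (B k \<bullet> k) / 2" by simp
        moreover have "u x - v y - \<psi> (norm (x - y)) - L * (norm (x - x0))\<^sup>2 \<le> u xb - v yb - \<psi> s - L * (norm (xb - x0))\<^sup>2"
          unfolding s_def by (rule mx[rule_format]) (use x y \<rho>' in auto)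
        ultimately show ?thesis unfolding k_def[symmetric] by linarith
      qed
    qed (use ell grad aA c L sub super c1 c2 \<rho>'(1) K cont Bl Bsym \<mu> B\<mu> ne1 Be \<kappa> p0 P0 in \<open>auto simp: P_def D_def c'_def\<close>)
    then have main: "2 * \<kappa> * (a * W - c' * D) \<le> 2 * A * L * N * norm P powr \<alpha> + c' * \<mu> * D
      + g xb - f yb + b yb * m powr \<beta> - b xb * norm P powr \<beta>"
      unfolding np W_def N_def by simp
    define T where "T = 1 + d / s + m + s * m\<^sup>2 + d * m"
    have Tn: "0 \<le> d / s" "0 \<le> s * m\<^sup>2" "0 \<le> d * m" using d2 s m0 by auto
    have e1: "2 * A * L * N * norm P powr \<alpha> \<le> k1 * W"
    proof -
      have "norm P powr \<alpha> \<le> W + D" unfolding D_def np W_def by linarith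
      also have "D \<le> Ca * 1 * W" by (rule order_trans[OF DW]) (use \<theta> Ca W in \<open>intro mult_right_mono mult_left_mono, auto\<close>)
      finally have "norm P powr \<alpha> \<le> (1 + Ca) * W" by (simp add: distrib_right)
      then have "2 * A * L * N * norm P powr \<alpha> \<le> 2 * A * L * N * ((1 + Ca) * W)"
        using aA L N0 by (intro mult_left_mono) auto
      then show ?thesis by (simp add: k1_def mult.assoc)
    qed
    have e2: "c' * \<mu> * D \<le> k2 * (d / s) * W + \<kappa> / 2 * (a / 4 * W)"
    proof -
      have "c' * (m / s) * D \<le> c' * (m / s) * (Ca * \<theta> * W)" by (intro mult_left_mono DW mult_nonneg_nonneg c'0 ms)
      also have "\<dots> = k2 * (d / s) * W" using m0 s by (simp add: k2_def \<theta>_def field_simps)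
      finally have "c' * (m / s) * D \<le> k2 * (d / s) * W" .
      moreover have "\<kappa> / 2 * (c' * D) \<le> \<kappa> / 2 * (a / 4 * W)" using c'D \<kappa> by (intro mult_left_mono) auto
      moreover have "c' * \<mu> * D = c' * (m / s) * D + \<kappa> / 2 * (c' * D)"
        unfolding \<mu>_def distrib_left distrib_right by (simp only: mult_ac)
      ultimately show ?thesis by linarith
    qed
    have mW: "1 \<le> m * W"
    proof -
      have "m * W = m powr (1 + \<alpha>)" using m0 by (simp add: W_def powr_add)
      then show ?thesis using ge_one_powr_ge_zero[of m "1 + \<alpha>"] m1 \<alpha> by simp
    qed
    have e3: "g xb - f yb \<le> k3 * m * W"
    proof -
      have "g xb - f yb \<le> 2 * K * 1" using K[OF xb] K[OF yb] by (auto simp: abs_le_iff)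
      also have "\<dots> \<le> 2 * K * (m * W)" using mW K0 by (intro mult_left_mono) auto
      finally show ?thesis by (simp add: k3_def mult.assoc)
    qed
    have mb: "m powr \<beta> \<le> m\<^sup>2 * W"
    proof -
      have "m powr \<beta> \<le> m powr (2 + \<alpha>)" using m1 \<beta> by (intro powr_mono) auto
      also have "\<dots> = m\<^sup>2 * W" using m0 by (simp add: W_def powr_add powr_numeral)
      finally show ?thesis .
    qed
    have e4: "b yb * m powr \<beta> - b xb * norm P powr \<beta> \<le> k4 * (s * m\<^sup>2) * W + k5 * (d * m) * W"
    proof -
      have "b yb * m powr \<beta> - b xb * norm P powr \<beta> = (b yb - b xb) * m powr \<beta> + b xb * (m powr \<beta> - norm P powr \<beta>)"
        by (simp add: algebra_simps)
      also have "\<dots> \<le> \<bar>b yb - b xb\<bar> * m powr \<beta> + \<bar>b xb\<bar> * \<bar>m powr \<beta> - norm P powr \<beta>\<bar>"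
        by (intro add_mono mult_right_mono order_trans[OF abs_ge_self eq_refl[OF abs_mult]]) auto
      also have "\<dots> \<le> (Lb * s) * m powr \<beta> + Kb * (Cb * \<theta> * m powr \<beta>)"
      proof (intro add_mono mult_right_mono mult_mono)
        show "\<bar>b yb - b xb\<bar> \<le> Lb * s" using bl[OF yb xb] by (simp add: s_def norm_minus_commute)
        have "\<bar>m powr \<beta> - norm P powr \<beta>\<bar> \<le> Cb * (\<bar>norm P - m\<bar> / m) * m powr \<beta>"
          using pb[OF m0 Pm2] by (simp add: abs_minus_commute)
        also have "\<dots> \<le> Cb * \<theta> * m powr \<beta>" using rel Cb by (intro mult_right_mono mult_left_mono) auto
        finally show "\<bar>m powr \<beta> - norm P powr \<beta>\<bar> \<le> Cb * \<theta> * m powr \<beta>" .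
      qed (use bK[OF xb] Kb in auto)
      also have "\<dots> = (Lb * s + Kb * Cb * \<theta>) * m powr \<beta>" by (simp add: algebra_simps)
      also have "\<dots> \<le> (Lb * s + Kb * Cb * \<theta>) * (m\<^sup>2 * W)"
        using mb Lb s Kb Cb \<theta> by (intro mult_left_mono) auto
      also have "\<dots> = k4 * (s * m\<^sup>2) * W + k5 * (d * m) * W"
        using m0 by (simp add: k4_def k5_def \<theta>_def power2_eq_square field_simps)
      finally show ?thesis .
    qed
    have "2 * \<kappa> * (a * W - a / 4 * W) \<le> 2 * \<kappa> * (a * W - c' * D)"
      using \<kappa> by (intro mult_left_mono diff_left_mono c'D) auto
    also note main
    finally have "2 * \<kappa> * (a * W - a / 4 * W)
       \<le> k1 * W + (k2 * (d / s) * W + \<kappa> / 2 * (a / 4 * W)) + k3 * m * W + (k4 * (s * m\<^sup>2) * W + k5 * (d * m) * W)"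
      using e1 e2 e3 e4 by linarith
    moreover have "2 * \<kappa> * (a * W - a / 4 * W) = 3 / 2 * (\<kappa> * a * W)" by (simp add: algebra_simps)
    moreover have "\<kappa> / 2 * (a / 4 * W) = 1 / 8 * (\<kappa> * a * W)" by simp
    moreover have "0 \<le> \<kappa> * a * W" using \<kappa> aA W by simp
    moreover have "k1 * W + k2 * (d / s) * W + k3 * m * W + k4 * (s * m\<^sup>2) * W + k5 * (d * m) * W
        = (k1 + k2 * (d / s) + k3 * m + k4 * (s * m\<^sup>2) + k5 * (d * m)) * W" by (simp only: distrib_right)
    ultimately have "\<kappa> * a * W \<le> (k1 + k2 * (d / s) + k3 * m + k4 * (s * m\<^sup>2) + k5 * (d * m)) * W" by linarith
    then have "\<kappa> * a \<le> k1 + k2 * (d / s) + k3 * m + k4 * (s * m\<^sup>2) + k5 * (d * m)" using W by (rule mult_right_le_imp_le)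
    also have "\<dots> \<le> k1 * T + k2 * T + k3 * T + k4 * T + k5 * T"
    proof (intro add_mono mult_left_mono ks)
      show "k1 \<le> k1 * T" using ks(1) Tn m0 mult_left_mono[of 1 T k1] by (simp add: T_def)
    qed (use Tn m0 in \<open>auto simp: T_def\<close>)
    also have "\<dots> = (C * a) * T"
    proof -
      have "C * a = k1 + k2 + k3 + k4 + k5" using aA by (simp add: C_def)
      then show ?thesis by (simp only: distrib_right)
    qed
    also have "\<dots> = (C * T) * a" by simp
    finally have "\<kappa> \<le> C * T" using aA(1) by (rule mult_right_le_imp_le)
    then show "\<kappa> \<le> C * (1 + norm (xb - x0) / norm (xb - yb) + d\<psi> (norm (xb - yb))
              + norm (xb - yb) * (d\<psi> (norm (xb - yb)))\<^sup>2 + norm (xb - x0) * d\<psi> (norm (xb - yb)))"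
      unfolding T_def m_def s_def d_def .
    qed
  qed
qed

section \<open>Hoelder and Lipschitz estimates\<close>

text \<open>
  \<open>L\<close> keeps \<open>xb\<close> and the growth of \<open>\<psi>\<close> keeps \<open>yb\<close> away from the boundary of the larger ball. Only \<open>x\<close> is
  penalised, so at \<open>x = x0\<close> nothing is lost in the estimate that is to be proved.
\<close>
lemma doubled_maximum:
  fixes u v :: "real^'n \<Rightarrow> real"
  assumes u: "usc_on (ball 0 1) u" and v: "lsc_on (ball 0 1) v"
    and rR: "r < R" "R < 1" and \<psi>: "continuous_on {0..} \<psi>" "\<And>t. 0 \<le> t \<Longrightarrow> t \<le> 2 \<Longrightarrow> 0 \<le> \<psi> t" and L: "0 \<le> L"
    and diag: "\<And>z. z \<in> ball 0 1 \<Longrightarrow> u z - v z \<le> S"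
    and K: "\<And>x y. x \<in> ball 0 1 \<Longrightarrow> y \<in> ball 0 1 \<Longrightarrow> u x - v y - S \<le> K"
    and LK: "K \<le> L * ((R - r) / 2)\<^sup>2" and \<psi>K: "\<And>t. 0 < t \<Longrightarrow> t \<le> 2 \<Longrightarrow> \<psi> t < K \<Longrightarrow> t < (R - r) / 2"
    and x0: "x0 \<in> ball 0 r" and y0: "y0 \<in> ball 0 r" and viol: "S + \<psi> (norm (x0 - y0)) < u x0 - v y0"
  obtains xb yb \<rho> where "xb \<in> ball 0 R" "yb \<in> ball 0 R" "xb \<noteq> yb" "0 < \<rho>"
    "L * (norm (xb - x0))\<^sup>2 + \<psi> (norm (xb - yb)) < u xb - v yb - S"
    "\<forall>x\<in>ball xb \<rho>. \<forall>y\<in>ball yb \<rho>. u x - v y - \<psi> (norm (x - y)) - L * (norm (x - x0))\<^sup>2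
        \<le> u xb - v yb - \<psi> (norm (xb - yb)) - L * (norm (xb - x0))\<^sup>2"
proof -
  let ?Q = "cball 0 R \<times> cball 0 R :: ((real^'n) \<times> (real^'n)) set"
  define \<Phi> where "\<Phi> = (\<lambda>z. (u (fst z) + - v (snd z)) + (- \<psi> (norm (fst z - snd z)) - L * (norm (fst z - x0))\<^sup>2))"
  have x0Q: "(x0, y0) \<in> ?Q" using x0 y0 rR by auto
  have B: "cball 0 R \<subseteq> (ball 0 1 :: (real^'n) set)" using rR by auto
  have "usc_on ?Q \<Phi>" unfolding \<Phi>_def
  proof (intro usc_on_add)
    show "usc_on ?Q (\<lambda>z. u (fst z))" by (rule usc_on_compose[OF u]) (use B in \<open>auto intro!: continuous_intros\<close>)
    have "usc_on (ball 0 1) (\<lambda>y. - v y)" using v by (simp add: lsc_on_iff_usc_on_uminus)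
    then show "usc_on ?Q (\<lambda>z. - v (snd z))"
      by (rule usc_on_compose[of _ "\<lambda>y. - v y"]) (use B in \<open>auto intro!: continuous_intros\<close>)
    show "usc_on ?Q (\<lambda>z. - \<psi> (norm (fst z - snd z)) - L * (norm (fst z - x0))\<^sup>2)"
      by (intro usc_on_continuous continuous_intros continuous_on_compose2[OF \<psi>(1)]) auto
  qed
  moreover have "compact ?Q" "?Q \<noteq> {}" using x0Q by (blast intro: compact_Times compact_cball)+
  ultimately obtain z where zQ: "z \<in> ?Q" and z: "\<And>w. w \<in> ?Q \<Longrightarrow> \<Phi> w \<le> \<Phi> z"
    using usc_on_attains_sup by blast
  obtain xb yb where zxy: "z = (xb, yb)" by (cases z)
  have xbR: "norm xb \<le> R" and ybR: "norm yb \<le> R" using zQ by (auto simp: zxy)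
  have xb1: "xb \<in> ball 0 1" and yb1: "yb \<in> ball 0 1" using xbR ybR rR by auto
  have "S < \<Phi> (x0, y0)" using viol by (simp add: \<Phi>_def)
  also have "\<dots> \<le> \<Phi> (xb, yb)" using z[OF x0Q] by (simp add: zxy)
  finally have gt: "L * (norm (xb - x0))\<^sup>2 + \<psi> (norm (xb - yb)) < u xb - v yb - S" by (simp add: \<Phi>_def)
  have s2: "norm (xb - yb) \<le> 2" using norm_triangle_ineq4[of xb yb] xbR ybR rR by simp
  have \<psi>0: "0 \<le> \<psi> (norm (xb - yb))" using \<psi>(2) s2 by simp
  have Ld: "0 \<le> L * (norm (xb - x0))\<^sup>2" using L by simp
  have ne: "xb \<noteq> yb"
  proof
    assume "xb = yb"
    then show False using gt \<psi>0 Ld diag[OF xb1] by simp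
  qed
  have "norm (xb - yb) < (R - r) / 2"
    using gt Ld K[OF xb1 yb1] s2 ne by (intro \<psi>K) auto
  moreover have "norm (xb - x0) < (R - r) / 2"
  proof -
    have "L * (norm (xb - x0))\<^sup>2 < L * ((R - r) / 2)\<^sup>2" using gt \<psi>0 K[OF xb1 yb1] LK by linarith
    then have "(norm (xb - x0))\<^sup>2 < ((R - r) / 2)\<^sup>2" using L by (simp add: mult_less_cancel_left)
    then show ?thesis by (rule power_less_imp_less_base) (use rR in simp)
  qed
  moreover have t1: "norm xb \<le> norm (xb - x0) + norm x0" and t2: "norm yb \<le> norm (xb - yb) + norm xb"
    using norm_triangle_ineq[of "xb - x0" x0] norm_triangle_ineq[of "yb - xb" xb] by (simp_all add: norm_minus_commute)
  moreover have t3: "norm x0 < r" using x0 by simp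
  ultimately have n1: "norm (xb - yb) < (R - r) / 2" and n2: "norm (xb - x0) < (R - r) / 2" by blast+
  have "norm xb < (R - r) / 2 + r" using n2 t1 t3 by linarith
  moreover from this have "norm yb < (R - r) / 2 + ((R - r) / 2 + r)" using n1 t2 by linarith
  moreover have "(R - r) / 2 + ((R - r) / 2 + r) = R" by (simp add: field_simps)
  moreover have "(R - r) / 2 + r < R" using rR by (simp add: field_simps)
  ultimately have xbi: "norm xb < R" and ybi: "norm yb < R" by (metis less_trans, metis)
  define \<rho> where "\<rho> = min (R - norm xb) (R - norm yb)"
  show thesis
  proof (rule that[of xb yb \<rho>])
    show "xb \<in> ball 0 R" "yb \<in> ball 0 R" "0 < \<rho>" using xbi ybi by (auto simp: \<rho>_def)
    show "\<forall>x\<in>ball xb \<rho>. \<forall>y\<in>ball yb \<rho>. u x - v y - \<psi> (norm (x - y)) - L * (norm (x - x0))\<^sup>2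
        \<le> u xb - v yb - \<psi> (norm (xb - yb)) - L * (norm (xb - x0))\<^sup>2"
    proof (intro ballI)
      fix x y assume x: "x \<in> ball xb \<rho>" and y: "y \<in> ball yb \<rho>"
      have "norm x \<le> norm (x - xb) + norm xb" "norm y \<le> norm (y - yb) + norm yb"
        using norm_triangle_ineq[of "x - xb" xb] norm_triangle_ineq[of "y - yb" yb] by simp_all
      moreover have "norm (x - xb) < R - norm xb" "norm (y - yb) < R - norm yb"
        using x y by (auto simp: \<rho>_def dist_norm norm_minus_commute)
      ultimately have "(x, y) \<in> ?Q" by auto
      from z[OF this] show "u x - v y - \<psi> (norm (x - y)) - L * (norm (x - x0))\<^sup>2
        \<le> u xb - v yb - \<psi> (norm (xb - yb)) - L * (norm (xb - x0))\<^sup>2"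
        by (simp add: \<Phi>_def zxy)
    qed
  qed (use ne gt in auto)
qed

text \<open>
  For \<open>\<psi> t = M \<surd>t\<close> and \<open>y = \<surd>s\<close> one has \<open>\<kappa> = M / (4 y^3)\<close>, and \<open>M y \<le> K\<close> at the maximum. After
  multiplication by \<open>4 y^3\<close> the concavity bound reads \<open>M \<le> 4 C E\<close> with \<open>E\<close> independent of \<open>M\<close>.
\<close>
lemma holder_step:
  fixes u v :: "real^'n \<Rightarrow> real"
  assumes u: "usc_on (ball 0 1) u" and v: "lsc_on (ball 0 1) v" and r: "0 < r" "r < 1"
    and diag: "\<And>z. z \<in> ball 0 1 \<Longrightarrow> u z - v z \<le> S"
    and K: "\<And>x y. x \<in> ball 0 1 \<Longrightarrow> y \<in> ball 0 1 \<Longrightarrow> u x - v y - S \<le> K" and K0: "0 < K"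
    and CB: "\<And>L. 0 \<le> L \<Longrightarrow> \<exists>C M0. 0 \<le> C \<and> concavity_bound u v L C M0"
  shows "\<exists>M>0. \<forall>x\<in>ball 0 r. \<forall>y\<in>ball 0 r. u x - v y \<le> S + M * sqrt (norm (x - y))"
proof -
  define R where "R = (1 + r) / 2"
  define h where "h = (R - r) / 2"
  have rR: "r < R" "R < 1" and h: "0 < h" "h \<le> 1" using r by (auto simp: R_def h_def field_simps)
  \<comment> \<open>forces \<open>norm (xb - x0) < h\<close>\<close>
  define L where "L = K / h\<^sup>2"
  have L: "0 < L" using K0 h by (simp add: L_def)
  obtain C M0 where C: "0 \<le> C" and cb: "concavity_bound u v L C M0" using CB[of L] L by auto
  define E where "E = 3 + 3 / 2 * K + K\<^sup>2 / 4"
  have E: "0 \<le> E" using K0 by (simp add: E_def)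
  define M where "M = 1 + K + K / h + 2 * \<bar>M0\<bar> + 4 * C * E"
  have Kh: "0 \<le> K / h" using K0 h by simp
  have CE: "0 \<le> 4 * C * E" using C E by simp
  have M: "1 \<le> M" "K \<le> M" "K / h \<le> M" "2 * M0 \<le> M" "4 * C * E < M"
    using K0 Kh CE unfolding M_def by linarith+
  have M0': "0 < M" using M by simp
  have "u x0 - v y0 \<le> S + M * sqrt (norm (x0 - y0))" if x0: "x0 \<in> ball 0 r" and y0: "y0 \<in> ball 0 r" for x0 y0
  proof (rule ccontr)
    assume "\<not> ?thesis"
    then have viol: "S + M * sqrt (norm (x0 - y0)) < u x0 - v y0" by simp
    have small: "sqrt t < 1 \<and> sqrt t < h" if "0 < t" "M * sqrt t < K" for t
    proof -
      have "M * sqrt t < M * 1" using that(2) M(2) by simp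
      then have "sqrt t < 1" using M0' by (simp only: mult_less_cancel_left_pos)
      moreover have "K \<le> M * h" using M(3) h by (simp add: divide_le_eq)
      then have "M * sqrt t < M * h" using that(2) by simp
      then have "sqrt t < h" using M0' by (simp only: mult_less_cancel_left_pos)
      ultimately show ?thesis by simp
    qed
    obtain xb yb \<rho> where xb: "xb \<in> ball 0 R" and yb: "yb \<in> ball 0 R" and ne: "xb \<noteq> yb" and \<rho>: "0 < \<rho>"
      and gt: "L * (norm (xb - x0))\<^sup>2 + M * sqrt (norm (xb - yb)) < u xb - v yb - S"
      and mx: "\<forall>x\<in>ball xb \<rho>. \<forall>y\<in>ball yb \<rho>. u x - v y - M * sqrt (norm (x - y)) - L * (norm (x - x0))\<^sup>2
        \<le> u xb - v yb - M * sqrt (norm (xb - yb)) - L * (norm (xb - x0))\<^sup>2"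
    proof (rule doubled_maximum[where \<psi>="\<lambda>t. M * sqrt t", OF u v rR _ _ less_imp_le[OF L] diag K _ _ x0 y0 viol])
      show "continuous_on {0..} (\<lambda>t. M * sqrt t)" by (intro continuous_intros)
      show "K \<le> L * ((R - r) / 2)\<^sup>2" using h by (simp add: L_def h_def[symmetric])
      show "t < (R - r) / 2" if "0 < t" "M * sqrt t < K" for t
      proof -
        have "t = sqrt t * sqrt t" using that by simp
        also have "\<dots> < h * 1" using small[OF that] that h by (intro mult_strict_mono) auto
        finally show ?thesis by (simp add: h_def)
      qed
    qed (use M0' in auto)
    define s where "s = norm (xb - yb)"
    define d where "d = norm (xb - x0)"
    define y where "y = sqrt s"
    have s: "0 < s" using ne by (simp add: s_def)
    have y: "0 < y" "s = y\<^sup>2" using s by (auto simp: y_def)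
    have xb1: "xb \<in> ball 0 1" and yb1: "yb \<in> ball 0 1" and x01: "x0 \<in> ball 0 1" using xb yb x0 rR by auto
    have d: "0 \<le> d" "d \<le> 2" using norm_triangle_ineq4[of xb x0] xb1 x01 by (auto simp: d_def)
    have "0 \<le> L * (norm (xb - x0))\<^sup>2" using L by simp
    then have My: "M * y < K" using gt K[OF xb1 yb1] unfolding y_def s_def by linarith
    then have y1: "y < 1" using small[OF s] by (simp add: y_def)
    have der: "\<forall>t>0. ((\<lambda>t. M * sqrt t) has_real_derivative M / (2 * sqrt t)) (at t)"
      by (auto intro!: derivative_eq_intros simp: field_simps)
    have der2: "((\<lambda>t. M / (2 * sqrt t)) has_real_derivative - (M / (4 * y ^ 3))) (at s)"
      using y by (auto intro!: derivative_eq_intros simp: power2_eq_square power3_eq_cube field_simps)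
    have \<kappa>: "0 < M / (4 * y ^ 3)" using M0' y by simp
    have m: "M0 \<le> M / (2 * sqrt s)"
    proof -
      have "M0 * y \<le> M / 2"
      proof (cases "0 \<le> M0")
        case True
        then have "M0 * y \<le> M0 * 1" using y1 by (intro mult_left_mono) auto
        then show ?thesis using M(4) by simp
      next
        case False
        then have "M0 * y \<le> 0" using y by (simp add: mult_nonpos_nonneg)
        then show ?thesis using M0' by simp
      qed
      then show ?thesis using y by (simp add: y_def[symmetric] field_simps)
    qed
    have "M / (4 * y ^ 3) \<le> C * (1 + d / s + M / (2 * sqrt s) + s * (M / (2 * sqrt s))\<^sup>2 + d * (M / (2 * sqrt s)))"
      using cb[unfolded concavity_bound_def, rule_format, OF xb1 yb1 x01 ne der[rule_format] _ \<kappa> _ \<rho> mx[rule_format]]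
        der2 m unfolding s_def d_def by blast
    then have "M / (4 * y ^ 3) * (4 * y ^ 3) \<le> C * (1 + d / y\<^sup>2 + M / (2 * y) + y\<^sup>2 * (M / (2 * y))\<^sup>2 + d * (M / (2 * y))) * (4 * y ^ 3)"
      using y by (intro mult_right_mono) (auto simp: y_def[symmetric])
    also have "M / (4 * y ^ 3) * (4 * y ^ 3) = M" using y by simp
    also have "C * (1 + d / y\<^sup>2 + M / (2 * y) + y\<^sup>2 * (M / (2 * y))\<^sup>2 + d * (M / (2 * y))) * (4 * y ^ 3)
       = 4 * C * (y ^ 3 + d * y + (M * y) * y / 2 + (M * y)\<^sup>2 * y / 4 + d * ((M * y) * y) / 2)"
      using y(1) by (simp add: field_simps power2_eq_square power3_eq_cube)
    also have "\<dots> \<le> 4 * C * E"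
    proof (intro mult_left_mono)
      have My0: "0 \<le> M * y" using M0' y by simp
      have "y ^ 3 \<le> 1" using y y1 by (intro power_le_one) auto
      moreover have "d * y \<le> 2 * 1" using d y y1 by (intro mult_mono) auto
      moreover have a1: "(M * y) * y \<le> K * 1" using My My0 y y1 K0 by (intro mult_mono) auto
      moreover have "(M * y)\<^sup>2 * y \<le> K\<^sup>2 * 1" using My My0 y y1 K0 by (intro mult_mono power_mono) auto
      moreover have "d * ((M * y) * y) \<le> 2 * (K * 1)" by (rule mult_mono) (use d a1 My0 y in auto)
      ultimately show "y ^ 3 + d * y + (M * y) * y / 2 + (M * y)\<^sup>2 * y / 4 + d * ((M * y) * y) / 2 \<le> E"
        unfolding E_def by linarith
    qed (use C in simp)
    finally show False using M(5) by simp
  qed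
  then show ?thesis using M0' by blast
qed


lemma fourth_root_powers:
  assumes "0 < t"
  shows "0 < sqrt (sqrt t) \<and> sqrt t = (sqrt (sqrt t))\<^sup>2 \<and> t = (sqrt (sqrt t)) ^ 4"
proof -
  have "(sqrt (sqrt t)) ^ 4 = ((sqrt (sqrt t))\<^sup>2)\<^sup>2" by (simp flip: power_mult)
  then show ?thesis using assms by simp
qed

text \<open>
  For \<open>\<psi> t = M (t - (2/5) t^(5/4))\<close> and \<open>w = s^(1/4)\<close> one has \<open>\<kappa> = M / (8 w^3)\<close>, while \<open>M / 2 \<le> \<psi>' s \<le> M\<close>
  and \<open>M w^4 \<le> 2 K\<close>. The Hoelder estimate gives \<open>d \<le> C1 w\<close>, so \<open>d / s \<le> C1 / w^3\<close> is of the same order as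
  \<open>\<kappa> / M\<close>. After multiplication by \<open>8 w^3\<close> the concavity bound reads \<open>M \<le> O(1) + O(w) M\<close>, and \<open>w\<close> is small
  for large \<open>M\<close>.
\<close>
lemma lipschitz_step:
  fixes u v :: "real^'n \<Rightarrow> real"
  assumes u: "usc_on (ball 0 1) u" and v: "lsc_on (ball 0 1) v" and r: "0 < r" "r < 1"
    and diag: "\<And>z. z \<in> ball 0 1 \<Longrightarrow> u z - v z \<le> S"
    and K: "\<And>x y. x \<in> ball 0 1 \<Longrightarrow> y \<in> ball 0 1 \<Longrightarrow> u x - v y - S \<le> K" and K0: "0 < K"
    and CB: "\<And>L. 0 \<le> L \<Longrightarrow> \<exists>C M0. 0 \<le> C \<and> concavity_bound u v L C M0"
  shows "\<exists>M. \<forall>x\<in>ball 0 r. \<forall>y\<in>ball 0 r. u x - v y \<le> S + M * norm (x - y)"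
proof -
  define R where "R = (1 + r) / 2"
  define h where "h = (R - r) / 2"
  have rR: "0 < R" "r < R" "R < 1" and h: "0 < h" using r by (auto simp: R_def h_def field_simps)
  obtain M1 where M1: "0 < M1" and hold: "\<And>x y. x \<in> ball 0 R \<Longrightarrow> y \<in> ball 0 R \<Longrightarrow> u x - v y \<le> S + M1 * sqrt (norm (x - y))"
    using holder_step[OF u v rR(1,3) diag K K0 CB] by blast
  \<comment> \<open>forces \<open>norm (xb - x0) < h\<close>\<close>
  define L where "L = K / h\<^sup>2"
  have L: "0 < L" using K0 h by (simp add: L_def)
  obtain C M0 where C: "0 \<le> C" and cb: "concavity_bound u v L C M0" using CB[of L] L by auto
  define C1 where "C1 = sqrt (M1 / L)"
  have C1: "0 \<le> C1" "C1\<^sup>2 = M1 / L" using M1 L by (auto simp: C1_def)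
  define G where "G = 32 * C * (3 + 2 * K)"
  have G: "0 \<le> G" using C K0 by (simp add: G_def)
  define \<zeta> where "\<zeta> = 1 / (1 + G)"
  have \<zeta>: "0 < \<zeta>" "\<zeta> \<le> 1" "G * \<zeta> \<le> 1" using G by (auto simp: \<zeta>_def field_simps)
  define M where "M = 1 + 2 * K / h + 2 * K / \<zeta> ^ 4 + 2 * \<bar>M0\<bar> + 32 * C * (1 + C1)"
  have pos: "0 \<le> 2 * K / h" "0 \<le> 2 * K / \<zeta> ^ 4" "0 \<le> 32 * C * (1 + C1)"
    using K0 h \<zeta> C C1 by simp_all
  have M: "1 \<le> M" "2 * K / h \<le> M" "2 * K / \<zeta> ^ 4 \<le> M" "2 * M0 \<le> M" "32 * C * (1 + C1) \<le> M"
    using pos unfolding M_def by linarith+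
  have M0': "0 < M" using M by simp
  define \<psi> where "\<psi> = (\<lambda>t. M * (t - 2 / 5 * (t * sqrt (sqrt t))))"
  define d\<psi> where "d\<psi> = (\<lambda>t. M * (1 - sqrt (sqrt t) / 2))"
  have lower: "M * t / 2 \<le> \<psi> t" if t: "0 \<le> t" "t \<le> 2" for t
  proof -
    have "sqrt t \<le> 25 / 16"
      by (rule real_le_lsqrt) (use t in \<open>simp_all add: power2_eq_square\<close>)
    then have "sqrt (sqrt t) \<le> 5 / 4"
      by (intro real_le_lsqrt) (use t in \<open>simp_all add: power2_eq_square\<close>)
    then have "t * sqrt (sqrt t) \<le> t * (5 / 4)" using t by (intro mult_left_mono) auto
    then have "t / 2 \<le> t - 2 / 5 * (t * sqrt (sqrt t))" by linarith
    then have "M * (t / 2) \<le> \<psi> t" unfolding \<psi>_def using M0' by (intro mult_left_mono) auto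
    then show ?thesis by simp
  qed
  have upper: "\<psi> t \<le> M * t" if "0 \<le> t" for t
    unfolding \<psi>_def using M0' that by (intro mult_left_mono) auto
  have "u x0 - v y0 \<le> S + M * norm (x0 - y0)" if x0: "x0 \<in> ball 0 r" and y0: "y0 \<in> ball 0 r" for x0 y0
  proof (rule ccontr)
    assume "\<not> ?thesis"
    then have viol: "S + \<psi> (norm (x0 - y0)) < u x0 - v y0" using upper[of "norm (x0 - y0)"] by simp
    obtain xb yb \<rho> where xb: "xb \<in> ball 0 R" and yb: "yb \<in> ball 0 R" and ne: "xb \<noteq> yb" and \<rho>: "0 < \<rho>"
      and gt: "L * (norm (xb - x0))\<^sup>2 + \<psi> (norm (xb - yb)) < u xb - v yb - S"
      and mx: "\<forall>x\<in>ball xb \<rho>. \<forall>y\<in>ball yb \<rho>. u x - v y - \<psi> (norm (x - y)) - L * (norm (x - x0))\<^sup>2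
        \<le> u xb - v yb - \<psi> (norm (xb - yb)) - L * (norm (xb - x0))\<^sup>2"
    proof (rule doubled_maximum[where \<psi>=\<psi>, OF u v rR(2,3) _ _ less_imp_le[OF L] diag K _ _ x0 y0 viol])
      show "continuous_on {0..} \<psi>" unfolding \<psi>_def by (intro continuous_intros)
      show "K \<le> L * ((R - r) / 2)\<^sup>2" using h by (simp add: L_def h_def[symmetric])
      show "0 \<le> \<psi> t" if "0 \<le> t" "t \<le> 2" for t
        using lower[OF that] that M0' by (meson order_trans divide_nonneg_nonneg mult_nonneg_nonneg less_imp_le zero_le_numeral)
      show "t < (R - r) / 2" if t: "0 < t" "t \<le> 2" "\<psi> t < K" for t
      proof -
        have "2 * K \<le> M * h" using M(2) h by (simp add: divide_le_eq)
        then have "M * t < M * h" using lower[of t] t by linarith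
        then show ?thesis using M0' by (simp only: mult_less_cancel_left_pos h_def[symmetric])
      qed
    qed
    define s where "s = norm (xb - yb)"
    define d where "d = norm (xb - x0)"
    define w where "w = sqrt (sqrt s)"
    have s: "0 < s" using ne by (simp add: s_def)
    have w: "0 < w" "sqrt s = w\<^sup>2" "s = w ^ 4"
      unfolding w_def using fourth_root_powers[OF s] by blast+
    have xb1: "xb \<in> ball 0 1" and yb1: "yb \<in> ball 0 1" and x01: "x0 \<in> ball 0 1" using xb yb x0 rR by auto
    have d: "0 \<le> d" "d \<le> 2" using norm_triangle_ineq4[of xb x0] xb1 x01 by (auto simp: d_def)
    have s2: "s \<le> 2" using norm_triangle_ineq4[of xb yb] xb1 yb1 by (simp add: s_def)
    have Ld: "0 \<le> L * d\<^sup>2" using L by simp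
    have \<psi>s: "M * s / 2 \<le> \<psi> s" using lower[of s] s s2 by simp
    have Ms: "M * s < 2 * K" using gt K[OF xb1 yb1] Ld \<psi>s unfolding s_def d_def by linarith
    have w\<zeta>: "w < \<zeta>"
    proof -
      have "2 * K \<le> M * \<zeta> ^ 4" using M(3) \<zeta> by (simp add: divide_le_eq)
      then have "M * w ^ 4 < M * \<zeta> ^ 4" using Ms unfolding w(3)[symmetric] by linarith
      then have "w ^ 4 < \<zeta> ^ 4" using M0' by (simp only: mult_less_cancel_left_pos)
      then show ?thesis by (rule power_less_imp_less_base) (use \<zeta> in simp)
    qed
    have w1: "w < 1" using w\<zeta> \<zeta> by linarith
    have dw: "d \<le> C1 * w"
    proof -
      have "L * d\<^sup>2 \<le> M1 * sqrt s"
      proof -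
        have "0 \<le> M * s / 2" using M0' s by simp
        then show ?thesis using gt hold[OF xb yb] \<psi>s unfolding s_def d_def by linarith
      qed
      then have "d\<^sup>2 \<le> M1 / L * w\<^sup>2" using L unfolding w(2) by (simp add: field_simps)
      then have "d\<^sup>2 \<le> (C1 * w)\<^sup>2" by (simp add: power_mult_distrib C1)
      then show ?thesis by (rule power2_le_imp_le) (use C1 w in simp)
    qed
    have der: "(\<psi> has_real_derivative d\<psi> t) (at t)" if t: "0 < t" for t
    proof -
      define q where "q = sqrt (sqrt t)"
      have q: "0 < q" "sqrt t = q\<^sup>2" "t = q ^ 4"
        unfolding q_def using fourth_root_powers[OF t] by blast+
      have d1: "(\<psi> has_real_derivative M * (1 - 2 / 5 * (sqrt (sqrt t) + t * (inverse (sqrt (sqrt t)) / 2 * (inverse (sqrt t) / 2))))) (at t)"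
        unfolding \<psi>_def using t by (auto intro!: derivative_eq_intros simp: mult_ac)
      have eq: "sqrt (sqrt t) + t * (inverse (sqrt (sqrt t)) / 2 * (inverse (sqrt t) / 2)) = 5 / 4 * q"
        unfolding q_def[symmetric] q(2) using q(1) by (subst q(3)) (simp add: field_simps power2_eq_square power4_eq_xxxx)
      show ?thesis using d1[unfolded eq] by (simp add: d\<psi>_def q_def)
    qed
    have der2: "(d\<psi> has_real_derivative - (M / (8 * w ^ 3))) (at s)"
    proof -
      have d1: "(d\<psi> has_real_derivative M * (- (inverse (sqrt (sqrt s)) / 2 * (inverse (sqrt s) / 2)) / 2)) (at s)"
        unfolding d\<psi>_def using s by (auto intro!: derivative_eq_intros)
      have eq: "M * (- (inverse (sqrt (sqrt s)) / 2 * (inverse (sqrt s) / 2)) / 2) = - (M / (8 * w ^ 3))"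
        unfolding w_def[symmetric] w(2) using w(1) by (simp add: field_simps power2_eq_square power3_eq_cube)
      show ?thesis using d1 unfolding eq .
    qed
    have \<kappa>: "0 < M / (8 * w ^ 3)" using M0' w by simp
    define m where "m = d\<psi> s"
    have m: "M / 2 \<le> m" "m \<le> M" "0 \<le> m"
    proof -
      have "M * (1 / 2) \<le> M * (1 - w / 2)" using w1 M0' by (intro mult_left_mono) auto
      moreover have "M * (1 - w / 2) \<le> M * 1" using w M0' by (intro mult_left_mono) auto
      ultimately show "M / 2 \<le> m" "m \<le> M" unfolding m_def d\<psi>_def w_def[symmetric] by simp_all
      then show "0 \<le> m" using M0' by linarith
    qed
    have mM0: "M0 \<le> d\<psi> s" using m M(4) unfolding m_def by linarith
    have "M / (8 * w ^ 3) \<le> C * (1 + d / s + d\<psi> s + s * (d\<psi> s)\<^sup>2 + d * d\<psi> s)"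
      using cb[unfolded concavity_bound_def, rule_format, OF xb1 yb1 x01 ne der _ \<kappa> _ \<rho> mx[rule_format]]
        der2 mM0 unfolding s_def d_def by blast
    also have "\<dots> = C * (1 + d / s + m + s * m\<^sup>2 + d * m)" by (simp add: m_def)
    also have "\<dots> \<le> C * (1 + C1 / w ^ 3 + M + s * M\<^sup>2 + 2 * M)"
    proof (intro mult_left_mono add_mono order_refl)
      have "d / s \<le> C1 * w / w ^ 4" unfolding w(3) using dw w(1) by (intro divide_right_mono) auto
      also have "\<dots> = C1 / w ^ 3" using w(1) by (simp add: power4_eq_xxxx power3_eq_cube)
      finally show "d / s \<le> C1 / w ^ 3" .
      show "m \<le> M" by (rule m)
      show "m\<^sup>2 \<le> M\<^sup>2" using m by (intro power_mono) auto
      show "0 \<le> s" using s by simp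
      show "d * m \<le> 2 * M" using d m by (intro mult_mono) auto
    qed (rule C)
    finally have "M / (8 * w ^ 3) * (8 * w ^ 3) \<le> C * (1 + C1 / w ^ 3 + M + s * M\<^sup>2 + 2 * M) * (8 * w ^ 3)"
      using w by (intro mult_right_mono) auto
    also have "M / (8 * w ^ 3) * (8 * w ^ 3) = M" using w by simp
    also have "C * (1 + C1 / w ^ 3 + M + s * M\<^sup>2 + 2 * M) * (8 * w ^ 3)
       = 8 * C * (w ^ 3 + C1) + 8 * C * ((3 + M * s) * w ^ 3) * M"
      using w(1) by (simp add: field_simps power2_eq_square)
    also have "\<dots> \<le> 8 * C * (1 + C1) + 8 * C * ((3 + 2 * K) * \<zeta>) * M"
    proof (intro add_mono mult_left_mono mult_right_mono)
      show "w ^ 3 \<le> 1" using w w1 by (intro power_le_one) auto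
      have "w ^ 3 \<le> w ^ 1" using w w1 by (intro power_decreasing) auto
      then have "w ^ 3 \<le> \<zeta>" using w\<zeta> by simp
      then show "(3 + M * s) * w ^ 3 \<le> (3 + 2 * K) * \<zeta>" using Ms K0 w by (intro mult_mono) auto
    qed (use C M0' in auto)
    also have "8 * C * ((3 + 2 * K) * \<zeta>) * M = (G * \<zeta>) * (M / 4)" by (simp add: G_def)
    also have "8 * C * (1 + C1) + (G * \<zeta>) * (M / 4) \<le> M / 4 + 1 * (M / 4)"
      using M(5) \<zeta>(3) M0' by (intro add_mono mult_right_mono) auto
    finally show False using M0' by simp
  qed
  then show ?thesis by blast
qed

theorem theorem2p1:
  fixes F :: "real^'n \<Rightarrow> real^'n^'n \<Rightarrow> real"
    and b f g u v :: "real^'n \<Rightarrow> real"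
    and \<alpha> \<beta> :: real
  assumes "\<alpha> > -1" and "0 < \<beta>" and "\<beta> \<le> \<alpha> + 2"
    and "structural_assms \<alpha> F"
    and "\<exists>L. L-lipschitz_on (ball 0 1) b"
    and "bounded (f ` ball 0 1)" and "continuous_on (ball 0 1) f"
    and "bounded (g ` ball 0 1)" and "continuous_on (ball 0 1) g"
    and "bounded (u ` ball 0 1)" and "viscosity_subsolution F b \<beta> g (ball 0 1) u"
    and "bounded (v ` ball 0 1)" and "viscosity_supersolution F b \<beta> f (ball 0 1) v"
  shows "\<forall>r. 0 < r \<and> r < 1 \<longrightarrow>
    (\<exists>c\<^sub>r. \<forall>x\<in>ball 0 r. \<forall>y\<in>ball 0 r.
       u x - v y \<le> (SUP z\<in>ball 0 1. u z - v z) + c\<^sub>r * norm (x - y))"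
proof (intro allI impI)
  fix r :: real assume r: "0 < r \<and> r < 1"
  let ?\<Omega> = "ball 0 1 :: (real^'n) set"
  obtain Lb where Lb: "Lb-lipschitz_on ?\<Omega> b" using assms(5) by blast
  have bounded_abs: "\<exists>B. \<forall>x\<in>?\<Omega>. \<bar>w x\<bar> \<le> B" if "bounded (w ` ?\<Omega>)" for w :: "real^'n \<Rightarrow> real"
    using that unfolding bounded_iff by auto
  obtain B1 B2 B3 B4 where "\<forall>x\<in>?\<Omega>. \<bar>u x\<bar> \<le> B1" "\<forall>x\<in>?\<Omega>. \<bar>v x\<bar> \<le> B2" "\<forall>x\<in>?\<Omega>. \<bar>f x\<bar> \<le> B3" "\<forall>x\<in>?\<Omega>. \<bar>g x\<bar> \<le> B4"
    using bounded_abs assms(6,8,10,12) by metis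
  then have "\<bar>u x\<bar> \<le> max (max B1 B2) (max B3 B4) \<and> \<bar>v x\<bar> \<le> max (max B1 B2) (max B3 B4)
      \<and> \<bar>f x\<bar> \<le> max (max B1 B2) (max B3 B4) \<and> \<bar>g x\<bar> \<le> max (max B1 B2) (max B3 B4)" if "x \<in> ?\<Omega>" for x
    using that by (auto simp: le_max_iff_disj)
  then obtain K where K: "\<And>x. x \<in> ?\<Omega> \<Longrightarrow> \<bar>u x\<bar> \<le> K \<and> \<bar>v x\<bar> \<le> K \<and> \<bar>f x\<bar> \<le> K \<and> \<bar>g x\<bar> \<le> K" by blast
  define S where "S = (SUP z\<in>?\<Omega>. u z - v z)"
  have diag: "u z - v z \<le> S" if "z \<in> ?\<Omega>" for z
    unfolding S_def
  proof (rule cSUP_upper[OF that bdd_aboveI2])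
    show "u z - v z \<le> 2 * K" if "z \<in> ?\<Omega>" for z using K[OF that] by (auto simp: abs_le_iff)
  qed
  have CB: "\<exists>C M0. 0 \<le> C \<and> concavity_bound u v L C M0" if L: "0 \<le> L" for L
    by (rule concavity_bound_at_maximum[OF assms(1,3,4) Lb assms(7,9) K assms(11,13) L]) blast+
  show "\<exists>c\<^sub>r. \<forall>x\<in>ball 0 r. \<forall>y\<in>ball 0 r. u x - v y \<le> (SUP z\<in>ball 0 1. u z - v z) + c\<^sub>r * norm (x - y)"
    unfolding S_def[symmetric]
  proof (rule lipschitz_step[OF _ _ _ _ diag _ _ CB, where K = "4 * \<bar>K\<bar> + 1"])
    show "usc_on ?\<Omega> u" using assms(11) by (simp add: viscosity_subsolution_def)
    show "lsc_on ?\<Omega> v" using assms(13) by (simp add: viscosity_supersolution_def)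
    show "u x - v y - S \<le> 4 * \<bar>K\<bar> + 1" if "x \<in> ?\<Omega>" "y \<in> ?\<Omega>" for x y
      using K[OF that(1)] K[OF that(2)] diag[OF that(1)] unfolding abs_le_iff by linarith
  qed (use r in auto)
qed

end
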